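(* Let $T:[0,\infty)\to[0,1]$ be as in the context (a map generating a $C^{1,1}(L)$-version of the $\beta$-transformation), let $T_a(x)=T(ax)$ for $x\in[0,1]$, $a>1$, and let $\mu_a$ be the unique absolutely continuous invariant probability measure of $T_a$. If $X:(1,\infty)\to(0,1]$ is $C^1$ and $X'(a)\ge 0$ for all $a>1$, then $X(a)$ is typical for $\mu_a$ for Lebesgue a.e. $a>1$.
   Context: A function is $C^{1,1}(L)$ if it is $C^1$ and its derivative is Lipschitz with constant at most $L$. Let $0=b_0<b_1<\dots$ be real numbers with $b_k\to\infty$, let $L>0$, and let $T:[0,\infty)\to[0,1]$ be a right continuous function which is $C^{1,1}(L)$ on each interval $[b_k,b_{k+1})$, $k\ge0$, such that $T(b_k)=0$ for each $k\ge0$ and, for each $a>1$, $1<\inf_{x\in[0,1]}\partial_xT(ax)$ and $\sup_{x\in[0,1]}\partial_xT(ax)<\infty$ (derivatives at the points $b_k/a$ being right derivatives). For each $a>1$ the map $T_a:[0,1]\to[0,1]$, $T_a(x)=T(ax)$, has a unique absolutely continuous invariant probability measure $\mu_a$. A point $x\in[0,1]$ is typical for $\mu_a$ if $\frac1n\sum_{i=0}^{n-1}\delta_{T_a^i(x)}\to\mu_a$ in the weak-$*$ topology as $n\to\infty$. *)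

theory Defs
  imports "HOL-Probability.Probability"
begin

text \<open>\<open>C\<^sup>1\<close> with \<open>L\<close>-Lipschitz derivative. The derivative is taken within \<open>S\<close>, so it is
  one-sided at an end point of an interval belonging to that interval.\<close>

definition C11_on :: "real \<Rightarrow> (real \<Rightarrow> real) \<Rightarrow> real set \<Rightarrow> bool" where
  "C11_on L f S \<longleftrightarrow>
     (\<exists>f'. (\<forall>x\<in>S. (f has_real_derivative f' x) (at x within S))
         \<and> continuous_on S f' \<and> L-lipschitz_on S f')"

definition right_deriv :: "(real \<Rightarrow> real) \<Rightarrow> real \<Rightarrow> real" where
  "right_deriv f x = (THE D. (f has_real_derivative D) (at_right x))"

text \<open>Self-maps of the unit interval are functions on \<^typ>\<open>real\<close> whose values outside
  \<open>[0,1]\<close> are irrelevant; measures live on \<open>[0,1]\<close> with its Borel sets.\<close>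

definition is_acip :: "(real \<Rightarrow> real) \<Rightarrow> real measure \<Rightarrow> bool" where
  "is_acip f \<mu> \<longleftrightarrow>
     prob_space \<mu>
   \<and> sets \<mu> = sets (restrict_space borel {0..1})
   \<and> absolutely_continuous (restrict_space lborel {0..1}) \<mu>
   \<and> f \<in> measurable \<mu> \<mu> \<and> distr \<mu> \<mu> f = \<mu>"

text \<open>Only meaningful for maps with exactly one absolutely continuous invariant probability
  measure.\<close>

definition acip :: "(real \<Rightarrow> real) \<Rightarrow> real measure" where
  "acip f = (THE \<mu>. is_acip f \<mu>)"

text \<open>The measure \<open>(1/n) \<Sum>i<n. \<delta>\<close> with \<open>\<delta>\<close> the point mass at \<open>(f ^^ i) x\<close>, as the
  push-forward of the uniform distribution on \<open>{..<n}\<close>. The case \<open>n = 0\<close> is a junk value.\<close>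

definition empirical_measure :: "(real \<Rightarrow> real) \<Rightarrow> real \<Rightarrow> nat \<Rightarrow> real measure" where
  "empirical_measure f x n =
     distr (uniform_count_measure {..<n}) (restrict_space borel {0..1}) (\<lambda>i. (f ^^ i) x)"

definition weak_star_conv :: "(nat \<Rightarrow> real measure) \<Rightarrow> real measure \<Rightarrow> bool" where
  "weak_star_conv M \<mu> \<longleftrightarrow>
     (\<forall>\<phi> :: real \<Rightarrow> real. continuous_on {0..1} \<phi> \<longrightarrow>
        (\<lambda>n. integral\<^sup>L (M n) \<phi>) \<longlonglongrightarrow> integral\<^sup>L \<mu> \<phi>)"

definition typical :: "(real \<Rightarrow> real) \<Rightarrow> real measure \<Rightarrow> real \<Rightarrow> bool" where
  "typical f \<mu> x \<longleftrightarrow> weak_star_conv (empirical_measure f x) \<mu>"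

lemma integral_empirical_measure:
  fixes \<phi> :: "real \<Rightarrow> real"
  assumes f: "f ` {0..1} \<subseteq> {0..1}" and x: "x \<in> {0..1}"
    and \<phi>: "\<phi> \<in> borel_measurable (restrict_space borel {0..1})"
  shows "integral\<^sup>L (empirical_measure f x n) \<phi> = (\<Sum>i<n. \<phi> ((f ^^ i) x)) / real n"
proof -
  have orb: "(f ^^ i) x \<in> {0..1}" for i
    using f x by (induction i) (auto simp del: atLeastAtMost_iff)
  have m: "(\<lambda>i. (f ^^ i) x) \<in> measurable (uniform_count_measure {..<n}) (restrict_space borel {0..1})"
    using orb by (auto simp: measurable_def space_uniform_count_measure
        sets_uniform_count_measure space_restrict_space)
  have "integral\<^sup>L (empirical_measure f x n) \<phi>
      = integral\<^sup>L (uniform_count_measure {..<n}) (\<lambda>i. \<phi> ((f ^^ i) x))"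
    unfolding empirical_measure_def by (rule integral_distr[OF m \<phi>])
  also have "\<dots> = (\<Sum>i<n. \<phi> ((f ^^ i) x)) / real n"
    by (simp add: uniform_count_measure_def lebesgue_integral_point_measure_finite
        sum_divide_distrib)
  finally show ?thesis .
qed

end

theory Submission
  imports Defs
begin

text \<open>
  Both \<open>a \<mapsto> T\<^sub>a\<^sup>n (X a)\<close> and the iterates of a single \<open>T\<^sub>a\<close> are instances of one recursion
  \<open>y\<^sub>0 = g\<close>, \<open>y\<^sub>n\<^sub>+\<^sub>1(s) = \<alpha>(s) T(y\<^sub>n(s))\<close> with \<open>\<alpha>\<close> nondecreasing and \<open>g\<close> expanding. Every \<open>y\<^sub>n\<close> is
  increasing with bounded distortion on the cylinders of order \<open>n\<close>, and, as every branch of \<open>T\<close>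
  starts at height \<open>0\<close>, it maps each cylinder but the leftmost onto an interval starting at \<open>0\<close>.

  For a Lipschitz bump \<open>\<phi>\<close> supported in an interval of length \<open>\<epsilon>\<close> and small \<open>\<theta> > 0\<close> let \<open>E\<^sub>n\<close> be the
  exponential of \<open>\<theta>\<close> times the number of visits (weighted by \<open>\<phi>\<close>) before time \<open>n\<close>. Let \<open>mass n\<close> be the
  integral of \<open>E\<^sub>n\<close>, and \<open>S n\<close> the sum over left end points of cylinders of \<open>E\<^sub>n\<close> divided by the
  derivative. Cutting a cylinder at a discontinuity requires its image to be long, so the new
  terms of \<open>S\<close> are bounded by \<open>mass\<close>: \<open>S (n+1) \<le> r S n + C mass n\<close> with \<open>r < 1\<close>, whereas
  \<open>mass (n+1) \<le> mass n + C \<theta> \<epsilon> S (n+1)\<close>. Hence \<open>mass n \<le> C e\<^bsup>C\<theta>\<epsilon>n\<^esup>\<close> with \<open>C\<close> independent of \<open>\<phi>\<close>, and by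
  Markov's inequality and Borel--Cantelli almost every orbit visits an interval of length \<open>\<epsilon>\<close> with
  frequency at most \<open>C \<epsilon>\<close>. Every weak limit of the empirical measures then has bounded density and
  is invariant; in particular an absolutely continuous invariant measure exists.

  For uniqueness, the same recursion with \<open>\<theta> = 0\<close> and constant \<open>\<alpha>\<close> gives \<open>\<delta>, \<kappa> > 0\<close> such that every
  interval \<open>J\<close> has an \<open>n\<close> with \<open>|J \<inter> T\<^sub>a\<^sup>-\<^sup>n E| \<ge> \<kappa> |J| |E|\<close> for all Borel \<open>E \<subseteq> [0,\<delta>)\<close>. If \<open>h\<^sub>1, h\<^sub>2\<close> are
  two invariant densities, \<open>A = {h\<^sub>1 > h\<^sub>2}\<close> is forward invariant up to a null set, so
  \<open>|J - A| \<ge> \<kappa> |J| |[0,\<delta>) - A|\<close> for all \<open>J\<close>, hence for all Borel sets in place of \<open>J\<close>; taking \<open>A\<close> shows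
  that \<open>A\<close> is null or contains \<open>[0,\<delta>)\<close> up to a null set. The same holds for the disjoint set
  \<open>{h\<^sub>2 > h\<^sub>1}\<close>, so both are null.
\<close>


section \<open>Piecewise expanding maps and distortion\<close>

locale branch_points =
  fixes b :: "nat \<Rightarrow> real"
  assumes b_0: "b 0 = 0" and b_strict: "strict_mono b" and b_unbounded: "filterlim b at_top sequentially"
begin

definition branch :: "real \<Rightarrow> nat" where
  "branch y = (LEAST k. y < b (Suc k))"

lemma b_mono: "i \<le> j \<Longrightarrow> b i \<le> b j"
  using b_strict by (simp add: strict_mono_less_eq)

lemma b_nonneg: "0 \<le> b k"
  using b_mono[of 0 k] b_0 by simp

lemma b_1_pos: "0 < b 1"
  using b_strict b_0 by (metis strict_mono_less zero_less_one)

lemma ex_branch: "\<exists>k. y < b (Suc k)"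
proof -
  from b_unbounded have "eventually (\<lambda>k. y < b k) sequentially"
    by (simp add: filterlim_at_top_dense)
  then obtain N where "\<forall>k\<ge>N. y < b k"
    by (auto simp: eventually_sequentially)
  then show ?thesis by (intro exI[of _ N]) simp
qed

lemma less_b_Suc_branch: "y < b (Suc (branch y))"
  unfolding branch_def by (rule LeastI_ex[OF ex_branch])

lemma b_branch_le:
  assumes "0 \<le> y" shows "b (branch y) \<le> y"
proof (cases "branch y")
  case 0
  then show ?thesis using assms b_0 by simp
next
  case (Suc j)
  then have "j < (LEAST k. y < b (Suc k))" by (simp add: branch_def)
  from not_less_Least[OF this] show ?thesis using Suc by simp
qed

lemma branch_eqI:
  assumes "b k \<le> y" "y < b (Suc k)" shows "branch y = k"
proof -
  have "branch y \<le> k" unfolding branch_def by (rule Least_le) fact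
  moreover have "k < Suc (branch y)"
    using assms less_b_Suc_branch[of y] b_strict by (meson le_less_trans strict_mono_less)
  ultimately show ?thesis by simp
qed

lemma branch_b [simp]: "branch (b k) = k"
  using b_strict by (intro branch_eqI) (auto simp: strict_mono_less)

lemma branch_mono: "0 \<le> x \<Longrightarrow> x \<le> y \<Longrightarrow> branch x \<le> branch y"
  unfolding branch_def[of x]
  by (rule Least_le) (use less_b_Suc_branch[of y] in linarith)

lemma finite_branches: "finite {k. b k \<le> x}"
proof -
  obtain k where "x < b (Suc k)" using ex_branch by blast
  then have "{k. b k \<le> x} \<subseteq> {..k}"
    by (auto simp: not_less_eq_eq[symmetric]) (meson b_mono le_less_trans less_le_not_le not_less_eq_eq order_trans)
  then show ?thesis by (rule finite_subset) simp
qed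

end

text \<open>The function \<open>d\<close> stands for the derivative of \<open>T\<close>, known only
  through estimates whose distortion is exponential in the distance. The derivative estimates stop
  at \<open>R\<close>, since expansion is available only on the bounded range that the orbits
  visit.\<close>

locale expanding_branches = branch_points b
  for T d :: "real \<Rightarrow> real" and b :: "nat \<Rightarrow> real" and R m H :: real +
  assumes T_b: "T (b k) = 0"
    and T_range: "0 \<le> y \<Longrightarrow> 0 \<le> T y \<and> T y \<le> 1"
    and T_cont: "continuous_on {b k..<b (Suc k)} T"
    and m_pos: "0 < m" and H_nonneg: "0 \<le> H"
    and d_ge: "0 \<le> x \<Longrightarrow> x \<le> R \<Longrightarrow> m \<le> d x"
    and T_expand: "b k \<le> x \<Longrightarrow> x \<le> y \<Longrightarrow> y < b (Suc k) \<Longrightarrow> y \<le> R \<Longrightarrow> m * (y - x) \<le> T y - T x"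
    and T_lower: "b k \<le> x \<Longrightarrow> x \<le> y \<Longrightarrow> y < b (Suc k) \<Longrightarrow> y \<le> R \<Longrightarrow>
        d x * exp (- H * (y - x)) * (y - x) \<le> T y - T x"
    and T_upper: "b k \<le> x \<Longrightarrow> x \<le> y \<Longrightarrow> y < b (Suc k) \<Longrightarrow> y \<le> R \<Longrightarrow>
        T y - T x \<le> d x * exp (H * (y - x)) * (y - x)"
    and d_lower: "b k \<le> x \<Longrightarrow> x \<le> y \<Longrightarrow> y < b (Suc k) \<Longrightarrow> y \<le> R \<Longrightarrow> d x * exp (- H * (y - x)) \<le> d y"
    and d_upper: "b k \<le> x \<Longrightarrow> x \<le> y \<Longrightarrow> y < b (Suc k) \<Longrightarrow> y \<le> R \<Longrightarrow> d y \<le> d x * exp (H * (y - x))"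
begin

lemma T_on_branch:
  assumes "0 \<le> x" "x \<le> y" "y \<le> R" "branch x = branch y"
  shows "m * (y - x) \<le> T y - T x"
    and "d x * exp (- H * (y - x)) * (y - x) \<le> T y - T x"
    and "T y - T x \<le> d x * exp (H * (y - x)) * (y - x)"
    and "d x * exp (- H * (y - x)) \<le> d y"
    and "d y \<le> d x * exp (H * (y - x))"
proof -
  have *: "b (branch x) \<le> x" "y < b (Suc (branch x))"
    using assms b_branch_le[of x] less_b_Suc_branch[of y] by auto
  show "m * (y - x) \<le> T y - T x" "d x * exp (- H * (y - x)) * (y - x) \<le> T y - T x"
    "T y - T x \<le> d x * exp (H * (y - x)) * (y - x)" "d x * exp (- H * (y - x)) \<le> d y"
    "d y \<le> d x * exp (H * (y - x))"
    using T_expand[OF *(1) assms(2) *(2) assms(3)] T_lower[OF *(1) assms(2) *(2) assms(3)]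
      T_upper[OF *(1) assms(2) *(2) assms(3)] d_lower[OF *(1) assms(2) *(2) assms(3)]
      d_upper[OF *(1) assms(2) *(2) assms(3)] by auto
qed

text \<open>Values of \<open>T\<close> on the negative axis are arbitrary; precomposing with
  \<open>max 0\<close> gives a function on the whole line, glued from the negative axis and
  countably many half-open branches.\<close>

lemma T_borel: "(\<lambda>y. T (max 0 y)) \<in> borel_measurable borel"
proof -
  define S where "S k = (if k = 0 then {..<0} else {b (k - 1)..<b k})" for k
  have "(\<lambda>y. T (max 0 y)) \<in> borel_measurable (restrict_space borel (S k))" for k
  proof (cases k)
    case 0
    then show ?thesis
      by (subst measurable_cong[where g = "\<lambda>_. T 0"]) (auto simp: space_restrict_space S_def)
  next
    case (Suc j)
    have "T \<in> borel_measurable (restrict_space borel {b j..<b (Suc j)})"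
      by (rule borel_measurable_continuous_on_restrict[OF T_cont])
    then show ?thesis using Suc b_nonneg[of j]
      by (subst measurable_cong[where g = T]) (auto simp: space_restrict_space S_def)
  qed
  moreover have "y \<in> (\<Union>k. S k)" for y
  proof (cases "y < 0")
    case True then show ?thesis by (intro UN_I[of 0]) (auto simp: S_def)
  next
    case False then show ?thesis using b_branch_le[of y] less_b_Suc_branch[of y]
      by (intro UN_I[of "Suc (branch y)"]) (auto simp: S_def)
  qed
  moreover have "S k \<in> sets borel" for k by (simp add: S_def)
  ultimately have *: "\<forall>k. (\<lambda>y. T (max 0 y)) \<in> borel_measurable (restrict_space borel (S k))"
    "\<forall>k. S k \<in> sets borel" "(\<Union>k. S k) = UNIV" by blast+
  show ?thesis
  proof (rule measurable_piecewise_restrict)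
    show "countable (range S)" by simp
  qed (use * in \<open>auto simp: image_iff\<close>)
qed

end

text \<open>Two instances matter: \<open>\<alpha> s = s\<close> with \<open>g s = s * X s\<close>,
  where \<open>y n s\<close> is \<open>s\<close> times the n-th iterate of \<open>X s\<close>, and
  constant \<open>\<alpha>\<close> with linear \<open>g\<close>, where \<open>y n s\<close> is a
  multiple of the n-th iterate of \<open>s\<close>. The product \<open>A * m\<close> is the least
  expansion per step.\<close>

locale expanding_family = expanding_branches +
  fixes \<alpha> g :: "real \<Rightarrow> real" and p q A c0 C0 :: real
  assumes p_less_q: "p < q"
    and \<alpha>_mono: "p \<le> s \<Longrightarrow> s \<le> t \<Longrightarrow> t < q \<Longrightarrow> \<alpha> s \<le> \<alpha> t"
    and \<alpha>_lipschitz: "p \<le> s \<Longrightarrow> s \<le> t \<Longrightarrow> t < q \<Longrightarrow> \<alpha> t - \<alpha> s \<le> t - s"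
    and \<alpha>_bounds: "p \<le> s \<Longrightarrow> s < q \<Longrightarrow> A \<le> \<alpha> s \<and> \<alpha> s \<le> R"
    and A_pos: "0 < A" and expansion: "1 < A * m"
    and c0_pos: "0 < c0"
    and g_expand: "p \<le> s \<Longrightarrow> s \<le> t \<Longrightarrow> t < q \<Longrightarrow> c0 * (t - s) \<le> g t - g s"
    and g_lipschitz: "p \<le> s \<Longrightarrow> s \<le> t \<Longrightarrow> t < q \<Longrightarrow> g t - g s \<le> C0 * (t - s)"
    and g_bounds: "p \<le> s \<Longrightarrow> s < q \<Longrightarrow> 0 \<le> g s \<and> g s \<le> R"
begin

abbreviation "lam \<equiv> A * m"

primrec y :: "nat \<Rightarrow> real \<Rightarrow> real" where
  "y 0 s = g s"
| "y (Suc n) s = \<alpha> s * T (y n s)"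

text \<open>The formal derivative of \<open>n\<close> steps with frozen \<open>\<alpha> s\<close>;
  by \<open>dy_ge\<close> and \<open>dy_le\<close> it is comparable to the slope of
  \<open>y n\<close>.\<close>

definition w :: "nat \<Rightarrow> real \<Rightarrow> real" where
  "w n s = (\<Prod>j<n. \<alpha> s * d (y j s))"

definition same :: "nat \<Rightarrow> real \<Rightarrow> real \<Rightarrow> bool" where
  "same n s t \<longleftrightarrow> (\<forall>i<n. branch (y i s) = branch (y i t))"

lemma w_0 [simp]: "w 0 s = 1" by (simp add: w_def)
lemma w_Suc: "w (Suc n) s = w n s * (\<alpha> s * d (y n s))" by (simp add: w_def)

lemma same_sym: "same n s t \<Longrightarrow> same n t s" by (simp add: same_def)
lemma same_trans: "same n s t \<Longrightarrow> same n t u \<Longrightarrow> same n s u" by (simp add: same_def)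
lemma same_le: "same n s t \<Longrightarrow> k \<le> n \<Longrightarrow> same k s t" by (simp add: same_def)
lemma same_0 [simp]: "same 0 s t" by (simp add: same_def)
lemma same_Suc: "same (Suc n) s t \<longleftrightarrow> same n s t \<and> branch (y n s) = branch (y n t)"
  by (auto simp: same_def less_Suc_eq)

lemma y_bounds:
  assumes "p \<le> s" "s < q" shows "0 \<le> y n s" "y n s \<le> R"
proof -
  have "0 \<le> y n s \<and> y n s \<le> R"
  proof (induction n)
    case 0
    show ?case using g_bounds[OF assms] by simp
  next
    case (Suc n)
    have "0 \<le> T (y n s)" "T (y n s) \<le> 1" using T_range Suc by auto
    moreover have "0 < \<alpha> s" "\<alpha> s \<le> R" using \<alpha>_bounds[OF assms] A_pos by auto
    moreover have "\<alpha> s * T (y n s) \<le> \<alpha> s * 1" using calculation by (intro mult_left_mono) auto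
    ultimately show ?case by (simp, linarith)
  qed
  then show "0 \<le> y n s" "y n s \<le> R" by auto
qed

lemma C0_pos: "0 < C0"
proof -
  define r where "r = (p + q) / 2"
  have r: "p < r" "r < q" using p_less_q by (auto simp: r_def)
  have "c0 * (r - p) \<le> C0 * (r - p)"
    using g_expand[of p r] g_lipschitz[of p r] r by linarith
  then have "c0 \<le> C0" using r by (simp add: mult_le_cancel_right)
  then show ?thesis using c0_pos by simp
qed

lemma U_pos_aux: "0 < C0 + 1 / (lam - 1)"
  using C0_pos expansion by (simp add: add_pos_pos)

lemma \<alpha>_pos: "p \<le> s \<Longrightarrow> s < q \<Longrightarrow> 0 < \<alpha> s" using \<alpha>_bounds A_pos by force

lemma R_pos: "0 < R" using \<alpha>_bounds[of p] A_pos p_less_q by force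

lemma deriv_ge: "p \<le> s \<Longrightarrow> s < q \<Longrightarrow> lam \<le> \<alpha> s * d (y n s)"
  using \<alpha>_bounds[of s] d_ge[of "y n s"] y_bounds[of s n] A_pos m_pos
  by (intro mult_mono) auto

lemma w_ge:
  assumes "p \<le> s" "s < q" shows "lam ^ n \<le> w n s"
proof -
  have "(\<Prod>j<n. lam) \<le> w n s"
    unfolding w_def using deriv_ge[OF assms] expansion by (intro prod_mono) auto
  then show ?thesis by simp
qed

lemma w_pos: "p \<le> s \<Longrightarrow> s < q \<Longrightarrow> 0 < w n s"
  using w_ge[of s n] expansion by (meson less_le_trans less_trans zero_less_one zero_less_power)

lemma w_Suc_ge: "p \<le> s \<Longrightarrow> s < q \<Longrightarrow> lam * w n s \<le> w (Suc n) s"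
  using deriv_ge[of s n] w_pos[of s n] by (simp add: w_Suc mult.commute)

text \<open>The increment splits into \<open>\<alpha> s * (T (y n t) - T (y n s))\<close> and the
  drift \<open>(\<alpha> t - \<alpha> s) * T (y n t)\<close>. The drift lies between 0 and
  \<open>t - s\<close> because \<open>\<alpha>\<close> is nondecreasing and 1-Lipschitz and
  \<open>T\<close> takes values in the unit interval.\<close>

lemma y_step:
  assumes "p \<le> s" "s \<le> t" "t < q" "y n s \<le> y n t" "branch (y n s) = branch (y n t)"
  shows "lam * (y n t - y n s) \<le> y (Suc n) t - y (Suc n) s"
    and "\<alpha> s * (d (y n s) * exp (- H * (y n t - y n s)) * (y n t - y n s)) \<le> y (Suc n) t - y (Suc n) s"
    and "y (Suc n) t - y (Suc n) s \<le>
      \<alpha> s * (d (y n s) * exp (H * (y n t - y n s)) * (y n t - y n s)) + (t - s)"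
    and "A * (T (y n t) - T (y n s)) \<le> y (Suc n) t - y (Suc n) s"
proof -
  have I: "s < q" "p \<le> t" using assms by auto
  have eq: "y (Suc n) t - y (Suc n) s = \<alpha> s * (T (y n t) - T (y n s)) + (\<alpha> t - \<alpha> s) * T (y n t)"
    by (simp add: algebra_simps)
  note b = T_on_branch[OF y_bounds(1)[OF assms(1) I(1)] assms(4) y_bounds(2)[OF I(2) assms(3)] assms(5)]
  have T01: "0 \<le> T (y n t)" "T (y n t) \<le> 1" using T_range y_bounds(1)[OF I(2) assms(3)] by auto
  have 0: "0 \<le> (\<alpha> t - \<alpha> s) * T (y n t)" using \<alpha>_mono[OF assms(1-3)] T01 by simp
  have 1: "(\<alpha> t - \<alpha> s) * T (y n t) \<le> (t - s) * 1"
    using \<alpha>_lipschitz[OF assms(1-3)] \<alpha>_mono[OF assms(1-3)] T01 assms by (intro mult_mono) auto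
  have a: "0 < \<alpha> s" "A \<le> \<alpha> s" using \<alpha>_pos \<alpha>_bounds assms I by auto
  have b0: "0 \<le> m * (y n t - y n s)" using m_pos assms by simp
  then have T0: "0 \<le> T (y n t) - T (y n s)" using b(1) by linarith
  show 4: "A * (T (y n t) - T (y n s)) \<le> y (Suc n) t - y (Suc n) s"
    using mult_right_mono[OF a(2) T0] 0 eq by linarith
  have "A * (m * (y n t - y n s)) \<le> A * (T (y n t) - T (y n s))"
    using b(1) A_pos by (intro mult_left_mono) auto
  then show "lam * (y n t - y n s) \<le> y (Suc n) t - y (Suc n) s"
    using 4 by (simp only: mult.assoc)
  show "\<alpha> s * (d (y n s) * exp (- H * (y n t - y n s)) * (y n t - y n s)) \<le> y (Suc n) t - y (Suc n) s"
    using mult_left_mono[OF b(2) less_imp_le[OF a(1)]] 0 eq by linarith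
  show "y (Suc n) t - y (Suc n) s \<le>
      \<alpha> s * (d (y n s) * exp (H * (y n t - y n s)) * (y n t - y n s)) + (t - s)"
    using add_mono[OF mult_left_mono[OF b(3) less_imp_le[OF a(1)]] 1] by (simp only: eq mult_1_right)
qed

section \<open>Monotonicity and bounded distortion along a common itinerary\<close>

lemma y_mono:
  assumes "p \<le> s" "s \<le> t" "t < q" "same n s t"
  shows "y n s \<le> y n t"
  using assms(4)
proof (induction n)
  case 0
  have "0 \<le> c0 * (t - s)" using assms c0_pos by simp
  then show ?case using g_expand[OF assms(1-3)] by simp
next
  case (Suc n)
  then have *: "y n s \<le> y n t" "branch (y n s) = branch (y n t)" by (auto simp: same_Suc)
  have "0 \<le> lam * (y n t - y n s)" using * expansion by simp
  then show ?case using y_step(1)[OF assms(1-3) *] by linarith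
qed

text \<open>Gaps grow at least by the factor \<open>lam\<close> per step, so all earlier gaps
  together are dominated by the last one. This keeps the accumulated distortion bounded.\<close>

lemma sum_dy_le:
  assumes "p \<le> s" "s \<le> t" "t < q" "same n s t"
  shows "(\<Sum>j<n. y j t - y j s) \<le> (y n t - y n s) / (lam - 1)"
  using assms(4)
proof (induction n)
  case 0
  then show ?case using y_mono[OF assms(1-3), of 0] expansion by simp
next
  case (Suc n)
  have sn: "same n s t" "branch (y n s) = branch (y n t)" using Suc by (auto simp: same_Suc)
  have 1: "lam * (y n t - y n s) \<le> y (Suc n) t - y (Suc n) s"
    using y_step(1)[OF assms(1-3) y_mono[OF assms(1-3) sn(1)] sn(2)] .
  have "(\<Sum>j<Suc n. y j t - y j s) \<le> (y n t - y n s) / (lam - 1) + (y n t - y n s)"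
    using Suc.IH[OF sn(1)] by simp
  also have "\<dots> = lam * (y n t - y n s) / (lam - 1)"
    using expansion by (simp add: field_simps)
  also have "\<dots> \<le> (y (Suc n) t - y (Suc n) s) / (lam - 1)"
    using 1 expansion by (intro divide_right_mono) auto
  finally show ?case .
qed

definition D :: real where "D = H * (R / (lam - 1))"

lemma sum_dy_le_D:
  assumes "p \<le> s" "s \<le> t" "t < q" "same n s t"
  shows "H * (\<Sum>j<n. y j t - y j s) \<le> D"
proof -
  have "(y n t - y n s) / (lam - 1) \<le> R / (lam - 1)"
    using y_bounds[of s n] y_bounds[of t n] assms expansion by (intro divide_right_mono) auto
  then have "(\<Sum>j<n. y j t - y j s) \<le> R / (lam - 1)"
    using sum_dy_le[OF assms] by linarith
  then show ?thesis unfolding D_def using H_nonneg by (intro mult_left_mono)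
qed

lemma dy_ge_aux:
  assumes "p \<le> s" "s \<le> t" "t < q" "same n s t"
  shows "w n s * exp (- H * (\<Sum>j<n. y j t - y j s)) * (g t - g s) \<le> y n t - y n s"
  using assms(4)
proof (induction n)
  case 0 then show ?case by simp
next
  case (Suc n)
  have sn: "same n s t" "branch (y n s) = branch (y n t)" using Suc by (auto simp: same_Suc)
  have I: "s < q" using assms by auto
  let ?e = "\<alpha> s * (d (y n s) * exp (- H * (y n t - y n s)))"
  have "0 < \<alpha> s * d (y n s)"
    using deriv_ge[OF assms(1) I, of n] expansion by linarith
  then have e: "0 \<le> ?e" by (simp add: mult.assoc[symmetric])
  have "w (Suc n) s * exp (- H * (\<Sum>j<Suc n. y j t - y j s)) * (g t - g s)
     = ?e * (w n s * exp (- H * (\<Sum>j<n. y j t - y j s)) * (g t - g s))"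
    by (simp add: w_Suc distrib_left exp_add exp_minus exp_diff field_simps)
  also have "\<dots> \<le> ?e * (y n t - y n s)"
    using Suc.IH[OF sn(1)] e by (intro mult_left_mono)
  also have "\<dots> \<le> y (Suc n) t - y (Suc n) s"
    using y_step(2)[OF assms(1-3) y_mono[OF assms(1-3) sn(1)] sn(2)] by (simp only: mult.assoc)
  finally show ?case .
qed

lemma dy_ge:
  assumes "p \<le> s" "s \<le> t" "t < q" "same n s t"
  shows "exp (- D) * c0 * w n s * (t - s) \<le> y n t - y n s"
proof -
  have I: "s < q" using assms by auto
  have "exp (- D) * c0 * w n s * (t - s) = w n s * exp (- D) * (c0 * (t - s))" by simp
  also have "\<dots> \<le> w n s * exp (- H * (\<Sum>j<n. y j t - y j s)) * (g t - g s)"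
    using sum_dy_le_D[OF assms] g_expand[OF assms(1-3)] w_pos[OF assms(1) I, of n] c0_pos assms
    by (intro mult_mono) auto
  also have "\<dots> \<le> y n t - y n s" by (rule dy_ge_aux[OF assms])
  finally show ?thesis .
qed

text \<open>As for \<open>dy_ge\<close>, but the last step applies \<open>T\<close> without the
  factor \<open>\<alpha> s\<close>, whence the division by \<open>R\<close>. It bounds the length of
  a set of parameters in a cylinder for which \<open>T (y n s)\<close> lies in a given
  interval.\<close>

lemma dT_ge:
  assumes "p \<le> s" "s \<le> t" "t < q" "same (Suc n) s t"
  shows "exp (- D) * c0 / R * w (Suc n) s * (t - s) \<le> T (y n t) - T (y n s)"
proof -
  have I: "s < q" "p \<le> t" using assms by auto
  have sn: "same n s t" "branch (y n s) = branch (y n t)" using assms by (auto simp: same_Suc)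
  have d0: "0 < d (y n s)" using d_ge[of "y n s"] y_bounds[OF assms(1) I(1), of n] m_pos by linarith
  have w0: "0 < w n s" using w_pos assms I by blast
  have a: "0 < \<alpha> s" "\<alpha> s \<le> R" using \<alpha>_pos \<alpha>_bounds assms I by auto
  have "exp (- D) * c0 / R * w (Suc n) s * (t - s) = (\<alpha> s / R) * (w n s * d (y n s) * (exp (- D) * (c0 * (t - s))))"
    by (simp add: w_Suc)
  also have "\<dots> \<le> 1 * (w n s * d (y n s) * (exp (- D) * (c0 * (t - s))))"
    using a d0 w0 R_pos assms c0_pos by (intro mult_right_mono) auto
  also have "\<dots> \<le> w n s * d (y n s) * (exp (- H * (\<Sum>j<Suc n. y j t - y j s)) * (g t - g s))"
    using sum_dy_le_D[OF assms] g_expand[OF assms(1-3)] w0 d0 c0_pos assms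
    by (simp only: mult_1) (intro mult_left_mono mult_mono, auto)
  also have "\<dots> = d (y n s) * exp (- H * (y n t - y n s)) *
      (w n s * exp (- H * (\<Sum>j<n. y j t - y j s)) * (g t - g s))"
    by (simp add: distrib_left exp_add exp_minus exp_diff field_simps)
  also have "\<dots> \<le> d (y n s) * exp (- H * (y n t - y n s)) * (y n t - y n s)"
    using dy_ge_aux[OF assms(1-3) sn(1)] d0 by (intro mult_left_mono) auto
  also have "\<dots> \<le> T (y n t) - T (y n s)"
    using T_on_branch(2)[OF y_bounds(1)[OF assms(1) I(1)] y_mono[OF assms(1-3) sn(1)] y_bounds(2)[OF I(2) assms(3)] sn(2)] .
  finally show ?thesis .
qed

text \<open>The factors \<open>\<alpha> t / \<alpha> s\<close> are at least 1 by monotonicity, so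
  only the distortion of \<open>d\<close> is lost. The reverse bound \<open>w_upper\<close> is
  stated for constant \<open>\<alpha>\<close>, where these factors equal 1.\<close>

lemma w_lower:
  assumes "p \<le> s" "s \<le> t" "t < q" "same n s t"
  shows "exp (- D) * w n s \<le> w n t"
proof -
  have I: "s < q" "p \<le> t" using assms by auto
  have "w n s * exp (- H * (\<Sum>j<n. y j t - y j s)) \<le> w n t"
    using assms(4)
  proof (induction n)
    case 0 then show ?case by simp
  next
    case (Suc n)
    have sn: "same n s t" "branch (y n s) = branch (y n t)" using Suc by (auto simp: same_Suc)
    have d0: "0 < d (y n s)" using d_ge[of "y n s"] y_bounds[OF assms(1) I(1), of n] m_pos by linarith
    have "w (Suc n) s * exp (- H * (\<Sum>j<Suc n. y j t - y j s))
      = (w n s * exp (- H * (\<Sum>j<n. y j t - y j s))) * (\<alpha> s * (d (y n s) * exp (- H * (y n t - y n s))))"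
      by (simp add: w_Suc distrib_left exp_add exp_minus exp_diff field_simps)
    also have "\<dots> \<le> w n t * (\<alpha> t * d (y n t))"
      using Suc.IH[OF sn(1)] \<alpha>_mono[OF assms(1-3)] \<alpha>_pos[OF assms(1) I(1)] \<alpha>_pos[OF I(2) assms(3)] w_pos[OF I(2) assms(3), of n] d0
        T_on_branch(4)[OF y_bounds(1)[OF assms(1) I(1)] y_mono[OF assms(1-3) sn(1)] y_bounds(2)[OF I(2) assms(3)] sn(2)]
      by (intro mult_mono) auto
    finally show ?case by (simp add: w_Suc)
  qed
  moreover have "exp (- D) * w n s \<le> w n s * exp (- H * (\<Sum>j<n. y j t - y j s))"
    using sum_dy_le_D[OF assms] w_pos[OF assms(1) I(1), of n] by (simp add: mult.commute)
  ultimately show ?thesis by linarith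
qed

definition U :: real where "U = exp D * (C0 + 1 / (lam - 1))"

text \<open>Each step adds a drift of at most \<open>t - s\<close>. Measured against
  \<open>w (Suc n) s \<ge> lam ^ Suc n\<close> these drifts form a geometric series, whose sum
  \<open>1 / (lam - 1)\<close> enters \<open>U\<close> next to the Lipschitz constant
  \<open>C0\<close> of \<open>g\<close>.\<close>

lemma dy_le:
  assumes "p \<le> s" "s \<le> t" "t < q" "same n s t"
  shows "y n t - y n s \<le> U * w n s * (t - s)"
proof -
  have I: "s < q" "p \<le> t" using assms by auto
  have "y n t - y n s \<le> w n s * exp (H * (\<Sum>j<n. y j t - y j s)) * ((C0 + (\<Sum>j<n. (1 / lam) ^ Suc j)) * (t - s))"
    using assms(4)
  proof (induction n)
    case 0 then show ?case using g_lipschitz[OF assms(1-3)] by simp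
  next
    case (Suc n)
    have sn: "same n s t" "branch (y n s) = branch (y n t)" using Suc by (auto simp: same_Suc)
    have ym: "y n s \<le> y n t" by (rule y_mono[OF assms(1-3) sn(1)])
    have d0: "0 < d (y n s)" using d_ge[of "y n s"] y_bounds[OF assms(1) I(1), of n] m_pos by linarith
    have a0: "0 < \<alpha> s" using \<alpha>_pos assms I by auto
    let ?S = "C0 + (\<Sum>j<n. (1 / lam) ^ Suc j)"
    let ?X = "exp (H * (\<Sum>j<Suc n. y j t - y j s))"
    have X1: "1 \<le> ?X" using ym assms H_nonneg
      by (simp, intro mult_nonneg_nonneg add_nonneg_nonneg sum_nonneg)
         (use y_mono[OF assms(1-3) same_le[OF sn(1)]] in auto)
    have W1: "1 \<le> w (Suc n) s * (1 / lam) ^ Suc n"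
      using w_ge[OF assms(1) I(1), of "Suc n"] expansion zero_less_power[of lam "Suc n"]
      by (simp only: power_divide power_one) (simp add: divide_simps del: power_Suc)
    have "y (Suc n) t - y (Suc n) s \<le>
      \<alpha> s * (d (y n s) * exp (H * (y n t - y n s)) * (y n t - y n s)) + (t - s)"
      using y_step(3)[OF assms(1-3) ym sn(2)] .
    also have "\<dots> \<le> \<alpha> s * (d (y n s) * exp (H * (y n t - y n s)) *
        (w n s * exp (H * (\<Sum>j<n. y j t - y j s)) * (?S * (t - s)))) + (t - s)"
      using Suc.IH[OF sn(1)] d0 a0 by (intro add_right_mono mult_left_mono) auto
    also have "\<dots> = w (Suc n) s * ?X * (?S * (t - s)) + 1 * (t - s)"
      by (simp add: w_Suc distrib_left exp_add)
    also have "\<dots> \<le> w (Suc n) s * ?X * (?S * (t - s)) + (w (Suc n) s * (1 / lam) ^ Suc n * ?X) * (t - s)"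
    proof -
      have "1 * 1 \<le> (w (Suc n) s * (1 / lam) ^ Suc n) * ?X" using X1 W1 by (intro mult_mono) auto
      then show ?thesis using assms by (intro add_left_mono mult_right_mono) auto
    qed
    also have "\<dots> = w (Suc n) s * ?X * ((C0 + (\<Sum>j<Suc n. (1 / lam) ^ Suc j)) * (t - s))"
      by (simp add: algebra_simps)
    finally show ?case .
  qed
  also have "\<dots> \<le> w n s * exp D * ((C0 + 1 / (lam - 1)) * (t - s))"
  proof -
    have "(\<Sum>j<n. (1 / lam) ^ Suc j) = (1 / lam) * (\<Sum>j<n. (1 / lam) ^ j)"
      by (simp add: sum_distrib_left)
    also have "\<dots> = (1 - (1 / lam) ^ n) / (lam - 1)"
      using expansion by (subst sum_gp_strict) (auto simp: field_simps)
    also have "\<dots> \<le> 1 / (lam - 1)" using expansion by (intro divide_right_mono) auto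
    finally have 1: "(\<Sum>j<n. (1 / lam) ^ Suc j) \<le> 1 / (lam - 1)" .
    have C0: "0 \<le> C0 * (t - s)"
      using C0_pos assms by simp
    have "0 \<le> (\<Sum>j<n. (1 / lam) ^ Suc j) * (t - s)" using expansion assms
      by (intro mult_nonneg_nonneg sum_nonneg) auto
    then have 2: "0 \<le> (C0 + (\<Sum>j<n. (1 / lam) ^ Suc j)) * (t - s)" using C0 by (simp add: distrib_right)
    show ?thesis
      using 1 2 sum_dy_le_D[OF assms] w_pos[OF assms(1) I(1), of n] assms C0_pos expansion
      by (intro mult_mono) auto
  qed
  also have "\<dots> = U * w n s * (t - s)" by (simp add: U_def)
  finally show ?thesis .
qed

end

section \<open>Cylinders\<close>

context expanding_family
begin

lemma y_strict:
  assumes "p \<le> s" "s < t" "t < q" "same n s t"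
  shows "y n s < y n t"
proof -
  have "0 < exp (- D) * c0 * w n s * (t - s)"
    using assms w_pos[of s n] c0_pos by (intro mult_pos_pos) auto
  then show ?thesis using dy_ge[of s t n] assms by linarith
qed

text \<open>Cylinders are convex: monotonicity of each \<open>y i\<close> squeezes the branch index
  of an intermediate point between two equal values.\<close>

lemma same_between:
  assumes "p \<le> l" "l \<le> s" "s \<le> t" "t < q" "same n l t"
  shows "same n l s"
  using assms(5)
proof (induction n)
  case 0 then show ?case by simp
next
  case (Suc n)
  then have lt: "same n l t" "branch (y n l) = branch (y n t)" by (auto simp: same_Suc)
  from Suc.IH[OF lt(1)] have ls: "same n l s" .
  then have st: "same n s t" using lt by (metis same_sym same_trans)
  have "y n l \<le> y n s" "y n s \<le> y n t"
    using y_mono ls st assms by auto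
  then have "branch (y n l) \<le> branch (y n s)" "branch (y n s) \<le> branch (y n t)"
    using y_bounds assms by (auto intro!: branch_mono)
  then show ?case using ls lt by (simp add: same_Suc)
qed

lemma \<alpha>_continuous: "continuous_on {p..<q} \<alpha>"
proof (rule lipschitz_on_continuous_on)
  show "1-lipschitz_on {p..<q} \<alpha>"
  proof (rule lipschitz_on_leI)
    fix s t assume "s \<in> {p..<q}" "t \<in> {p..<q}" "s \<le> t"
    then show "dist (\<alpha> s) (\<alpha> t) \<le> 1 * dist s t"
      using \<alpha>_mono[of s t] \<alpha>_lipschitz[of s t] by (simp add: dist_real_def)
  qed auto
qed

lemma g_continuous: "continuous_on {p..<q} g"
proof (rule lipschitz_on_continuous_on)
  show "C0-lipschitz_on {p..<q} g"
  proof (rule lipschitz_on_leI)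
    fix s t assume "s \<in> {p..<q}" "t \<in> {p..<q}" "s \<le> t"
    then show "dist (g s) (g t) \<le> C0 * dist s t"
      using g_lipschitz[of s t] order_trans[OF mult_nonneg_nonneg[of c0 "t - s"] g_expand[of s t]] c0_pos
      by (auto simp: dist_real_def)
  qed (use C0_pos in auto)
qed

lemma y_continuous:
  assumes "p \<le> l" "l \<le> t" "t < q" "same n l t"
  shows "continuous_on {l..t} (y n)"
  using assms(4)
proof (induction n)
  case 0
  then show ?case using assms by (auto intro!: continuous_on_subset[OF g_continuous])
next
  case (Suc n)
  then have lt: "same n l t" "branch (y n l) = branch (y n t)" by (auto simp: same_Suc)
  have "y n ` {l..t} \<subseteq> {b (branch (y n l))..<b (Suc (branch (y n l)))}"
  proof safe
    fix s assume s: "s \<in> {l..t}"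
    then have "same (Suc n) l s" using same_between[of l s t "Suc n"] assms Suc by auto
    then have "branch (y n s) = branch (y n l)" by (simp add: same_Suc)
    then show "y n s \<in> {b (branch (y n l))..<b (Suc (branch (y n l)))}"
      using b_branch_le[of "y n s"] less_b_Suc_branch[of "y n s"] y_bounds[of s n] s assms by auto
  qed
  then have "continuous_on {l..t} (\<lambda>s. T (y n s))"
    by (rule continuous_on_compose2[OF T_cont Suc.IH[OF lt(1)]])
  moreover have "continuous_on {l..t} \<alpha>"
    using assms by (auto intro!: continuous_on_subset[OF \<alpha>_continuous])
  ultimately show ?case by (simp add: continuous_on_mult)
qed

section \<open>Left end points and the partition into cylinders\<close>

text \<open>The left end points of the cylinders of order \<open>n\<close>: the orbit of such a point other than \<open>p\<close>
  hits a discontinuity \<open>b k\<close>, \<open>k \<ge> 1\<close>, before time \<open>n\<close> and stays at \<open>0\<close> from then on.\<close>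

definition base :: "nat \<Rightarrow> real set" where
  "base n = insert p {s. p \<le> s \<and> s < q \<and> (\<exists>i<n. \<exists>k\<ge>1. y i s = b k)}"

definition cyl :: "nat \<Rightarrow> real \<Rightarrow> real set" where
  "cyl n l = {t. p \<le> t \<and> t < q \<and> same n l t}"

lemma base_D: "l \<in> base n \<Longrightarrow> p \<le> l" "l \<in> base n \<Longrightarrow> l < q"
  using p_less_q by (auto simp: base_def)

lemma p_in_base: "p \<in> base n" by (simp add: base_def)

lemma base_0: "base 0 = {p}" by (simp add: base_def)

lemma base_mono: "base n \<subseteq> base (Suc n)"
  by (auto simp: base_def intro: less_SucI)

lemma base_Suc_newD:
  assumes "s \<in> base (Suc n)" "s \<notin> base n"
  shows "p \<le> s" "s < q" "y n s = b (branch (y n s))" "1 \<le> branch (y n s)"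
  using assms by (auto simp: base_def less_Suc_eq)

text \<open>If \<open>y n\<close> leaves its branch between \<open>l\<close> and \<open>t\<close>,
  continuity makes it cross \<open>b k\<close>, where \<open>k\<close> is the branch of
  \<open>y n t\<close>. The crossing point is the left end point at the next order.\<close>

lemma ex_base:
  assumes "p \<le> t" "t < q"
  shows "\<exists>l\<in>base n. l \<le> t \<and> same n l t"
proof (induction n)
  case 0
  show ?case using assms p_in_base by (intro bexI[of _ p]) auto
next
  case (Suc n)
  then obtain l where l: "l \<in> base n" "l \<le> t" "same n l t" by blast
  note lb = base_D[OF l(1)]
  show ?case
  proof (cases "branch (y n l) = branch (y n t)")
    case True
    then show ?thesis using l base_mono by (auto simp: same_Suc)
  next
    case False
    let ?k = "branch (y n t)"
    have mono: "y n l \<le> y n t" using y_mono[of l t n] lb l assms by auto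
    have nn: "0 \<le> y n l" "0 \<le> y n t" using y_bounds lb assms by auto
    have lt: "branch (y n l) < ?k" using branch_mono[OF nn(1) mono] False by simp
    have "y n l < b ?k"
      using lt less_b_Suc_branch[of "y n l"] b_mono[of "Suc (branch (y n l))" ?k] by auto
    moreover have "b ?k \<le> y n t" using b_branch_le[OF nn(2)] .
    ultimately obtain s where s: "l \<le> s" "s \<le> t" "y n s = b ?k"
      using IVT'[of "y n" l "b ?k" t] y_continuous[of l t n] l lb assms by auto
    have "same n l s" using same_between[of l s t n] s l lb assms by auto
    then have "same n s t" using l by (metis same_sym same_trans)
    moreover have "s \<in> base (Suc n)"
      unfolding base_def using s lb assms lt
      by (intro insertI2 CollectI conjI exI[of _ n] exI[of _ ?k]) auto
    ultimately show ?thesis using s by (auto simp: same_Suc)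
  qed
qed

text \<open>The point \<open>l'\<close> hits some \<open>b k\<close> at a time \<open>i < n\<close>;
  as \<open>y i\<close> is strictly increasing on the cylinder, its value at \<open>l\<close> lies
  below \<open>b k\<close>, hence in an earlier branch.\<close>

lemma base_unique_aux:
  assumes "l \<in> base n" "l' \<in> base n" "same n l l'" "l < l'"
  shows False
proof -
  have "l' \<noteq> p" using assms base_D[of l n] by auto
  then obtain i k where i: "i < n" "1 \<le> k" "y i l' = b k" using assms(2) by (auto simp: base_def)
  have "y i l < y i l'" using y_strict[of l l' i] same_le[OF assms(3), of i] base_D assms i by auto
  then have "branch (y i l) \<noteq> k"
    using less_b_Suc_branch[of "y i l"] b_branch_le[of "y i l"] i y_bounds[of l i] base_D[OF assms(1)]
    by auto
  moreover have "branch (y i l) = branch (y i l')" using assms(3) i by (simp add: same_def)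
  ultimately show False using i by simp
qed

lemma base_unique:
  assumes "l \<in> base n" "l' \<in> base n" "same n l l'"
  shows "l = l'"
  using base_unique_aux[of l n l'] base_unique_aux[of l' n l] assms same_sym[OF assms(3)] by (meson linorder_neqE)

lemma cyl_D:
  assumes "l \<in> base n" "t \<in> cyl n l"
  shows "p \<le> l" "l \<le> t" "t < q" "same n l t" "p \<le> t" "l < q"
proof -
  have t: "p \<le> t" "t < q" "same n l t" using assms by (auto simp: cyl_def)
  obtain l' where l': "l' \<in> base n" "l' \<le> t" "same n l' t" using ex_base t by blast
  have "l = l'" using base_unique[OF assms(1) l'(1)] t l' by (metis same_sym same_trans)
  then show "p \<le> l" "l \<le> t" "t < q" "same n l t" "p \<le> t" "l < q" using t l' base_D[OF assms(1)] by auto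
qed

lemma y_base_eq_0:
  assumes "l \<in> base n" "l \<noteq> p"
  shows "y n l = 0"
proof -
  obtain i k where i: "i < n" "y i l = b k" using assms by (auto simp: base_def)
  \<comment> \<open>A hit of \<open>b k\<close> is sent to 0, and 0 is fixed because
    \<open>b 0 = 0\<close> and \<open>T (b 0) = 0\<close>.\<close>
  have "y (Suc (i + j)) l = 0" for j
    by (induction j) (use i T_b[of k] T_b[of 0] b_0 in auto)
  from this[of "n - Suc i"] i show ?thesis by simp
qed

definition root :: "nat \<Rightarrow> real \<Rightarrow> real" where
  "root n t = (THE l. l \<in> base n \<and> t \<in> cyl n l)"

lemma root:
  assumes "p \<le> t" "t < q"
  shows "root n t \<in> base n" "t \<in> cyl n (root n t)"
proof -
  have "\<exists>!l. l \<in> base n \<and> t \<in> cyl n l"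
  proof -
    obtain l where l: "l \<in> base n" "l \<le> t" "same n l t" using ex_base assms by blast
    then show ?thesis
      using assms by (intro ex1I[of _ l]) (auto simp: cyl_def dest: same_sym intro!: base_unique elim: same_trans)
  qed
  from theI'[OF this] show "root n t \<in> base n" "t \<in> cyl n (root n t)"
    by (simp_all add: root_def)
qed

lemma root_eqI: "l \<in> base n \<Longrightarrow> t \<in> cyl n l \<Longrightarrow> root n t = l"
  by (metis (mono_tags, lifting) base_unique cyl_def mem_Collect_eq root same_sym same_trans)

definition new :: "nat \<Rightarrow> real set" where
  "new n = base (Suc n) - base n"

definition K :: nat where "K = card {k. b k \<le> R}"

lemma new_D:
  assumes "s \<in> new n"
  shows "p \<le> s" "s < q" "y n s = b (branch (y n s))" "1 \<le> branch (y n s)"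
  using base_Suc_newD[of s n] assms by (auto simp: new_def)

text \<open>New end points in one cylinder hit discontinuities with distinct indices, because
  \<open>y n\<close> is strictly increasing there, and only those discontinuities not exceeding
  \<open>R\<close> can be hit.\<close>

lemma new_in_cyl:
  assumes "l \<in> base n"
  shows "finite (new n \<inter> cyl n l)" "card (new n \<inter> cyl n l) \<le> K"
proof -
  have inj: "inj_on (\<lambda>s. branch (y n s)) (new n \<inter> cyl n l)"
  proof (rule linorder_inj_onI)
    fix s t assume st: "s < t" "s \<in> new n \<inter> cyl n l" "t \<in> new n \<inter> cyl n l"
    have "same n s t" using st by (metis (mono_tags, lifting) IntD2 cyl_def mem_Collect_eq same_sym same_trans)
    then have "y n s < y n t" using y_strict[of s t n] st by (auto simp: cyl_def)
    moreover have "y n s = b (branch (y n s))" "y n t = b (branch (y n t))" using new_D st by auto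
    ultimately show "branch (y n s) \<noteq> branch (y n t)" by auto
  qed auto
  have sub: "(\<lambda>s. branch (y n s)) ` (new n \<inter> cyl n l) \<subseteq> {k. b k \<le> R}"
  proof safe
    fix s assume "s \<in> new n" "s \<in> cyl n l"
    then show "b (branch (y n s)) \<le> R" using new_D[of s n] y_bounds[of s n] by auto
  qed
  show "finite (new n \<inter> cyl n l)" using inj_on_finite[OF inj sub finite_branches] .
  show "card (new n \<inter> cyl n l) \<le> K" unfolding K_def by (rule card_inj_on_le[OF inj sub finite_branches])
qed

lemma finite_base: "finite (base n)"
proof (induction n)
  case 0 then show ?case by (simp add: base_0)
next
  case (Suc n)
  have "base (Suc n) \<subseteq> base n \<union> (\<Union>l\<in>base n. new n \<inter> cyl n l)"
  proof
    fix s assume s: "s \<in> base (Suc n)"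
    then show "s \<in> base n \<union> (\<Union>l\<in>base n. new n \<inter> cyl n l)"
      using root[of s n] base_D[OF s] by (auto simp: new_def)
  qed
  moreover have "finite (base n \<union> (\<Union>l\<in>base n. new n \<inter> cyl n l))"
    using Suc new_in_cyl(1) by (intro finite_UnI finite_UN_I) auto
  ultimately show ?case by (rule finite_subset)
qed

lemma y_measurable: "y n \<in> borel_measurable (restrict_space borel {p..<q})"
proof (induction n)
  case 0
  show ?case using borel_measurable_continuous_on_restrict[OF g_continuous] by simp
next
  case (Suc n)
  have "(\<lambda>s. \<alpha> s * (\<lambda>z. T (max 0 z)) (y n s)) \<in> borel_measurable (restrict_space borel {p..<q})"
    using borel_measurable_continuous_on_restrict[OF \<alpha>_continuous] measurable_compose[OF Suc T_borel]
    by measurable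
  then show ?case
    by (subst measurable_cong[where g = "\<lambda>s. \<alpha> s * T (max 0 (y n s))"])
       (auto simp: space_restrict_space max_def dest: y_bounds(1))
qed

lemma branch_eq_iff: "0 \<le> z \<Longrightarrow> branch z = k \<longleftrightarrow> z \<in> {b k..<b (Suc k)}"
  using b_branch_le[of z] less_b_Suc_branch[of z] branch_eqI[of k z] by auto

lemma cyl_measurable: "cyl n l \<in> sets borel"
proof -
  define B where "B i = {b (branch (y i l))..<b (Suc (branch (y i l)))}" for i
  let ?M = "restrict_space borel {p..<q}"
  have B: "B i \<in> sets borel" for i by (simp add: B_def)
  have "{t \<in> space ?M. \<forall>i\<in>{..<n}. y i t \<in> B i} \<in> sets ?M"
    by (rule sets.sets_Collect_finite_All, rule measurable_sets_Collect[OF y_measurable])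
       (use B in \<open>auto\<close>)
  then have "{t \<in> {p..<q}. \<forall>i\<in>{..<n}. y i t \<in> B i} \<in> sets borel"
    by (simp add: sets_restrict_space_iff space_restrict_space)
  also have "{t \<in> {p..<q}. \<forall>i\<in>{..<n}. y i t \<in> B i} = cyl n l"
    using y_bounds(1) by (auto simp: cyl_def same_def B_def branch_eq_iff eq_commute[of "branch (y _ l)"])
  finally show ?thesis .
qed

lemma cyl_subset: "cyl n l \<subseteq> {p..<q}" by (auto simp: cyl_def)

lemma cyl_fmeasurable: "emeasure lborel (cyl n l) < \<infinity>"
  using emeasure_mono[OF cyl_subset[of n l], of lborel] p_less_q
  by (auto simp: le_less_trans)

lemma cyl_interval_le:
  assumes "l \<in> base n" "t \<in> cyl n l"
  shows "t - l \<le> measure lborel (cyl n l)"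
proof -
  note c = cyl_D[OF assms]
  have "{l..t} \<subseteq> cyl n l"
    using same_between[of l _ t n] c by (auto simp: cyl_def)
  then have "measure lborel {l..t} \<le> measure lborel (cyl n l)"
    using cyl_measurable cyl_fmeasurable by (intro measure_mono_fmeasurable) (auto simp: fmeasurable_def)
  then show ?thesis using c by simp
qed

end

lemma measure_le_diameter:
  fixes S :: "real set"
  assumes "S \<in> sets borel" "0 \<le> r" "\<And>s t. s \<in> S \<Longrightarrow> t \<in> S \<Longrightarrow> s \<le> t \<Longrightarrow> t - s \<le> r"
  shows "measure lborel S \<le> r"
proof (cases "S = {}")
  case True then show ?thesis using assms by simp
next
  case False
  then obtain x where x: "x \<in> S" by blast
  have lb: "s \<ge> x - r" if "s \<in> S" for s using assms(3)[of s x] assms(2) x that by linarith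
  then have bdd: "bdd_below S" by (intro bdd_belowI)
  have "S \<subseteq> {Inf S..Inf S + r}"
  proof
    fix t assume t: "t \<in> S"
    have "t - r \<le> Inf S"
    proof (rule cInf_greatest[OF False])
      fix s assume "s \<in> S"
      then show "t - r \<le> s" using assms(3)[of s t] t assms(2) by linarith
    qed
    then show "t \<in> {Inf S..Inf S + r}" using cInf_lower[OF t bdd] by auto
  qed
  then have "measure lborel S \<le> measure lborel {Inf S..Inf S + r}"
    using assms(1,2) by (intro measure_mono_fmeasurable) (auto simp: fmeasurable_def)
  then show ?thesis using assms(2) by simp
qed

section \<open>Weighted sums over cylinders\<close>

context expanding_family
begin

lemma set_integrable_bounded:
  fixes f :: "real \<Rightarrow> real"
  assumes "f \<in> borel_measurable (restrict_space borel {p..<q})"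
    and "\<And>s. p \<le> s \<Longrightarrow> s < q \<Longrightarrow> \<bar>f s\<bar> \<le> B" and "S \<in> sets borel" "S \<subseteq> {p..<q}"
  shows "set_integrable lborel S f"
proof -
  have "set_integrable lborel {p..<q} f"
    unfolding set_integrable_def
  proof (rule integrableI_bounded_set[where A = "{p..<q}" and B = B])
    show "emeasure lborel {p..<q} < \<infinity>" using p_less_q by simp
    show "(\<lambda>x. indicator {p..<q} x *\<^sub>R f x) \<in> borel_measurable lborel"
      using assms(1) by (simp add: borel_measurable_restrict_space_iff)
  qed (use assms(2) in \<open>auto simp: indicator_def\<close>)
  then show ?thesis using assms by (auto intro: set_integrable_subset)
qed

lemma sum_cyl:
  fixes f :: "real \<Rightarrow> real"
  assumes "set_integrable lborel {p..<q} f"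
  shows "(LINT s:{p..<q}|lborel. f s) = (\<Sum>l\<in>base n. LINT s:cyl n l|lborel. f s)"
proof -
  have "indicator {p..<q} s *\<^sub>R f s = (\<Sum>l\<in>base n. indicator (cyl n l) s *\<^sub>R f s)" for s
  proof (cases "s \<in> {p..<q}")
    case True
    then have s: "p \<le> s" "s < q" by auto
    have "(\<Sum>l\<in>base n. indicator (cyl n l) s *\<^sub>R f s) = (\<Sum>l\<in>base n. if l = root n s then f s else 0)"
    proof (intro sum.cong refl)
      fix l assume "l \<in> base n"
      then have "s \<in> cyl n l \<longleftrightarrow> l = root n s" using root_eqI root(2)[OF s] by metis
      then show "indicator (cyl n l) s *\<^sub>R f s = (if l = root n s then f s else 0)"
        by (cases "l = root n s") (auto simp: indicator_def)
    qed
    also have "\<dots> = f s" using finite_base root(1)[OF s] by simp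
    finally show ?thesis using True by simp
  next
    case False
    then have "s \<notin> cyl n l" for l using cyl_subset[of n l] by auto
    then show ?thesis using False by simp
  qed
  then have "(LINT s:{p..<q}|lborel. f s) = (LINT s|lborel. (\<Sum>l\<in>base n. indicator (cyl n l) s *\<^sub>R f s))"
    unfolding set_lebesgue_integral_def by simp
  also have "\<dots> = (\<Sum>l\<in>base n. LINT s:cyl n l|lborel. f s)"
    unfolding set_lebesgue_integral_def
    using set_integrable_subset[OF assms, of "cyl n _"] cyl_measurable cyl_subset
    by (intro Bochner_Integration.integral_sum) (auto simp: set_integrable_def)
  finally show ?thesis .
qed

text \<open>Constants of the recursion between \<open>S\<close> and \<open>mass\<close>. The 4 in
  \<open>C1\<close> is a 2 from the variation of \<open>E\<close> at new end points times a 2 from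
  comparing \<open>E\<close> at an end point with its integral; \<open>b 1\<close> is the least
  height at which a cylinder is cut.\<close>

definition C1 :: real where "C1 = 4 * real K * exp D * U / b 1"
definition C2 :: real where "C2 = 2 * real K * exp D"
definition C3 :: real where "C3 = 4 * R * exp D * exp D / c0"

lemma U_pos: "0 < U" unfolding U_def using U_pos_aux by simp
lemma C1_nonneg: "0 \<le> C1" unfolding C1_def using U_pos b_1_pos by simp
text \<open>A bound for the ratio of \<open>S\<close> to \<open>mass\<close>: the first entry of the
  maximum covers order 0, the second is the fixed point of the recursion with contraction rate
  \<open>(1 + lam) / (2 * lam)\<close>.\<close>

definition C4 :: real where
  "C4 = max (1 / (q - p)) ((C1 + C2 / (q - p)) / (1 - (1 + lam) / (2 * lam)))"

lemma C2_nonneg: "0 \<le> C2" unfolding C2_def by simp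
lemma C3_nonneg: "0 \<le> C3" unfolding C3_def using R_pos c0_pos by simp

lemma C4_pos: "0 < C4" unfolding C4_def using p_less_q by (simp add: less_max_iff_disj)
lemma C3_pos: "0 < C3" unfolding C3_def using R_pos c0_pos by simp

end

text \<open>The last assumption makes \<open>exp (\<theta> * visits n s)\<close> vary by a factor of at most \<open>2\<close> on a cylinder
  of order \<open>n\<close>.\<close>

locale weighted_family = expanding_family +
  fixes \<phi> :: "real \<Rightarrow> real" and \<theta> \<Lambda> :: real
  assumes \<phi>_range: "0 \<le> x \<Longrightarrow> x \<le> 1 \<Longrightarrow> 0 \<le> \<phi> x \<and> \<phi> x \<le> 1"
    and \<phi>_lipschitz: "0 \<le> x \<Longrightarrow> x \<le> z \<Longrightarrow> z \<le> 1 \<Longrightarrow> \<bar>\<phi> z - \<phi> x\<bar> \<le> \<Lambda> * (z - x)"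
    and \<Lambda>_nonneg: "0 \<le> \<Lambda>"
    and \<phi>_measurable [measurable]: "\<phi> \<in> borel_measurable borel"
    and \<theta>_nonneg: "0 \<le> \<theta>" and \<theta>_le_1: "\<theta> \<le> 1" and exp_\<theta>: "exp \<theta> \<le> (1 + A * m) / 2"
    and \<theta>_small: "\<theta> * (\<Lambda> / A * (R / (A * m - 1) + R)) \<le> ln 2"
begin

definition visits :: "nat \<Rightarrow> real \<Rightarrow> real" where
  "visits n s = (\<Sum>j<n. \<phi> (T (y j s)))"

definition E :: "nat \<Rightarrow> real \<Rightarrow> real" where
  "E n s = exp (\<theta> * visits n s)"

lemma E_pos: "0 < E n s" by (simp add: E_def)

lemma E_Suc: "E (Suc n) s = E n s * exp (\<theta> * \<phi> (T (y n s)))"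
  by (simp add: E_def visits_def distrib_left exp_add)

lemma \<phi>_T_range: "p \<le> s \<Longrightarrow> s < q \<Longrightarrow> 0 \<le> \<phi> (T (y n s)) \<and> \<phi> (T (y n s)) \<le> 1"
  using \<phi>_range T_range[OF y_bounds(1)] by blast

lemma E_Suc_bounds:
  assumes "p \<le> s" "s < q"
  shows "E n s \<le> E (Suc n) s" "E (Suc n) s \<le> exp \<theta> * E n s"
proof -
  have "1 \<le> exp (\<theta> * \<phi> (T (y n s)))" "exp (\<theta> * \<phi> (T (y n s))) \<le> exp \<theta>"
    using \<phi>_T_range[OF assms, of n] \<theta>_nonneg by (auto simp: mult_left_le)
  then show "E n s \<le> E (Suc n) s" "E (Suc n) s \<le> exp \<theta> * E n s"
    using E_pos[of n s] by (auto simp: E_Suc)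
qed

text \<open>Each difference of \<open>\<phi>\<close> is at most \<open>\<Lambda> / A\<close> times
  the gap of \<open>y\<close> one step later, and these gaps sum geometrically. The bound is
  independent of \<open>n\<close>, so one \<open>\<theta>\<close> serves all orders.\<close>

lemma visits_variation:
  assumes "p \<le> s" "s \<le> t" "t < q" "same n s t"
  shows "\<bar>visits n t - visits n s\<bar> \<le> \<Lambda> / A * (R / (lam - 1) + R)"
proof -
  have I: "s < q" "p \<le> t" using assms by auto
  have dy: "0 \<le> y j t - y j s" if "j \<le> n" for j
    using y_mono[OF assms(1-3) same_le[OF assms(4) that]] by simp
  have "\<bar>\<phi> (T (y j t)) - \<phi> (T (y j s))\<bar> \<le> \<Lambda> / A * (y (Suc j) t - y (Suc j) s)" if "j < n" for j
  proof -
    have sj: "same j s t" "branch (y j s) = branch (y j t)"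
      using assms(4) that by (auto simp: same_def)
    have yj: "y j s \<le> y j t" using dy[of j] that by simp
    have "m * (y j t - y j s) \<le> T (y j t) - T (y j s)"
      using T_on_branch(1)[OF y_bounds(1)[OF assms(1) I(1)] yj y_bounds(2)[OF I(2) assms(3)] sj(2)] .
    moreover have "0 \<le> m * (y j t - y j s)" using m_pos yj by simp
    ultimately have "T (y j s) \<le> T (y j t)" by linarith
    then have "\<bar>\<phi> (T (y j t)) - \<phi> (T (y j s))\<bar> \<le> \<Lambda> * (T (y j t) - T (y j s))"
      using T_range[OF y_bounds(1)[OF assms(1) I(1)], of j] T_range[OF y_bounds(1)[OF I(2) assms(3)], of j]
      by (intro \<phi>_lipschitz) auto
    also have "\<dots> = \<Lambda> / A * (A * (T (y j t) - T (y j s)))" using A_pos by simp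
    also have "\<dots> \<le> \<Lambda> / A * (y (Suc j) t - y (Suc j) s)"
      using y_step(4)[OF assms(1-3) yj sj(2)] \<Lambda>_nonneg A_pos by (intro mult_left_mono) auto
    finally show ?thesis .
  qed
  then have "(\<Sum>j<n. \<bar>\<phi> (T (y j t)) - \<phi> (T (y j s))\<bar>) \<le> (\<Sum>j<n. \<Lambda> / A * (y (Suc j) t - y (Suc j) s))"
    by (intro sum_mono) auto
  also have "\<dots> = \<Lambda> / A * (\<Sum>j<n. y (Suc j) t - y (Suc j) s)"
    by (simp only: sum_distrib_left)
  also have "\<dots> \<le> \<Lambda> / A * (R / (lam - 1) + R)"
  proof (rule mult_left_mono)
    have "(\<Sum>j<n. y (Suc j) t - y (Suc j) s) \<le> (\<Sum>j<Suc n. y j t - y j s)"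
      using dy[of 0] by (subst sum.lessThan_Suc_shift) simp
    also have "\<dots> = (\<Sum>j<n. y j t - y j s) + (y n t - y n s)" by simp
    also have "\<dots> \<le> (y n t - y n s) / (lam - 1) + (y n t - y n s)"
      using sum_dy_le[OF assms] by simp
    also have "\<dots> \<le> R / (lam - 1) + R"
      using y_bounds[OF assms(1) I(1), of n] y_bounds[OF I(2) assms(3), of n] expansion
      by (intro add_mono divide_right_mono) auto
    finally show "(\<Sum>j<n. y (Suc j) t - y (Suc j) s) \<le> R / (lam - 1) + R" .
  qed (use \<Lambda>_nonneg A_pos in auto)
  finally have "(\<Sum>j<n. \<bar>\<phi> (T (y j t)) - \<phi> (T (y j s))\<bar>) \<le> \<Lambda> / A * (R / (lam - 1) + R)" .
  moreover have "\<bar>visits n t - visits n s\<bar> \<le> (\<Sum>j<n. \<bar>\<phi> (T (y j t)) - \<phi> (T (y j s))\<bar>)"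
    unfolding visits_def sum_subtractf[symmetric] by (rule sum_abs)
  ultimately show ?thesis by linarith
qed

lemma E_variation:
  assumes "p \<le> s" "s < q" "p \<le> t" "t < q" "same n s t"
  shows "E n t \<le> 2 * E n s"
proof -
  have "\<bar>visits n t - visits n s\<bar> \<le> \<Lambda> / A * (R / (lam - 1) + R)"
    using visits_variation[of s t n] visits_variation[of t s n] assms same_sym[OF assms(5)]
    by (cases "s \<le> t") (auto simp: abs_minus_commute)
  then have "\<theta> * (visits n t - visits n s) \<le> \<theta> * (\<Lambda> / A * (R / (lam - 1) + R))"
    using \<theta>_nonneg by (intro mult_left_mono) auto
  also note \<theta>_small
  finally have "exp (\<theta> * (visits n t - visits n s)) \<le> exp (ln 2)" by (simp only: exp_le_cancel_iff)
  then have "exp (\<theta> * visits n t - \<theta> * visits n s) \<le> 2" by (simp add: right_diff_distrib)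
  then show ?thesis by (simp add: E_def exp_diff divide_le_eq)
qed

lemma visits_measurable: "visits n \<in> borel_measurable (restrict_space borel {p..<q})"
proof -
  have "(\<lambda>s. \<Sum>j<n. \<phi> (T (max 0 (y j s)))) \<in> borel_measurable (restrict_space borel {p..<q})"
    by (intro borel_measurable_sum measurable_compose[OF _ \<phi>_measurable]
        measurable_compose[OF y_measurable T_borel])
  then show ?thesis
    by (subst measurable_cong[where g = "\<lambda>s. \<Sum>j<n. \<phi> (T (max 0 (y j s)))"])
       (auto simp: space_restrict_space visits_def max_def dest: y_bounds(1) intro!: sum.cong)
qed

lemma E_measurable: "E n \<in> borel_measurable (restrict_space borel {p..<q})"
  unfolding E_def[abs_def] using visits_measurable by measurable

lemma E_bounded:
  assumes "p \<le> s" "s < q" shows "E n s \<le> exp \<theta> ^ n"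
proof (induction n)
  case 0 then show ?case by (simp add: E_def visits_def)
next
  case (Suc n)
  then show ?case using order_trans[OF E_Suc_bounds(2)[OF assms, of n] mult_left_mono[OF Suc exp_ge_zero[of \<theta>]]] by simp
qed

lemma E_set_integrable: "S \<in> sets borel \<Longrightarrow> S \<subseteq> {p..<q} \<Longrightarrow> set_integrable lborel S (E n)"
  using E_bounded[of _ n] E_pos[of n] E_measurable
  by (intro set_integrable_bounded[where B = "exp \<theta> ^ n"]) (auto simp: abs_of_pos)

section \<open>The recursion between total mass and boundary sums\<close>

definition mass :: "nat \<Rightarrow> real" where
  "mass n = (LINT s:{p..<q}|lborel. E n s)"

definition S :: "nat \<Rightarrow> real" where
  "S n = (\<Sum>l\<in>base n. E n l / w n l)"

lemma mass_cyl: "mass n = (\<Sum>l\<in>base k. LINT s:cyl k l|lborel. E n s)"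
  unfolding mass_def by (rule sum_cyl) (auto intro: E_set_integrable)

lemma E_measure_cyl_le:
  assumes "l \<in> base n"
  shows "E n l * measure lborel (cyl n l) \<le> 2 * (LINT s:cyl n l|lborel. E n s)"
proof -
  have "(LINT s:cyl n l|lborel. E n l / 2) \<le> (LINT s:cyl n l|lborel. E n s)"
  proof (rule set_integral_mono)
    show "set_integrable lborel (cyl n l) (\<lambda>s. E n l / 2)"
      using cyl_measurable cyl_subset E_pos[of n l] by (intro set_integrable_bounded[where B = "E n l / 2"]) auto
    show "set_integrable lborel (cyl n l) (E n)" using cyl_measurable cyl_subset by (intro E_set_integrable)
    fix s assume s: "s \<in> cyl n l"
    from cyl_D[OF assms s] show "E n l / 2 \<le> E n s" using E_variation[of s l n] same_sym by auto
  qed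
  moreover have "(LINT s:cyl n l|lborel. E n l / 2) = measure lborel (cyl n l) *\<^sub>R (E n l / 2)"
    using cyl_measurable cyl_fmeasurable[of n l] by (intro set_integral_const) auto
  ultimately show ?thesis by (simp add: mult.commute)
qed

text \<open>One step multiplies \<open>E\<close> by at most \<open>exp \<theta> \<le> lam\<close>
  and \<open>w\<close> by at least \<open>lam\<close>, so these cancel. What remains is the
  variation 2 of \<open>E\<close> and the distortion \<open>exp D\<close> of
  \<open>w\<close>.\<close>

lemma new_term:
  assumes "l \<in> base n" "s \<in> new n \<inter> cyl n l"
  shows "E (Suc n) s / w (Suc n) s \<le> 2 * exp D * (E n l / w n l)"
proof -
  note c = cyl_D[OF assms(1), of s]
  have s: "p \<le> l" "l \<le> s" "s < q" "same n l s" "p \<le> s" "l < q" using c assms by auto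
  have "E (Suc n) s \<le> exp \<theta> * E n s" using E_Suc_bounds s by auto
  also have "\<dots> \<le> lam * (2 * E n l)"
    using E_variation[OF s(1,6,5,3,4)] exp_\<theta> E_pos[of n s] expansion by (intro mult_mono) (auto simp: field_simps)
  finally have 1: "E (Suc n) s \<le> lam * (2 * E n l)" .
  have "lam * (exp (- D) * w n l) \<le> lam * w n s" using w_lower[OF s(1-4)] expansion by (intro mult_left_mono) auto
  also have "\<dots> \<le> w (Suc n) s" using w_Suc_ge s by auto
  finally have 2: "lam * (exp (- D) * w n l) \<le> w (Suc n) s" .
  have "E (Suc n) s / w (Suc n) s \<le> lam * (2 * E n l) / (lam * (exp (- D) * w n l))"
    using 1 2 E_pos[of n l] E_pos[of "Suc n" s] w_pos[of l n] s expansion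
    by (intro frac_le) (auto intro!: mult_pos_pos)
  also have "\<dots> = 2 * exp D * (E n l / w n l)" using m_pos A_pos by (simp add: exp_minus field_simps)
  finally show ?thesis .
qed

lemma base_p_term: "E n p / w n p \<le> (exp \<theta> / lam) ^ n"
  unfolding power_divide using E_bounded[of p n] w_ge[of p n] p_less_q expansion E_pos[of n p]
  by (intro frac_le) auto

text \<open>A cylinder other than the leftmost starts at height 0. A new end point in it forces
  \<open>y n\<close> up to height \<open>b 1\<close>, hence a length of order at least
  \<open>1 / w n l\<close>, and the integral over the cylinder pays for the new terms. The leftmost
  cylinder may start higher; its term is bounded by exponential decay instead.\<close>

lemma new_sum_cyl:
  assumes "l \<in> base n"
  shows "(\<Sum>s\<in>new n \<inter> cyl n l. E (Suc n) s / w (Suc n) s) \<le>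
    C1 * (LINT s:cyl n l|lborel. E n s) + (if l = p then C2 * (exp \<theta> / lam) ^ n else 0)"
proof -
  note lb = base_D[OF assms]
  have w0: "0 < w n l" using w_pos lb by auto
  have int0: "0 \<le> (LINT s:cyl n l|lborel. E n s)"
    unfolding set_lebesgue_integral_def using less_imp_le[OF E_pos]
    by (intro Bochner_Integration.integral_nonneg) (simp add: indicator_def)
  have "(\<Sum>s\<in>new n \<inter> cyl n l. E (Suc n) s / w (Suc n) s) \<le> (\<Sum>s\<in>new n \<inter> cyl n l. 2 * exp D * (E n l / w n l))"
    using new_term[OF assms] by (intro sum_mono)
  also have "\<dots> = real (card (new n \<inter> cyl n l)) * (2 * exp D * (E n l / w n l))" by simp
  finally have 0: "(\<Sum>s\<in>new n \<inter> cyl n l. E (Suc n) s / w (Suc n) s) \<le>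
      real (card (new n \<inter> cyl n l)) * (2 * exp D * (E n l / w n l))" .
  also have "\<dots> \<le> real K * (2 * exp D * (E n l / w n l))"
    using new_in_cyl(2)[OF assms] E_pos[of n l] w0 by (intro mult_right_mono) auto
  finally have 1: "(\<Sum>s\<in>new n \<inter> cyl n l. E (Suc n) s / w (Suc n) s) \<le> C2 * (E n l / w n l)"
    by (simp add: C2_def mult_ac)
  show ?thesis
  proof (cases "l = p")
    case True
    have "C2 * (E n l / w n l) \<le> C2 * (exp \<theta> / lam) ^ n"
      using base_p_term[of n] C2_nonneg True by (intro mult_left_mono) auto
    then show ?thesis using 1 True mult_nonneg_nonneg[OF C1_nonneg int0] by simp
  next
    case False
    show ?thesis
    proof (cases "new n \<inter> cyl n l = {}")
      case True
      then show ?thesis using False mult_nonneg_nonneg[OF C1_nonneg int0] by simp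
    next
      case ne: False
      then obtain s where s: "s \<in> new n" "s \<in> cyl n l" by auto
      note c = cyl_D[OF assms s(2)]
      have "b 1 \<le> y n s" using new_D[OF s(1)] b_mono[of 1 "branch (y n s)"] by auto
      also have "\<dots> = y n s - y n l" using y_base_eq_0[OF assms False] by simp
      also have "\<dots> \<le> U * w n l * (s - l)" using dy_le c by auto
      also have "\<dots> \<le> U * w n l * measure lborel (cyl n l)"
        using cyl_interval_le[OF assms s(2)] U_pos w0 by (intro mult_left_mono) auto
      finally have "1 / w n l \<le> U / b 1 * measure lborel (cyl n l)"
        using w0 b_1_pos by (simp add: field_simps)
      then have "C2 * (E n l * (1 / w n l)) \<le> C2 * (E n l * (U / b 1 * measure lborel (cyl n l)))"
        using C2_nonneg E_pos[of n l] by (intro mult_left_mono) auto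
      also have "\<dots> = C2 * U / b 1 * (E n l * measure lborel (cyl n l))" by simp
      also have "\<dots> \<le> C2 * U / b 1 * (2 * (LINT s:cyl n l|lborel. E n s))"
        using E_measure_cyl_le[OF assms] C2_nonneg U_pos b_1_pos by (intro mult_left_mono) auto
      also have "\<dots> = C1 * (LINT s:cyl n l|lborel. E n s)" by (simp add: C1_def C2_def)
      finally show ?thesis using 1 False by simp
    qed
  qed
qed

text \<open>Terms of old end points shrink by \<open>exp \<theta> / lam\<close>; new end points are
  grouped by the cylinder of order \<open>n\<close> that contains them.\<close>

lemma S_Suc_le: "S (Suc n) \<le> exp \<theta> / lam * S n + C1 * mass n + C2 * (exp \<theta> / lam) ^ n"
proof -
  have fin: "finite (new n)" using finite_base by (auto simp: new_def)
  have un: "base (Suc n) = base n \<union> new n" "base n \<inter> new n = {}" using base_mono by (auto simp: new_def)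
  have "S (Suc n) = (\<Sum>l\<in>base n. E (Suc n) l / w (Suc n) l) + (\<Sum>l\<in>new n. E (Suc n) l / w (Suc n) l)"
    unfolding S_def un(1) by (rule sum.union_disjoint[OF finite_base fin un(2)])
  moreover have "(\<Sum>l\<in>base n. E (Suc n) l / w (Suc n) l) \<le> exp \<theta> / lam * S n"
    unfolding S_def sum_distrib_left
  proof (rule sum_mono)
    fix l assume "l \<in> base n"
    note lb = base_D[OF this]
    have "E (Suc n) l / w (Suc n) l \<le> exp \<theta> * E n l / (lam * w n l)"
      using E_Suc_bounds[OF lb, of n] w_Suc_ge[OF lb, of n] w_pos[OF lb, of n] E_pos[of n l] expansion
      by (intro frac_le) auto
    then show "E (Suc n) l / w (Suc n) l \<le> exp \<theta> / lam * (E n l / w n l)" by simp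
  qed
  moreover have "(\<Sum>l\<in>new n. E (Suc n) l / w (Suc n) l) \<le> C1 * mass n + C2 * (exp \<theta> / lam) ^ n"
  proof -
    have "(\<Sum>l\<in>new n. E (Suc n) l / w (Suc n) l)
        = (\<Sum>l\<in>base n. \<Sum>s\<in>{s \<in> new n. root n s = l}. E (Suc n) s / w (Suc n) s)"
      by (rule sum.group[symmetric, OF fin finite_base]) (blast intro: root(1) dest: new_D(1,2))
    also have "\<dots> = (\<Sum>l\<in>base n. \<Sum>s\<in>new n \<inter> cyl n l. E (Suc n) s / w (Suc n) s)"
    proof (intro sum.cong refl)
      fix l assume "l \<in> base n"
      then show "{s \<in> new n. root n s = l} = new n \<inter> cyl n l"
      proof (intro set_eqI iffI)
        fix s assume "s \<in> {s \<in> new n. root n s = l}"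
        then have "s \<in> new n" "l = root n s" by auto
        with root(2)[OF new_D(1,2)[OF this(1)], of n] show "s \<in> new n \<inter> cyl n l" by blast
      next
        fix s assume "s \<in> new n \<inter> cyl n l"
        with root_eqI[OF \<open>l \<in> base n\<close>, of s] show "s \<in> {s \<in> new n. root n s = l}" by blast
      qed
    qed
    also have "\<dots> \<le> (\<Sum>l\<in>base n. C1 * (LINT s:cyl n l|lborel. E n s) + (if l = p then C2 * (exp \<theta> / lam) ^ n else 0))"
      using new_sum_cyl by (intro sum_mono)
    also have "\<dots> = C1 * mass n + C2 * (exp \<theta> / lam) ^ n"
      using finite_base p_in_base by (simp add: sum.distrib mass_cyl[of n n] sum_distrib_left)
    finally show ?thesis .
  qed
  ultimately show ?thesis by linarith
qed

text \<open>The weight grows only where \<open>T (y n s)\<close> lies in \<open>{u..v}\<close>. In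
  each cylinder of order \<open>Suc n\<close> this set has length of order at most
  \<open>(v - u) / w (Suc n) l\<close>, and summing over \<open>l\<close> produces
  \<open>S (Suc n)\<close>.\<close>

lemma mass_Suc_le:
  assumes supp: "\<And>x. 0 \<le> x \<Longrightarrow> x \<le> 1 \<Longrightarrow> x \<notin> {u..v} \<Longrightarrow> \<phi> x = 0" and "u \<le> v"
  shows "mass (Suc n) \<le> mass n + C3 * \<theta> * (v - u) * S (Suc n)"
proof -
  have cyl: "(LINT s:cyl (Suc n) l|lborel. E (Suc n) s) \<le>
      (LINT s:cyl (Suc n) l|lborel. E n s) + C3 * \<theta> * (v - u) * (E (Suc n) l / w (Suc n) l)"
    if l: "l \<in> base (Suc n)" for l
  proof -
    note lb = base_D[OF l]
    define Z where "Z = {t \<in> cyl (Suc n) l. T (y n t) \<in> {u..v}}"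
    have w0: "0 < w (Suc n) l" using w_pos lb by auto
    have Z_meas: "Z \<in> sets borel"
    proof -
      have "{t \<in> space (restrict_space borel {p..<q}). T (max 0 (y n t)) \<in> {u..v}} \<in> sets (restrict_space borel {p..<q})"
        by (rule measurable_sets_Collect[OF measurable_compose[OF y_measurable T_borel]]) auto
      then have "{t \<in> {p..<q}. T (max 0 (y n t)) \<in> {u..v}} \<in> sets borel"
        by (simp add: sets_restrict_space_iff space_restrict_space)
      moreover have "Z = cyl (Suc n) l \<inter> {t \<in> {p..<q}. T (max 0 (y n t)) \<in> {u..v}}"
        using cyl_subset[of "Suc n" l] y_bounds(1) by (auto simp: Z_def max_def)
      ultimately show ?thesis using cyl_measurable by auto
    qed
    have Z_le: "measure lborel Z \<le> exp D * exp D * R * (v - u) / (c0 * w (Suc n) l)"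
    proof (rule measure_le_diameter[OF Z_meas])
      show "0 \<le> exp D * exp D * R * (v - u) / (c0 * w (Suc n) l)" using R_pos c0_pos w0 assms by simp
      fix s t assume st: "s \<in> Z" "t \<in> Z" "s \<le> t"
      have cs: "s \<in> cyl (Suc n) l" "t \<in> cyl (Suc n) l" using st by (auto simp: Z_def)
      note s = cyl_D[OF l cs(1)] and t = cyl_D[OF l cs(2)]
      have same: "same (Suc n) s t" using s t by (metis same_sym same_trans)
      have "exp (- D) * c0 / R * (exp (- D) * w (Suc n) l) * (t - s) \<le> exp (- D) * c0 / R * w (Suc n) s * (t - s)"
        using w_lower[of l s "Suc n"] s st c0_pos R_pos by (intro mult_right_mono mult_left_mono) auto
      also have "\<dots> \<le> T (y n t) - T (y n s)" using dT_ge[of s t n] s t st same by auto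
      also have "\<dots> \<le> v - u" using st by (auto simp: Z_def)
      finally show "t - s \<le> exp D * exp D * R * (v - u) / (c0 * w (Suc n) l)"
        using c0_pos R_pos w0 by (simp add: exp_minus field_simps)
    qed
    have ZI: "Z \<subseteq> {p..<q}" using cyl_subset by (auto simp: Z_def)
    have "(LINT s:cyl (Suc n) l|lborel. E (Suc n) s) - (LINT s:cyl (Suc n) l|lborel. E n s)
        = (LINT s:cyl (Suc n) l|lborel. E (Suc n) s - E n s)"
      using cyl_measurable cyl_subset by (intro set_integral_diff(2)[symmetric] E_set_integrable)
    also have "\<dots> \<le> (LINT s:cyl (Suc n) l|lborel. 4 * \<theta> * E n l * indicator Z s)"
    proof (rule set_integral_mono)
      show "set_integrable lborel (cyl (Suc n) l) (\<lambda>s. E (Suc n) s - E n s)"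
        using cyl_measurable cyl_subset by (intro set_integral_diff(1) E_set_integrable)
      show "set_integrable lborel (cyl (Suc n) l) (\<lambda>s. 4 * \<theta> * E n l * indicator Z s)"
        using cyl_measurable cyl_subset \<theta>_nonneg E_pos[of n l] Z_meas
        by (intro set_integrable_bounded[where B = "4 * \<theta> * E n l"])
           (auto simp: indicator_def less_imp_le intro!: measurable_restrict_space1 borel_measurable_times)
      fix s assume s: "s \<in> cyl (Suc n) l"
      note c = cyl_D[OF l s]
      note \<phi>r = \<phi>_T_range[OF c(5,3), of n]
      show "E (Suc n) s - E n s \<le> 4 * \<theta> * E n l * indicator Z s"
      proof (cases "s \<in> Z")
        case True
        let ?x = "\<theta> * \<phi> (T (y n s))"
        have x: "0 \<le> ?x" "?x \<le> \<theta>" using \<phi>r \<theta>_nonneg by (auto simp: mult_left_le)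
        \<comment> \<open>The resulting factor 2 and the factor 2 of \<open>E_variation\<close> make
          up the 4 in \<open>C3\<close>.\<close>
        have "exp ?x \<le> 1 + ?x + ?x\<^sup>2" using x \<theta>_le_1 by (intro exp_bound) auto
        also have "?x\<^sup>2 \<le> ?x" using x \<theta>_le_1 by (simp add: power2_eq_square mult_left_le)
        finally have ex: "exp ?x - 1 \<le> 2 * \<theta>" using x by linarith
        have "E (Suc n) s - E n s = E n s * (exp ?x - 1)" by (simp add: E_Suc algebra_simps)
        also have "\<dots> \<le> (2 * E n l) * (2 * \<theta>)"
          using ex x E_variation[OF c(1,6,5,3)] same_le[OF c(4), of n] E_pos[of n s] E_pos[of n l]
          by (intro mult_mono) auto
        finally show ?thesis using True by (simp add: mult_ac)
      next
        case False
        then have "\<phi> (T (y n s)) = 0" using s T_range[OF y_bounds(1)[OF c(5,3)]] by (intro supp) (auto simp: Z_def)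
        then show ?thesis using False by (simp add: E_Suc)
      qed
    qed
    also have "\<dots> = 4 * \<theta> * E n l * measure lborel Z"
    proof -
      have "indicator (cyl (Suc n) l) s * indicator Z s = (indicator Z s :: real)" for s
        by (auto simp: indicator_def Z_def)
      then have "(LINT s:cyl (Suc n) l|lborel. 4 * \<theta> * E n l * indicator Z s) = (LINT s|lborel. 4 * \<theta> * E n l * indicator Z s)"
        unfolding set_lebesgue_integral_def by (intro Bochner_Integration.integral_cong) (auto simp: ac_simps)
      also have "\<dots> = 4 * \<theta> * E n l * measure lborel Z" using Z_meas by simp
      finally show ?thesis .
    qed
    \<comment> \<open>Raising the order of \<open>E\<close> at \<open>l\<close> by one matches the
      summands of \<open>S (Suc n)\<close>.\<close>
    also have "\<dots> \<le> 4 * \<theta> * E (Suc n) l * (exp D * exp D * R * (v - u) / (c0 * w (Suc n) l))"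
      using Z_le \<theta>_nonneg E_pos[of n l] E_pos[of "Suc n" l] E_Suc_bounds(1)[OF lb, of n] by (intro mult_mono) auto
    also have "\<dots> = C3 * \<theta> * (v - u) * (E (Suc n) l / w (Suc n) l)" by (simp add: C3_def)
    finally show ?thesis by simp
  qed
  have "mass (Suc n) = (\<Sum>l\<in>base (Suc n). LINT s:cyl (Suc n) l|lborel. E (Suc n) s)" by (rule mass_cyl)
  also have "\<dots> \<le> (\<Sum>l\<in>base (Suc n). (LINT s:cyl (Suc n) l|lborel. E n s) + C3 * \<theta> * (v - u) * (E (Suc n) l / w (Suc n) l))"
    using cyl by (intro sum_mono)
  also have "\<dots> = mass n + C3 * \<theta> * (v - u) * S (Suc n)"
    by (simp add: sum.distrib mass_cyl[of n "Suc n"] S_def sum_distrib_left)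
  finally show ?thesis .
qed

end

section \<open>Large deviations of visits\<close>

context weighted_family
begin

lemma mass_0: "mass 0 = q - p"
  using p_less_q by (simp add: mass_def E_def visits_def set_integral_const)

lemma mass_le_Suc: "mass n \<le> mass (Suc n)"
  unfolding mass_def using E_Suc_bounds(1)
  by (intro set_integral_mono E_set_integrable) auto

lemma mass_ge: "q - p \<le> mass n"
  by (induction n) (auto simp: mass_0 intro: order_trans[OF _ mass_le_Suc])

lemma S_0: "S 0 = 1"
  by (simp add: S_def base_0 E_def visits_def)

lemma exp_\<theta>_lam: "exp \<theta> / lam \<le> (1 + lam) / (2 * lam)" "(1 + lam) / (2 * lam) < 1"
proof -
  show "exp \<theta> / lam \<le> (1 + lam) / (2 * lam)"
    using divide_right_mono[OF exp_\<theta>, of lam] expansion by (simp add: field_simps)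
  show "(1 + lam) / (2 * lam) < 1"
    using expansion by (subst divide_less_eq_1_pos) auto
qed

text \<open>The contraction rate is below 1, and \<open>mass n \<ge> q - p\<close> absorbs the
  decaying term of the leftmost cylinder. The index shift is the one in which
  \<open>mass_Suc_le\<close> needs the bound.\<close>

lemma S_Suc_le_mass: "S (Suc n) \<le> C4 * mass n"
proof -
  let ?r = "(1 + lam) / (2 * lam)"
  have r: "0 \<le> exp \<theta> / lam" "exp \<theta> / lam \<le> ?r" "?r < 1" using exp_\<theta>_lam expansion by auto
  have step: "S (Suc n) \<le> C4 * mass n" if "S n \<le> C4 * mass n" for n
  proof -
    have m0: "0 < mass n" using mass_ge[of n] p_less_q by linarith
    have "S (Suc n) \<le> exp \<theta> / lam * S n + C1 * mass n + C2 * (exp \<theta> / lam) ^ n" by (rule S_Suc_le)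
    also have "\<dots> \<le> ?r * (C4 * mass n) + C1 * mass n + C2 * (1 / (q - p) * mass n)"
    proof (intro add_mono order_refl mult_left_mono)
      have "exp \<theta> / lam * S n \<le> exp \<theta> / lam * (C4 * mass n)" using that r by (intro mult_left_mono) auto
      also have "\<dots> \<le> ?r * (C4 * mass n)" using r m0 C4_pos by (intro mult_right_mono) auto
      finally show "exp \<theta> / lam * S n \<le> ?r * (C4 * mass n)" .
      have "(exp \<theta> / lam) ^ n \<le> 1" using r by (intro power_le_one) auto
      also have "1 \<le> 1 / (q - p) * mass n" using mass_ge[of n] p_less_q by (simp add: field_simps)
      finally show "(exp \<theta> / lam) ^ n \<le> 1 / (q - p) * mass n" .
    qed (rule C2_nonneg)
    also have "\<dots> = (?r * C4 + (C1 + C2 / (q - p))) * mass n" by (simp add: algebra_simps)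
    also have "\<dots> \<le> C4 * mass n"
    proof (rule mult_right_mono)
      have "(C1 + C2 / (q - p)) / (1 - ?r) \<le> C4" by (simp add: C4_def)
      then have "C1 + C2 / (q - p) \<le> C4 * (1 - ?r)" using r by (subst (asm) pos_divide_le_eq) auto
      then show "?r * C4 + (C1 + C2 / (q - p)) \<le> C4" by (simp add: algebra_simps)
    qed (use m0 in simp)
    finally show ?thesis .
  qed
  have le: "S n \<le> C4 * mass n" for n
  proof (induction n)
    case 0
    have "1 / (q - p) * (q - p) \<le> C4 * (q - p)" using p_less_q by (intro mult_right_mono) (auto simp: C4_def)
    then show ?case using p_less_q by (simp add: S_0 mass_0)
  next
    case (Suc n)
    then show ?case using step[OF Suc] mult_left_mono[OF mass_le_Suc[of n], of C4] C4_pos by linarith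
  qed
  then show ?thesis by (rule step)
qed

lemma mass_exp_le:
  assumes supp: "\<And>x. 0 \<le> x \<Longrightarrow> x \<le> 1 \<Longrightarrow> x \<notin> {u..v} \<Longrightarrow> \<phi> x = 0" and "u \<le> v"
  shows "mass n \<le> (q - p) * exp (C3 * C4 * \<theta> * (v - u) * real n)"
proof (induction n)
  case 0 then show ?case by (simp add: mass_0)
next
  case (Suc n)
  let ?x = "C3 * C4 * \<theta> * (v - u)"
  have m0: "0 \<le> mass n" using mass_ge[of n] p_less_q by linarith
  have "mass (Suc n) \<le> mass n + C3 * \<theta> * (v - u) * S (Suc n)"
    using mass_Suc_le[OF supp] assms by blast
  also have "\<dots> \<le> mass n + C3 * \<theta> * (v - u) * (C4 * mass n)"
    using S_Suc_le_mass[of n] C3_nonneg \<theta>_nonneg assms by (intro add_left_mono mult_left_mono) auto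
  also have "\<dots> = (1 + ?x) * mass n" by (simp add: algebra_simps)
  also have "\<dots> \<le> exp ?x * mass n" using m0 by (intro mult_right_mono exp_ge_add_one_self)
  also have "\<dots> \<le> exp ?x * ((q - p) * exp (?x * real n))" using Suc by (intro mult_left_mono) auto
  also have "\<dots> = (q - p) * exp (?x * real (Suc n))"
  proof -
    have "exp (?x * real (Suc n)) = exp ?x * exp (?x * real n)"
      unfolding exp_add[symmetric] by (simp add: algebra_simps)
    then show ?thesis by simp
  qed
  finally show ?case .
qed

text \<open>A Chernoff bound. The threshold times \<open>\<theta>\<close> is twice the growth
  exponent of \<open>mass\<close>, so half of it is left as decay.\<close>

lemma measure_visits_le:
  assumes supp: "\<And>x. 0 \<le> x \<Longrightarrow> x \<le> 1 \<Longrightarrow> x \<notin> {u..v} \<Longrightarrow> \<phi> x = 0" and "u \<le> v"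
  shows "{s \<in> {p..<q}. 2 * C3 * C4 * (v - u) * n \<le> visits n s} \<in> sets borel"
    and "measure lborel {s \<in> {p..<q}. 2 * C3 * C4 * (v - u) * n \<le> visits n s}
        \<le> (q - p) * exp (- (C3 * C4 * \<theta> * (v - u))) ^ n"
proof -
  let ?c = "2 * C3 * C4 * (v - u) * n"
  define Z where "Z = {s \<in> {p..<q}. ?c \<le> visits n s}"
  have "{s \<in> space (restrict_space borel {p..<q}). ?c \<le> visits n s} \<in> sets (restrict_space borel {p..<q})"
    using visits_measurable by measurable
  then have "{s \<in> {p..<q}. ?c \<le> visits n s} \<in> sets borel"
    by (simp only: sets_restrict_space_iff space_restrict_space space_borel Int_UNIV_right sets.top atLeastLessThan_borel)
  then show Z: "Z \<in> sets borel" by (simp only: Z_def)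
  have ZI: "Z \<subseteq> {p..<q}" by (auto simp: Z_def)
  have fin: "emeasure lborel Z \<noteq> \<infinity>" using emeasure_mono[OF ZI, of lborel] p_less_q by (auto simp: top_unique)
  have "exp (\<theta> * ?c) * measure lborel Z = (LINT s:Z|lborel. exp (\<theta> * ?c))"
    using Z fin by (subst set_integral_const) auto
  also have "\<dots> \<le> (LINT s:Z|lborel. E n s)"
  proof (rule set_integral_mono)
    show "set_integrable lborel Z (\<lambda>s. exp (\<theta> * ?c))"
      using Z ZI by (intro set_integrable_bounded[where B = "exp (\<theta> * ?c)"]) auto
    show "set_integrable lborel Z (E n)" using Z ZI by (rule E_set_integrable)
    show "exp (\<theta> * ?c) \<le> E n s" if "s \<in> Z" for s
      using that \<theta>_nonneg by (auto simp: E_def Z_def intro!: mult_left_mono)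
  qed
  also have "\<dots> \<le> mass n" unfolding mass_def set_lebesgue_integral_def
  proof (rule integral_mono)
    show "integrable lborel (\<lambda>s. indicator Z s *\<^sub>R E n s)"
      using E_set_integrable[OF Z ZI] by (simp only: set_integrable_def)
    show "integrable lborel (\<lambda>s. indicator {p..<q} s *\<^sub>R E n s)"
      using E_set_integrable[of "{p..<q}" n] by (simp add: set_integrable_def)
    show "indicator Z s *\<^sub>R E n s \<le> indicator {p..<q} s *\<^sub>R E n s" for s
      using ZI E_pos[of n s] by (auto simp: indicator_def)
  qed
  also have "\<dots> \<le> (q - p) * exp (C3 * C4 * \<theta> * (v - u) * real n)" using mass_exp_le[OF supp] assms by blast
  finally have "measure lborel Z \<le> (q - p) * exp (C3 * C4 * \<theta> * (v - u) * real n) / exp (\<theta> * ?c)"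
    by (simp add: field_simps)
  also have "\<dots> = (q - p) * exp (- (C3 * C4 * \<theta> * (v - u))) ^ n"
  proof -
    have "exp (C3 * C4 * \<theta> * (v - u) * real n) / exp (\<theta> * ?c) = exp (real n * - (C3 * C4 * \<theta> * (v - u)))"
      unfolding exp_diff[symmetric] by (simp add: algebra_simps)
    then show ?thesis unfolding exp_of_nat_mult[symmetric] by (simp only: times_divide_eq_right[symmetric])
  qed
  finally show "measure lborel {s \<in> {p..<q}. ?c \<le> visits n s} \<le> (q - p) * exp (- (C3 * C4 * \<theta> * (v - u))) ^ n"
    by (simp add: Z_def)
qed

lemma AE_visits_less:
  assumes supp: "\<And>x. 0 \<le> x \<Longrightarrow> x \<le> 1 \<Longrightarrow> x \<notin> {u..v} \<Longrightarrow> \<phi> x = 0" and "u < v" "0 < \<theta>"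
  shows "AE s in lborel. p \<le> s \<and> s < q \<longrightarrow> (\<forall>\<^sub>F n in sequentially. visits n s \<le> 2 * C3 * C4 * (v - u) * n)"
proof -
  define Z where "Z n = {s \<in> {p..<q}. 2 * C3 * C4 * (v - u) * real n \<le> visits n s}" for n
  have uv: "u \<le> v" using assms by simp
  note mv = measure_visits_le[OF supp uv, folded Z_def]
  let ?r = "exp (- (C3 * C4 * \<theta> * (v - u)))"
  have r: "?r < 1" using C3_pos C4_pos assms by simp
  have "AE s in lborel. eventually (\<lambda>n. s \<in> space lborel - Z n) sequentially"
  proof (rule borel_cantelli_AE1)
    show "Z n \<in> sets lborel" for n using mv(1) by simp
    have "Z n \<subseteq> {p..<q}" for n by (auto simp: Z_def)
    then show "emeasure lborel (Z n) < \<infinity>" for n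
      using emeasure_mono[of "Z n" "{p..<q}" lborel] p_less_q by (auto simp: le_less_trans)
    have "summable (\<lambda>n. (q - p) * ?r ^ n)" using r by (intro summable_mult summable_geometric) auto
    then show "summable (\<lambda>n. measure lborel (Z n))"
      by (rule summable_comparison_test') (use mv(2) in auto)
  qed
  then show ?thesis
  proof (rule AE_mp, intro AE_I2 impI)
    fix s assume "\<forall>\<^sub>F n in sequentially. s \<in> space lborel - Z n" "p \<le> s \<and> s < q"
    then show "\<forall>\<^sub>F n in sequentially. visits n s \<le> 2 * C3 * C4 * (v - u) * n"
      by (elim eventually_mono) (auto simp: Z_def)
  qed
qed

end

context expanding_family
begin

text \<open>The constant \<open>2 * C3 * C4\<close> does not involve \<open>\<phi>\<close>,
  \<open>\<Lambda>\<close> or \<open>\<theta>\<close>; only the time from which the bound holds may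
  depend on them. This uniformity gives the weak limits a bounded density.\<close>

theorem AE_eventually_visits_le:
  fixes \<phi> :: "real \<Rightarrow> real"
  assumes range: "\<And>x. 0 \<le> x \<Longrightarrow> x \<le> 1 \<Longrightarrow> 0 \<le> \<phi> x \<and> \<phi> x \<le> 1"
    and lip: "\<And>x z. 0 \<le> x \<Longrightarrow> x \<le> z \<Longrightarrow> z \<le> 1 \<Longrightarrow> \<bar>\<phi> z - \<phi> x\<bar> \<le> \<Lambda> * (z - x)" and "0 \<le> \<Lambda>"
    and meas: "\<phi> \<in> borel_measurable borel"
    and supp: "\<And>x. 0 \<le> x \<Longrightarrow> x \<le> 1 \<Longrightarrow> x \<notin> {u..v} \<Longrightarrow> \<phi> x = 0" and "u < v"
  shows "AE s in lborel. p \<le> s \<and> s < q \<longrightarrow>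
    (\<forall>\<^sub>F n in sequentially. (\<Sum>j<n. \<phi> (T (y j s))) \<le> 2 * C3 * C4 * (v - u) * n)"
proof -
  define X where "X = \<Lambda> / A * (R / (lam - 1) + R)"
  have X: "0 \<le> X" unfolding X_def using assms A_pos R_pos expansion by (intro mult_nonneg_nonneg) auto
  \<comment> \<open>The entries secure \<open>\<theta> \<le> 1\<close>, the contraction
    \<open>exp \<theta> / lam < 1\<close> and the variation of \<open>E\<close> by at most 2; the
    denominator \<open>X + 1\<close> stays positive when \<open>X = 0\<close>.\<close>
  define \<theta> where "\<theta> = min 1 (min (ln ((1 + lam) / 2)) (ln 2 / (X + 1)))"
  have \<theta>_pos: "0 < \<theta>" unfolding \<theta>_def using expansion X by simp
  have "weighted_family T d b R m H \<alpha> g p q A c0 C0 \<phi> \<theta> \<Lambda>"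
  proof unfold_locales
    show "exp \<theta> \<le> (1 + lam) / 2"
    proof -
      have "exp \<theta> \<le> exp (ln ((1 + lam) / 2))" unfolding exp_le_cancel_iff by (simp add: \<theta>_def)
      then show ?thesis using expansion by simp
    qed
    have "\<theta> * X \<le> ln 2 / (X + 1) * (X + 1)" using X \<theta>_pos by (intro mult_mono) (auto simp: \<theta>_def)
    then show "\<theta> * (\<Lambda> / A * (R / (lam - 1) + R)) \<le> ln 2" using X by (simp add: X_def)
  qed (use assms \<theta>_pos in \<open>auto simp: \<theta>_def\<close>)
  then interpret weighted_family T d b R m H \<alpha> g p q A c0 C0 \<phi> \<theta> \<Lambda> .
  show ?thesis using AE_visits_less[OF supp \<open>u < v\<close> \<theta>_pos] by (simp add: visits_def)
qed

end

section \<open>Uniform mixing\<close>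

text \<open>A compact set is the decreasing intersection of finite unions of the dyadic intervals
  meeting it, on which the inequality adds up; inner regularity then reaches all Borel sets.\<close>

lemma emeasure_le_of_intervals:
  fixes M N :: "real measure"
  assumes M: "finite_measure M" "sets M = sets borel" and N: "finite_measure N" "sets N = sets borel"
    and le: "\<And>u v. u < v \<Longrightarrow> emeasure M {u..<v} \<le> emeasure N {u..<v}"
    and B: "B \<in> sets borel"
  shows "emeasure M B \<le> emeasure N B"
proof -
  have compact_le: "emeasure M C \<le> emeasure N C" if C: "compact C" for C
  proof -
    define F where "F n = (\<lambda>z. \<lfloor>2 ^ n * z\<rfloor>) ` C" for n :: nat
    define I where "I n i = {real_of_int i / 2 ^ n..<(real_of_int i + 1) / 2 ^ n}" for n :: nat and i :: int
    define G where "G n = (\<Union>i\<in>F n. I n i)" for n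
    have I_iff: "x \<in> I n i \<longleftrightarrow> \<lfloor>2 ^ n * x\<rfloor> = i" for x n i
      by (auto simp: I_def floor_eq_iff field_simps)
    have fin: "finite (F n)" for n
    proof -
      obtain c where c: "\<And>z. z \<in> C \<Longrightarrow> \<bar>z\<bar> \<le> c"
        using compact_imp_bounded[OF C] by (auto simp: bounded_real)
      have "F n \<subseteq> {\<lfloor>- (2 ^ n * c)\<rfloor>..\<lfloor>2 ^ n * c\<rfloor>}"
      proof
        fix i assume "i \<in> F n"
        then obtain z where z: "z \<in> C" "i = \<lfloor>2 ^ n * z\<rfloor>" by (auto simp: F_def)
        have "- c \<le> z" "z \<le> c" using c[OF z(1)] by auto
        then have "- (2 ^ n * c) \<le> 2 ^ n * z" "2 ^ n * z \<le> 2 ^ n * c"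
          using mult_left_mono[of "- c" z "2 ^ n"] by auto
        then show "i \<in> {\<lfloor>- (2 ^ n * c)\<rfloor>..\<lfloor>2 ^ n * c\<rfloor>}" using z by (auto intro: floor_mono)
      qed
      then show ?thesis by (rule finite_subset) simp
    qed
    have disj: "disjoint_family_on (I n) (F n)" for n
      by (auto simp: disjoint_family_on_def I_iff)
    have I_borel: "I n i \<in> sets borel" for n i by (simp add: I_def)
    have G_borel: "G n \<in> sets borel" for n using fin I_borel by (auto simp: G_def)
    have emG: "emeasure L (G n) = (\<Sum>i\<in>F n. emeasure L (I n i))" if "sets L = sets borel" for L :: "real measure" and n
      unfolding G_def using fin disj I_borel that by (intro sum_emeasure[symmetric]) auto
    have MG_le: "emeasure M (G n) \<le> emeasure N (G n)" for n
      unfolding emG[OF M(2)] emG[OF N(2)]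
      by (intro sum_mono) (auto simp: I_def intro!: le divide_strict_right_mono)
    have C_sub: "C \<subseteq> G n" for n by (auto simp: G_def I_iff F_def)
    have dec: "decseq G"
    proof (rule decseq_SucI, rule subsetI)
      fix n x assume "x \<in> G (Suc n)"
      then obtain z where z: "z \<in> C" "\<lfloor>2 ^ Suc n * x\<rfloor> = \<lfloor>2 ^ Suc n * z\<rfloor>" by (auto simp: G_def I_iff F_def)
      have "\<lfloor>2 ^ n * w\<rfloor> = \<lfloor>2 ^ Suc n * w\<rfloor> div 2" for w :: real
        using floor_divide_real_eq_div[of 2 "2 ^ Suc n * w"] by simp
      then show "x \<in> G n" using z by (auto simp: G_def I_iff F_def)
    qed
    have C_closed: "closed C" using C by (rule compact_imp_closed)
    have "(\<Inter>n. G n) = C"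
    proof (intro equalityI subsetI)
      fix x assume x: "x \<in> (\<Inter>n. G n)"
      have "\<exists>z\<in>C. dist z x < e" if "e > 0" for e
      proof -
        obtain n where n: "(1/2) ^ n < e" using real_arch_pow_inv[of e "1/2"] \<open>e > 0\<close> by auto
        from x have "x \<in> G n" by blast
        then obtain z where z: "z \<in> C" "\<lfloor>2 ^ n * x\<rfloor> = \<lfloor>2 ^ n * z\<rfloor>" by (auto simp: G_def I_iff F_def)
        have "\<bar>2 ^ n * x - 2 ^ n * z\<bar> < 1" using z(2) by linarith
        then have "2 ^ n * \<bar>x - z\<bar> < 1" by (simp add: abs_mult right_diff_distrib[symmetric])
        then have "\<bar>x - z\<bar> < (1/2) ^ n" by (simp add: power_divide field_simps)
        then show ?thesis using z n by (intro bexI[of _ z]) (auto simp: dist_real_def)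
      qed
      then show "x \<in> C" using C_closed closed_approachable by blast
    qed (use C_sub in auto)
    moreover have "(\<lambda>n. emeasure N (G n)) \<longlonglongrightarrow> emeasure N (\<Inter>n. G n)"
      using dec G_borel N by (intro Lim_emeasure_decseq) (auto simp: finite_measure.emeasure_finite)
    moreover have "emeasure M C \<le> emeasure N (G n)" for n
      using order_trans[OF emeasure_mono[OF C_sub[of n], of M] MG_le[of n]] G_borel M by auto
    ultimately show ?thesis by (intro LIMSEQ_le_const) auto
  qed
  have "emeasure M B = (SUP C\<in>{C. C \<subseteq> B \<and> compact C}. emeasure M C)"
    using M B by (intro inner_regular) (auto simp: finite_measure.emeasure_finite)
  also have "\<dots> \<le> emeasure N B"
  proof (rule SUP_least)
    fix C assume "C \<in> {C. C \<subseteq> B \<and> compact C}"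
    then have C: "C \<subseteq> B" "compact C" by auto
    from compact_le[OF C(2)] show "emeasure M C \<le> emeasure N B"
      using order_trans[OF _ emeasure_mono[OF C(1), of N]] B N by auto
  qed
  finally show ?thesis .
qed

section \<open>Mixing times of families with constant scaling\<close>

locale constant_family = expanding_family +
  assumes \<alpha>_const: "p \<le> s \<Longrightarrow> s < q \<Longrightarrow> \<alpha> s = A"

context expanding_family
begin

text \<open>The sum of \<open>1 / w n l\<close> is eventually at most \<open>Cs * (q - p)\<close>;
  cylinders whose image stays below \<open>\<delta>\<close> are then negligible, and
  \<open>2 * \<kappa>\<close> bounds from below the share of any other non-leftmost cylinder sent
  into a subinterval of \<open>{0..<\<delta>}\<close>, per unit length. None of the three depends on
  \<open>p\<close> or \<open>q\<close>.\<close>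

definition Cs :: real where "Cs = C1 / (1 - 1 / lam) + 1"
definition \<delta> :: real where "\<delta> = c0 / (4 * exp D * exp D * Cs)"
definition \<kappa> :: real where "\<kappa> = c0 / (2 * U * exp D * exp D * exp D * R)"

lemma Cs_pos: "0 < Cs"
  unfolding Cs_def using C1_nonneg expansion by (intro add_nonneg_pos divide_nonneg_nonneg) auto

lemma \<delta>_pos: "0 < \<delta>" unfolding \<delta>_def using Cs_pos c0_pos by simp

lemma \<kappa>_pos: "0 < \<kappa>" unfolding \<kappa>_def using U_pos R_pos c0_pos by simp

lemma measure_cyl_le:
  assumes "l \<in> base n" "0 \<le> r" "\<And>t. t \<in> cyl n l \<Longrightarrow> y n t \<le> r"
  shows "measure lborel (cyl n l) \<le> exp D * exp D * r / (c0 * w n l)"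
proof (rule measure_le_diameter[OF cyl_measurable])
  have w0: "0 < w n l" using w_pos base_D[OF assms(1)] by auto
  then show "0 \<le> exp D * exp D * r / (c0 * w n l)" using assms c0_pos by simp
  fix s t assume st: "s \<in> cyl n l" "t \<in> cyl n l" "s \<le> t"
  note s = cyl_D[OF assms(1) st(1)] and t = cyl_D[OF assms(1) st(2)]
  have same: "same n s t" using s t by (metis same_sym same_trans)
  have "exp (- D) * c0 * (exp (- D) * w n l) * (t - s) \<le> exp (- D) * c0 * w n s * (t - s)"
    using w_lower[of l s n] s st c0_pos by (intro mult_right_mono mult_left_mono) auto
  also have "\<dots> \<le> y n t - y n s" using dy_ge[of s t n] s t st same by auto
  also have "\<dots> \<le> r" using assms(3)[OF st(2)] y_bounds[of s n] s by auto
  finally show "t - s \<le> exp D * exp D * r / (c0 * w n l)"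
    using c0_pos w0 by (simp add: exp_minus field_simps)
qed

end

context constant_family
begin

lemma w_upper:
  assumes "p \<le> s" "s \<le> t" "t < q" "same n s t"
  shows "w n t \<le> exp D * w n s"
proof -
  have I: "s < q" "p \<le> t" using assms by auto
  have "w n t \<le> w n s * exp (H * (\<Sum>j<n. y j t - y j s))"
    using assms(4)
  proof (induction n)
    case 0 then show ?case by simp
  next
    case (Suc n)
    have sn: "same n s t" "branch (y n s) = branch (y n t)" using Suc by (auto simp: same_Suc)
    have d0: "0 < d (y n t)" using d_ge[of "y n t"] y_bounds[OF I(2) assms(3), of n] m_pos by linarith
    have "w (Suc n) t = w n t * (A * d (y n t))" using I assms by (simp add: w_Suc \<alpha>_const)
    also have "\<dots> \<le> (w n s * exp (H * (\<Sum>j<n. y j t - y j s))) * (A * (d (y n s) * exp (H * (y n t - y n s))))"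
      using Suc.IH[OF sn(1)] w_pos[OF assms(1) I(1), of n] d0 A_pos
        T_on_branch(5)[OF y_bounds(1)[OF assms(1) I(1)] y_mono[OF assms(1-3) sn(1)] y_bounds(2)[OF I(2) assms(3)] sn(2)]
      by (intro mult_mono) auto
    also have "\<dots> = w (Suc n) s * exp (H * (\<Sum>j<Suc n. y j t - y j s))"
      using I assms by (simp add: w_Suc \<alpha>_const distrib_left exp_add)
    finally show ?case .
  qed
  also have "\<dots> \<le> w n s * exp D"
    using sum_dy_le_D[OF assms] w_pos[OF assms(1) I(1), of n] by simp
  finally show ?thesis by (simp add: mult.commute)
qed

text \<open>The cylinder starts at height 0 and reaches \<open>v\<close>, so \<open>y n\<close>
  crosses the whole band from \<open>u\<close> to \<open>v\<close>, with slope at most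
  \<open>U * exp D * w n l\<close>.\<close>

lemma measure_preimage_cyl_ge:
  assumes l: "l \<in> base n" "l \<noteq> p" and t: "t \<in> cyl n l" "v \<le> y n t" and uv: "0 \<le> u" "u < v"
  shows "(v - u) / (U * exp D * w n l) \<le> measure lborel {s \<in> cyl n l. y n s \<in> {u..<v}}"
    and "{s \<in> cyl n l. y n s \<in> {u..<v}} \<in> sets borel"
proof -
  let ?Z = "{s \<in> cyl n l. y n s \<in> {u..<v}}"
  note c = cyl_D[OF l(1) t(1)]
  have w0: "0 < w n l" using w_pos c by auto
  have cont: "continuous_on {l..t} (y n)" using y_continuous c by auto
  have yl: "y n l = 0" using y_base_eq_0[OF l] .
  have "{s \<in> space (restrict_space borel {p..<q}). y n s \<in> {u..<v}} \<in> sets (restrict_space borel {p..<q})"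
    by (rule measurable_sets_Collect[OF y_measurable]) auto
  then have "{s \<in> {p..<q}. y n s \<in> {u..<v}} \<in> sets borel"
    by (simp add: sets_restrict_space_iff space_restrict_space)
  moreover have "?Z = cyl n l \<inter> {s \<in> {p..<q}. y n s \<in> {u..<v}}"
    using cyl_subset[of n l] by auto
  ultimately show Z: "?Z \<in> sets borel" using cyl_measurable by auto
  obtain s2 where s2: "l \<le> s2" "s2 \<le> t" "y n s2 = v"
    using IVT'[of "y n" l v t] cont t uv c yl by auto
  obtain s1 where s1: "l \<le> s1" "s1 \<le> s2" "y n s1 = u"
    using IVT'[of "y n" l u s2] continuous_on_subset[OF cont, of "{l..s2}"] s2 uv yl by auto
  have same1: "same n l s1" "same n l s2" "same n s1 s2"
    using same_between[of l _ t n] c s1 s2 by (auto, metis order_trans same_sym same_trans)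
  have "v - u \<le> U * w n s1 * (s2 - s1)" using dy_le[of s1 s2 n] s1 s2 c same1 by auto
  also have "\<dots> \<le> U * (exp D * w n l) * (s2 - s1)"
    using w_upper[of l s1 n] s1 s2 c same1 U_pos by (intro mult_right_mono mult_left_mono) auto
  finally have "(v - u) / (U * exp D * w n l) \<le> s2 - s1"
    using U_pos w0 by (simp add: field_simps)
  also have "s2 - s1 = measure lborel {s1..<s2}" using s1 by simp
  also have "\<dots> \<le> measure lborel ?Z"
  proof (rule measure_mono_fmeasurable)
    show "{s1..<s2} \<subseteq> ?Z"
    proof
      fix s assume s: "s \<in> {s1..<s2}"
      have same: "same n l s" using same_between[of l s t n] c s s1 s2 by auto
      then have "same n s1 s" "same n s s2" using same1 by (metis same_sym same_trans)+
      then have "y n s1 \<le> y n s" "y n s < y n s2" using y_mono[of s1 s n] y_strict[of s s2 n] s s1 s2 c by auto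
      then show "s \<in> ?Z" using s s1 s2 c same by (auto simp: cyl_def)
    qed
    show "?Z \<in> fmeasurable lborel"
      using Z cyl_fmeasurable[of n l] emeasure_mono[of ?Z "cyl n l" lborel] cyl_measurable
      by (intro fmeasurableI) (auto simp: le_less_trans)
  qed simp
  finally show "(v - u) / (U * exp D * w n l) \<le> measure lborel ?Z" .
qed

text \<open>With \<open>\<theta> = 0\<close> the mass stays \<open>q - p\<close> and
  \<open>S\<close> is the sum of \<open>1 / w n l\<close>, which controls the total length of
  cylinders with low image. For a suitable \<open>n\<close> the leftmost and the low cylinders fill
  at most half of \<open>{p..<q}\<close>; each other one maps across \<open>{0..<\<delta>}\<close>
  with bounded distortion.\<close>

lemma ex_mixing_time:
  "\<exists>n. \<forall>u v. 0 \<le> u \<and> u < v \<and> v \<le> \<delta> \<longrightarrow>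
    \<kappa> * (q - p) * (v - u) \<le> measure lborel {s \<in> {p..<q}. y n s \<in> {u..<v}}"
proof -
  interpret W: weighted_family T d b R m H \<alpha> g p q A c0 C0 "\<lambda>_. 0" 0 0
    by unfold_locales (use expansion in auto)
  let ?r = "1 / lam"
  have r: "0 < ?r" "?r < 1" using expansion by auto
  have mass: "W.mass n = q - p" for n
    using p_less_q by (simp add: W.mass_def W.E_def W.visits_def set_integral_const)
  have S: "W.S n = (\<Sum>l\<in>base n. 1 / w n l)" for n by (simp add: W.S_def W.E_def W.visits_def)
  \<comment> \<open>A stationary term plus a transient. The transient carries a factor
    \<open>n\<close> because the inhomogeneity \<open>C2 * ?r ^ n\<close> decays at the rate
    \<open>?r\<close> of the recursion itself.\<close>
  have S_le: "W.S n \<le> C1 / (1 - ?r) * (q - p) + (1 + C2 * real n / ?r) * ?r ^ n" for n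
  proof (induction n)
    case 0
    then show ?case using W.S_0 C1_nonneg r p_less_q by simp
  next
    case (Suc n)
    have "W.S (Suc n) \<le> ?r * W.S n + C1 * (q - p) + C2 * ?r ^ n"
      using W.S_Suc_le[of n] by (simp add: mass)
    also have "\<dots> \<le> ?r * (C1 / (1 - ?r) * (q - p) + (1 + C2 * real n / ?r) * ?r ^ n) + C1 * (q - p) + C2 * ?r ^ n"
      using Suc r C1_nonneg C2_nonneg by (intro add_mono mult_left_mono) auto
    also have "\<dots> = C1 / (1 - ?r) * (q - p) + (1 + C2 * real (Suc n) / ?r) * ?r ^ Suc n"
    proof -
      have *: "x * (C / (1 - x) * X + (1 + E * N / x) * x ^ n) + C * X + E * x ^ n
        = C / (1 - x) * X + (1 + E * (N + 1) / x) * x ^ Suc n"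
        if "0 < x" "x < 1" for x C X E N :: real
        using that by (simp add: divide_simps) (simp add: algebra_simps)
      show ?thesis using *[OF r, of C1 "q - p" C2 "real n"] by (simp add: add.commute)
    qed
    finally show ?case .
  qed
  have "(\<lambda>n. (1 + C2 * real n / ?r) * ?r ^ n) \<longlonglongrightarrow> 0"
  proof -
    have "(\<lambda>n. real n * ?r ^ n) \<longlonglongrightarrow> 0" using r by (intro powser_times_n_limit_0) auto
    moreover have "(\<lambda>n. ?r ^ n) \<longlonglongrightarrow> 0" using r by (intro LIMSEQ_realpow_zero) auto
    ultimately have "(\<lambda>n. ?r ^ n + C2 / ?r * (real n * ?r ^ n)) \<longlonglongrightarrow> 0 + C2 / ?r * 0" by (intro tendsto_add tendsto_mult tendsto_const)
    then show ?thesis by (simp add: algebra_simps)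
  qed
  then have ev1: "eventually (\<lambda>n. (1 + C2 * real n / ?r) * ?r ^ n < q - p) sequentially"
    using p_less_q by (intro order_tendstoD) auto
  have "(\<lambda>n. exp D * exp D * R / c0 * ?r ^ n) \<longlonglongrightarrow> exp D * exp D * R / c0 * 0"
    using r by (intro tendsto_mult tendsto_const LIMSEQ_realpow_zero) auto
  then have ev2: "eventually (\<lambda>n. exp D * exp D * R / c0 * ?r ^ n < (q - p) / 4) sequentially"
    using p_less_q by (intro order_tendstoD) auto
  from eventually_happens[OF eventually_conj[OF ev1 ev2]]
  obtain n where n: "(1 + C2 * real n / ?r) * ?r ^ n < q - p" "exp D * exp D * R / c0 * ?r ^ n < (q - p) / 4"
    by auto
  have Sn: "W.S n \<le> Cs * (q - p)" using S_le[of n] n(1) by (simp add: Cs_def distrib_right)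
  define good where "good = {l \<in> base n. l \<noteq> p \<and> (\<exists>t\<in>cyl n l. \<delta> \<le> y n t)}"
  define bad where "bad = {l \<in> base n. l \<noteq> p \<and> \<not> (\<exists>t\<in>cyl n l. \<delta> \<le> y n t)}"
  have wl: "0 < w n l" if "l \<in> base n" for l using w_pos base_D[OF that] by auto
  have total: "(\<Sum>l\<in>base n. measure lborel (cyl n l)) = q - p"
  proof -
    have "(LINT s:cyl n l|lborel. W.E n s) = measure lborel (cyl n l)" for l
      using cyl_measurable cyl_fmeasurable[of n l] by (simp add: W.E_def W.visits_def set_integral_const)
    then show ?thesis using W.mass_cyl[of n n] by (simp add: mass)
  qed
  have split: "base n = insert p (good \<union> bad)" "p \<notin> good \<union> bad" "good \<inter> bad = {}" "finite good" "finite bad"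
    using p_in_base finite_base by (auto simp: good_def bad_def)
  have "q - p = measure lborel (cyl n p) + ((\<Sum>l\<in>good. measure lborel (cyl n l)) + (\<Sum>l\<in>bad. measure lborel (cyl n l)))"
    unfolding total[symmetric] split(1) using split(2-5) by (simp add: sum.union_disjoint)
  moreover have "measure lborel (cyl n p) \<le> (q - p) / 4"
  proof -
    have "measure lborel (cyl n p) \<le> exp D * exp D * R / (c0 * w n p)"
      using measure_cyl_le[OF p_in_base, of R n] R_pos y_bounds(2) by (auto simp: cyl_def)
    also have "\<dots> \<le> exp D * exp D * R / (c0 * lam ^ n)"
      using w_ge[of p n] p_less_q expansion c0_pos R_pos wl[OF p_in_base]
      by (intro divide_left_mono mult_left_mono mult_pos_pos) auto
    also have "\<dots> = exp D * exp D * R / c0 * ?r ^ n" by (simp add: power_divide)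
    finally show ?thesis using n(2) by linarith
  qed
  moreover have "(\<Sum>l\<in>bad. measure lborel (cyl n l)) \<le> (q - p) / 4"
  proof -
    have "(\<Sum>l\<in>bad. measure lborel (cyl n l)) \<le> (\<Sum>l\<in>bad. exp D * exp D * \<delta> / c0 * (1 / w n l))"
    proof (rule sum_mono)
      fix l assume "l \<in> bad"
      then have "measure lborel (cyl n l) \<le> exp D * exp D * \<delta> / (c0 * w n l)"
        using \<delta>_pos by (intro measure_cyl_le) (auto simp: bad_def not_le less_imp_le)
      then show "measure lborel (cyl n l) \<le> exp D * exp D * \<delta> / c0 * (1 / w n l)" by simp
    qed
    also have "\<dots> \<le> (\<Sum>l\<in>base n. exp D * exp D * \<delta> / c0 * (1 / w n l))"
      using finite_base wl \<delta>_pos c0_pos by (intro sum_mono2) (auto simp: bad_def less_imp_le)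
    also have "\<dots> = exp D * exp D * \<delta> / c0 * W.S n" by (simp only: S sum_distrib_left)
    also have "\<dots> \<le> exp D * exp D * \<delta> / c0 * (Cs * (q - p))"
      using Sn \<delta>_pos c0_pos by (intro mult_left_mono) auto
    also have "\<dots> = (q - p) / 4" using Cs_pos c0_pos by (simp add: \<delta>_def field_simps)
    finally show ?thesis .
  qed
  moreover have "x / 2 \<le> B" if "x = A + (B + C)" "A \<le> x / 4" "C \<le> x / 4" for x A B C :: real
    using that by linarith
  ultimately have good: "(q - p) / 2 \<le> (\<Sum>l\<in>good. measure lborel (cyl n l))" by blast
  have "\<kappa> * (q - p) * (v - u) \<le> measure lborel {s \<in> {p..<q}. y n s \<in> {u..<v}}"
    if uv: "0 \<le> u" "u < v" "v \<le> \<delta>" for u v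
  proof -
    let ?Z = "\<lambda>l. {s \<in> cyl n l. y n s \<in> {u..<v}}"
    have Zm: "?Z l \<in> sets borel" "2 * \<kappa> * (v - u) * measure lborel (cyl n l) \<le> measure lborel (?Z l)" if l: "l \<in> good" for l
    proof -
      from l obtain t where t: "t \<in> cyl n l" "\<delta> \<le> y n t" and l': "l \<in> base n" "l \<noteq> p" by (auto simp: good_def)
      note mp = measure_preimage_cyl_ge[OF l' t(1) order_trans[OF uv(3) t(2)] uv(1,2)]
      show "?Z l \<in> sets borel" by (rule mp(2))
      have "measure lborel (cyl n l) \<le> exp D * exp D * R / (c0 * w n l)"
        using measure_cyl_le[OF l'(1), of R] R_pos y_bounds(2) by (auto simp: cyl_def)
      then have "2 * \<kappa> * (v - u) * measure lborel (cyl n l) \<le> 2 * \<kappa> * (v - u) * (exp D * exp D * R / (c0 * w n l))"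
        using \<kappa>_pos uv by (intro mult_left_mono) auto
      also have "\<dots> = (v - u) / (U * exp D * w n l)"
        using U_pos R_pos c0_pos wl[OF l'(1)] by (simp add: \<kappa>_def field_simps)
      finally show "2 * \<kappa> * (v - u) * measure lborel (cyl n l) \<le> measure lborel (?Z l)" using mp(1) by linarith
    qed
    have "\<kappa> * (q - p) * (v - u) = 2 * \<kappa> * (v - u) * ((q - p) / 2)" by simp
    also have "\<dots> \<le> 2 * \<kappa> * (v - u) * (\<Sum>l\<in>good. measure lborel (cyl n l))"
      using good \<kappa>_pos uv by (intro mult_left_mono) auto
    also have "\<dots> \<le> (\<Sum>l\<in>good. measure lborel (?Z l))"
      unfolding sum_distrib_left using Zm(2) by (intro sum_mono)
    also have "\<dots> = measure lborel (\<Union>l\<in>good. ?Z l)"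
    proof (rule measure_finite_Union[symmetric])
      show "?Z ` good \<subseteq> sets lborel" using Zm(1) by auto
      show "disjoint_family_on ?Z good"
        by (auto simp: disjoint_family_on_def good_def cyl_def) (metis base_unique same_sym same_trans)
      show "emeasure lborel (?Z l) \<noteq> \<infinity>" if "l \<in> good" for l
        using emeasure_mono[of "?Z l" "cyl n l" lborel] cyl_fmeasurable[of n l] cyl_measurable by (auto simp: top_unique)
    qed (use split in auto)
    also have "\<dots> \<le> measure lborel {s \<in> {p..<q}. y n s \<in> {u..<v}}"
    proof (rule measure_mono_fmeasurable)
      show "(\<Union>l\<in>good. ?Z l) \<subseteq> {s \<in> {p..<q}. y n s \<in> {u..<v}}" using cyl_subset by blast
      show "(\<Union>l\<in>good. ?Z l) \<in> sets lborel" using Zm(1) split by auto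
      have "{s \<in> space (restrict_space borel {p..<q}). y n s \<in> {u..<v}} \<in> sets (restrict_space borel {p..<q})"
        by (rule measurable_sets_Collect[OF y_measurable]) auto
      then have "{s \<in> {p..<q}. y n s \<in> {u..<v}} \<in> sets borel"
        by (simp add: sets_restrict_space_iff space_restrict_space)
      moreover have "emeasure lborel {s \<in> {p..<q}. y n s \<in> {u..<v}} < \<infinity>"
        by (rule le_less_trans[OF emeasure_mono[of _ "{p..<q}"]]) (use p_less_q in auto)
      ultimately show "{s \<in> {p..<q}. y n s \<in> {u..<v}} \<in> fmeasurable lborel" by (intro fmeasurableI) auto
    qed
    finally show ?thesis .
  qed
  then show ?thesis by blast
qed

end

section \<open>Uniqueness of the invariant measure\<close>

text \<open>The cut-off \<open>R\<close> of the derivative estimates is \<open>a\<close> itself, as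
  \<open>a * x \<le> a\<close> on the unit interval.\<close>

locale scaled_map = expanding_branches T d b a m H for T d b a m H +
  assumes a_pos: "0 < a" and am: "1 < a * m"
begin

definition f :: "real \<Rightarrow> real" where "f x = T (a * x)"

lemma f_range: "x \<in> {0..1} \<Longrightarrow> f x \<in> {0..1}"
  using T_range[of "a * x"] a_pos by (simp add: f_def)

lemma funpow_f_range: "x \<in> {0..1} \<Longrightarrow> (f ^^ n) x \<in> {0..1}"
  by (induction n) (use f_range in auto)

lemma f_measurable: "f \<in> measurable (restrict_space borel {0..1}) (restrict_space borel {0..1})"
proof (rule measurable_restrict_space2)
  show "f \<in> space (restrict_space borel {0..1}) \<rightarrow> {0..1}"
    using f_range by (auto simp: space_restrict_space)
  have "(\<lambda>x. T (max 0 (a * x))) \<in> borel_measurable (restrict_space borel {0..1})"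
    by (intro measurable_compose[OF _ T_borel] measurable_restrict_space1) simp
  then show "f \<in> borel_measurable (restrict_space borel {0..1})"
    by (subst measurable_cong[where g = "\<lambda>x. T (max 0 (a * x))"])
       (use a_pos in \<open>auto simp: f_def space_restrict_space max_def zero_le_mult_iff\<close>)
qed

lemma funpow_f_measurable:
  "f ^^ n \<in> measurable (restrict_space borel {0..1}) (restrict_space borel {0..1})"
proof (induction n)
  case 0 then show ?case by (simp add: id_def)
next
  case (Suc n)
  then show ?case unfolding funpow.simps(2) by (rule measurable_comp[OF _ f_measurable])
qed

lemma constant_familyI:
  assumes "0 \<le> s0" "s0 < t0" "t0 \<le> 1"
  shows "constant_family T d b a m H (\<lambda>_. a) (\<lambda>s. a * s) s0 t0 a a a"
proof unfold_locales
  fix s assume "s0 \<le> s" "s < t0"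
  then show "0 \<le> a * s \<and> a * s \<le> a" using a_pos assms by (auto simp: mult_le_cancel_left1)
qed (use assms a_pos am in \<open>auto simp: algebra_simps\<close>)

text \<open>One time \<open>n\<close> per interval serves all targets at once, so the bound extends
  to Borel targets; \<open>\<delta>\<close> and \<open>\<kappa>\<close> are common to all intervals,
  so it extends to Borel sets in place of the interval.\<close>

definition mixing :: "real \<Rightarrow> real \<Rightarrow> bool" where
  "mixing \<delta> \<kappa> \<longleftrightarrow> (\<forall>s0 t0. 0 \<le> s0 \<and> s0 < t0 \<and> t0 \<le> 1 \<longrightarrow>
    (\<exists>n. \<forall>u v. 0 \<le> u \<and> u < v \<and> v \<le> \<delta> \<longrightarrow>
      \<kappa> * (t0 - s0) * (v - u) \<le> measure lborel {s \<in> {s0..<t0}. (f ^^ n) s \<in> {u..<v}}))"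

lemma ex_mixing: "\<exists>\<delta>>0. \<exists>\<kappa>>0. mixing \<delta> \<kappa>"
proof -
  interpret F0: constant_family T d b a m H "\<lambda>_. a" "\<lambda>s. a * s" 0 1 a a a
    by (rule constant_familyI) auto
  have "\<exists>n. \<forall>u v. 0 \<le> u \<and> u < v \<and> v \<le> F0.\<delta> / a \<longrightarrow>
      (F0.\<kappa> * a) * (t0 - s0) * (v - u) \<le> measure lborel {s \<in> {s0..<t0}. (f ^^ n) s \<in> {u..<v}}"
    if "0 \<le> s0" "s0 < t0" "t0 \<le> 1" for s0 t0
  proof -
    interpret F: constant_family T d b a m H "\<lambda>_. a" "\<lambda>s. a * s" s0 t0 a a a
      by (rule constant_familyI) (use that in auto)
    have y: "F.y n s = a * (f ^^ n) s" for n s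
      by (induction n) (auto simp: f_def)
    \<comment> \<open>The constants of \<open>F\<close> do not involve the interval, hence are those
      of \<open>F0\<close>.\<close>
    obtain n where n: "\<And>u v. 0 \<le> u \<Longrightarrow> u < v \<Longrightarrow> v \<le> F0.\<delta> \<Longrightarrow>
        F0.\<kappa> * (t0 - s0) * (v - u) \<le> measure lborel {s \<in> {s0..<t0}. F.y n s \<in> {u..<v}}"
      using F.ex_mixing_time by blast
    have "(F0.\<kappa> * a) * (t0 - s0) * (v - u) \<le> measure lborel {s \<in> {s0..<t0}. (f ^^ n) s \<in> {u..<v}}"
      if uv: "0 \<le> u" "u < v" "v \<le> F0.\<delta> / a" for u v
    proof -
      have "F0.\<kappa> * (t0 - s0) * (a * v - a * u) \<le> measure lborel {s \<in> {s0..<t0}. F.y n s \<in> {a * u..<a * v}}"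
        using uv a_pos by (intro n) (auto simp: field_simps)
      also have "{s \<in> {s0..<t0}. F.y n s \<in> {a * u..<a * v}} = {s \<in> {s0..<t0}. (f ^^ n) s \<in> {u..<v}}"
        using a_pos by (auto simp: y)
      finally show ?thesis by (simp add: algebra_simps)
    qed
    then show ?thesis by blast
  qed
  then have "mixing (F0.\<delta> / a) (F0.\<kappa> * a)" unfolding mixing_def by blast
  then show ?thesis using F0.\<delta>_pos F0.\<kappa>_pos a_pos
    by (intro exI[of _ "F0.\<delta> / a"] conjI exI[of _ "F0.\<kappa> * a"]) auto
qed

section \<open>Invariant densities and the set where one exceeds the other\<close>

abbreviation "M0 \<equiv> restrict_space lborel {0..1::real}"

lemma acip_density:
  assumes "is_acip f \<mu>"
  obtains h where "h \<in> borel_measurable M0" "\<mu> = density M0 h"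
proof -
  have fin: "emeasure M0 (space M0) \<noteq> \<infinity>" by (simp add: space_restrict_space emeasure_restrict_space)
  interpret M0: finite_measure M0 by (rule finite_measureI[OF fin])
  have "sets M0 = sets (restrict_space borel {0..1})" by (rule sets_restrict_space_cong) simp
  then show ?thesis using M0.Radon_Nikodym[of \<mu>] assms that by (auto simp: is_acip_def)
qed

lemma acip_funpow:
  assumes "is_acip f \<mu>" "B \<in> sets \<mu>"
  shows "emeasure \<mu> ((f ^^ n) -` B \<inter> {0..1}) = emeasure \<mu> B" "(f ^^ n) -` B \<inter> {0..1} \<in> sets \<mu>"
proof -
  have s: "sets \<mu> = sets (restrict_space borel {0..1})" and fm: "f \<in> measurable \<mu> \<mu>" and inv: "distr \<mu> \<mu> f = \<mu>"
    using assms(1) by (auto simp: is_acip_def)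
  have sp: "space \<mu> = {0..1}" using sets_eq_imp_space_eq[OF s] by (simp add: space_restrict_space)
  have fn: "f ^^ n \<in> measurable \<mu> \<mu>" for n
    using funpow_f_measurable[of n] measurable_cong_sets[OF s s] by auto
  have "distr \<mu> \<mu> (f ^^ n) = \<mu>"
  proof (induction n)
    case 0 then show ?case by (simp add: id_def distr_id)
  next
    case (Suc n)
    have "distr \<mu> \<mu> (f ^^ Suc n) = distr (distr \<mu> \<mu> (f ^^ n)) \<mu> f"
      unfolding funpow.simps(2) by (rule distr_distr[OF fm fn[of n], symmetric])
    then show ?case using Suc inv by (simp only:)
  qed
  then have "emeasure \<mu> B = emeasure (distr \<mu> \<mu> (f ^^ n)) B" by simp
  also have "\<dots> = emeasure \<mu> ((f ^^ n) -` B \<inter> {0..1})" using fn assms(2) by (simp add: emeasure_distr sp)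
  finally show "emeasure \<mu> ((f ^^ n) -` B \<inter> {0..1}) = emeasure \<mu> B" by simp
  show "(f ^^ n) -` B \<inter> {0..1} \<in> sets \<mu>" using measurable_sets[OF fn assms(2)] by (simp add: sp)
qed

lemma density_less_null:
  assumes h: "h1 \<in> borel_measurable M" "h2 \<in> borel_measurable M" and B: "B \<in> sets M"
    and less: "\<And>x. x \<in> B \<Longrightarrow> h2 x < h1 x"
    and le: "emeasure (density M h1) B \<le> emeasure (density M h2) B"
    and fin: "emeasure (density M h2) B < \<infinity>"
  shows "emeasure M B = 0"
proof (rule ccontr)
  assume "emeasure M B \<noteq> 0"
  have "(\<integral>\<^sup>+ x. h2 x * indicator B x \<partial>M) < (\<integral>\<^sup>+ x. h1 x * indicator B x \<partial>M)"
  proof (rule nn_integral_less)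
    show "(\<integral>\<^sup>+ x. h2 x * indicator B x \<partial>M) \<noteq> \<infinity>" using fin h B by (simp add: emeasure_density)
    show "AE x in M. h2 x * indicator B x \<le> h1 x * indicator B x"
      using less by (intro AE_I2) (auto simp: indicator_def less_imp_le)
    show "\<not> (AE x in M. h1 x * indicator B x \<le> h2 x * indicator B x)"
    proof
      assume "AE x in M. h1 x * indicator B x \<le> h2 x * indicator B x"
      then have "AE x in M. x \<notin> B" by (rule AE_mp) (use less in \<open>auto simp: not_less[symmetric] intro!: AE_I2\<close>)
      then show False using \<open>emeasure M B \<noteq> 0\<close> B AE_iff_null_sets[OF B] by auto
    qed
  qed (use h B in auto)
  then show False using le h B by (simp add: emeasure_density)
qed

text \<open>Almost no point of \<open>A\<close> leaves \<open>A\<close>, so preimages of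
  \<open>{0..<\<delta>} - A\<close> avoid \<open>A\<close> up to null sets. By mixing they would
  fill a fixed share of every interval, and hence of \<open>A\<close>, unless that target is
  null.\<close>

lemma positive_part_covers:
  assumes a1: "is_acip f (density M0 h1)" and a2: "is_acip f (density M0 h2)"
    and h: "h1 \<in> borel_measurable M0" "h2 \<in> borel_measurable M0"
    and A_def: "A = {x \<in> {0..1}. h2 x < h1 x}" and pos: "emeasure lborel A \<noteq> 0"
    and \<delta>: "0 < \<delta>" and \<kappa>: "0 < \<kappa>"
    and mix: "mixing \<delta> \<kappa>"
  shows "A \<in> sets borel" "emeasure lborel ({0..<\<delta>} - A) = 0"
proof -
  let ?m1 = "density M0 h1" and ?m2 = "density M0 h2"
  have sp: "space M0 = {0..1}" by (simp add: space_restrict_space)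
  have sM: "sets M0 = sets (restrict_space borel {0..1})" by (rule sets_restrict_space_cong) simp
  interpret p1: prob_space ?m1 using a1 by (simp add: is_acip_def)
  interpret p2: prob_space ?m2 using a2 by (simp add: is_acip_def)
  have AM: "A \<in> sets M0"
  proof -
    have "{x \<in> space M0. h2 x < h1 x} \<in> sets M0" using h by measurable
    then show ?thesis by (simp only: A_def sp)
  qed
  show A: "A \<in> sets borel" using AM by (simp add: sets_restrict_space_iff)
  have A01: "A \<subseteq> {0..1}" by (auto simp: A_def)
  have e0: "emeasure M0 B = emeasure lborel B" if "B \<in> sets M0" for B
    using that sets.sets_into_space[OF that] by (simp add: emeasure_restrict_space sp)
  define P where "P n = (f ^^ n) -` A \<inter> {0..1}" for n
  \<comment> \<open>Invariance gives \<open>A - P n\<close> and \<open>P n - A\<close> equal mass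
    under each measure. As \<open>h1 \<le> h2\<close> off \<open>A\<close>, the first measure of
    \<open>A - P n\<close> is at most the second, although \<open>h1 > h2\<close> there.\<close>
  have null: "emeasure lborel (A - P n) = 0" for n
  proof -
    have P: "P n \<in> sets M0" using acip_funpow(2)[OF a1, of A n] AM by (simp add: P_def)
    have P1: "emeasure ?m1 (P n) = emeasure ?m1 A" using acip_funpow(1)[OF a1, of A n] AM by (simp add: P_def)
    have P2: "emeasure ?m2 (P n) = emeasure ?m2 A" using acip_funpow(1)[OF a2, of A n] AM by (simp add: P_def)
    have 1: "measure ?m1 (A - P n) = measure ?m1 (P n - A)"
      using P1 AM P p1.finite_measure_Diff'[of A "P n"] p1.finite_measure_Diff'[of "P n" A]
      by (simp add: measure_def Int_commute)
    have 2: "measure ?m2 (A - P n) = measure ?m2 (P n - A)"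
      using P2 AM P p2.finite_measure_Diff'[of A "P n"] p2.finite_measure_Diff'[of "P n" A]
      by (simp add: measure_def Int_commute)
    have "emeasure ?m1 (A - P n) = emeasure ?m1 (P n - A)" using 1 by (simp add: p1.emeasure_eq_measure)
    also have "\<dots> \<le> emeasure ?m2 (P n - A)"
      using h AM P by (simp add: emeasure_density)
         (intro nn_integral_mono, auto simp: indicator_def A_def P_def not_less)
    also have "\<dots> = emeasure ?m2 (A - P n)" using 2 by (simp add: p2.emeasure_eq_measure)
    finally have le: "emeasure ?m1 (A - P n) \<le> emeasure ?m2 (A - P n)" .
    have "emeasure M0 (A - P n) = 0"
      by (rule density_less_null[OF h _ _ le]) (use AM P in \<open>auto simp: A_def p2.emeasure_eq_measure\<close>)
    then show ?thesis using e0[of "A - P n"] AM P by auto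
  qed
  define E where "E = {0..<\<delta>} - A"
  have E: "E \<in> sets borel" using A by (simp add: E_def)
  have E_fin: "emeasure lborel E < \<infinity>"
    by (rule le_less_trans[OF emeasure_mono[of _ "{0..<\<delta>}"]]) (use \<delta> in \<open>auto simp: E_def\<close>)
  have J: "ennreal (\<kappa> * (t0 - s0)) * emeasure lborel E \<le> emeasure lborel ({s0..<t0} - A)"
    if st: "0 \<le> s0" "s0 < t0" "t0 \<le> 1" for s0 t0
  proof -
    obtain n where n: "\<And>u v. 0 \<le> u \<Longrightarrow> u < v \<Longrightarrow> v \<le> \<delta> \<Longrightarrow>
        \<kappa> * (t0 - s0) * (v - u) \<le> measure lborel {s \<in> {s0..<t0}. (f ^^ n) s \<in> {u..<v}}"
      using mix st unfolding mixing_def by blast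
    define c where "c = \<kappa> * (t0 - s0)"
    have c0: "0 \<le> c" using \<kappa> st by (simp add: c_def)
    let ?J = "{s0..<t0}"
    have J01: "?J \<subseteq> {0..1}" using st by auto
    define N where "N = distr (restrict_space lborel ?J) borel (f ^^ n)"
    have fm: "f ^^ n \<in> borel_measurable (restrict_space lborel ?J)"
    proof -
      have "f ^^ n \<in> borel_measurable (restrict_space borel {0..1})"
        using funpow_f_measurable[of n] by (rule measurable_restrict_space2_iff[THEN iffD1, THEN conjunct1])
      then have "f ^^ n \<in> borel_measurable (restrict_space (restrict_space borel {0..1}) ?J)"
        by (rule measurable_restrict_space1)
      also have "restrict_space (restrict_space borel {0..1}) ?J = restrict_space borel ?J"
        using J01 by (subst restrict_restrict_space) (auto simp: Int_absorb1)
      finally show ?thesis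
        using measurable_cong_sets[OF sets_restrict_space_cong[OF sets_lborel] refl, of ?J borel] by simp
    qed
    have N: "emeasure N B = emeasure lborel {s \<in> ?J. (f ^^ n) s \<in> B}" if "B \<in> sets borel" for B
    proof -
      have "emeasure N B = emeasure (restrict_space lborel ?J) ((f ^^ n) -` B \<inter> ?J)"
        unfolding N_def using that fm by (simp add: emeasure_distr space_restrict_space)
      also have "\<dots> = emeasure lborel ((f ^^ n) -` B \<inter> ?J)"
        by (rule emeasure_restrict_space) auto
      also have "(f ^^ n) -` B \<inter> ?J = {s \<in> ?J. (f ^^ n) s \<in> B}" by auto
      finally show ?thesis .
    qed
    have sub_fin: "emeasure lborel X < \<infinity>" if "X \<subseteq> ?J" for X
      by (rule le_less_trans[OF emeasure_mono[OF that]]) (use st in auto)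
    define L where "L = density lborel (\<lambda>x. ennreal c * indicator {0..<\<delta>} x)"
    have L: "emeasure L B = ennreal c * emeasure lborel (B \<inter> {0..<\<delta>})" if "B \<in> sets borel" for B
      unfolding L_def using that by (simp add: emeasure_density mult.assoc indicator_inter_arith[symmetric]
          nn_integral_cmult_indicator Int_commute mult.commute[of "indicator {0..<\<delta>} _"])
    have "emeasure L E \<le> emeasure N E"
    proof (rule emeasure_le_of_intervals)
      show "finite_measure L"
        by (rule finite_measureI) (use L[of UNIV] \<delta> in \<open>auto simp: L_def ennreal_mult_eq_top_iff\<close>)
      show "finite_measure N"
      proof (rule finite_measureI)
        have "emeasure lborel {s \<in> ?J. (f ^^ n) s \<in> UNIV} < \<infinity>" by (rule sub_fin) auto
        then have "emeasure N UNIV \<noteq> \<infinity>" using N[of UNIV] by simp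
        then show "emeasure N (space N) \<noteq> \<infinity>" by (simp add: N_def)
      qed
      show "sets L = sets borel" "sets N = sets borel" by (simp_all add: L_def N_def)
      show "E \<in> sets borel" by (rule E)
      fix u v :: real assume "u < v"
      let ?u = "max u 0" and ?v = "min v \<delta>"
      show "emeasure L {u..<v} \<le> emeasure N {u..<v}"
      proof (cases "?u < ?v")
        case True
        have "{u..<v} \<inter> {0..<\<delta>} = {?u..<?v}" by auto
        then have "emeasure L {u..<v} = ennreal (c * (?v - ?u))"
          using True c0 by (simp add: L ennreal_mult)
        also have "\<dots> \<le> ennreal (measure lborel {s \<in> ?J. (f ^^ n) s \<in> {?u..<?v}})"
          using n[of ?u ?v] True by (intro ennreal_leI) (simp add: c_def)
        also have "\<dots> = emeasure lborel {s \<in> ?J. (f ^^ n) s \<in> {?u..<?v}}"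
        proof (rule emeasure_eq_ennreal_measure[symmetric])
          have "emeasure lborel {s \<in> ?J. (f ^^ n) s \<in> {?u..<?v}} < \<infinity>" by (rule sub_fin) auto
          then show "emeasure lborel {s \<in> ?J. (f ^^ n) s \<in> {?u..<?v}} \<noteq> top" by simp
        qed
        also have "\<dots> = emeasure N {?u..<?v}" by (rule N[symmetric]) simp
        also have "\<dots> \<le> emeasure N {u..<v}" by (rule emeasure_mono) (auto simp: N_def)
        finally show ?thesis .
      next
        case False
        then have e: "{u..<v} \<inter> {0..<\<delta>} = {}" by auto
        have "emeasure L {u..<v} = 0" using L[of "{u..<v}"] unfolding e by simp
        then show ?thesis by simp
      qed
    qed
    then have "ennreal c * emeasure lborel E \<le> emeasure lborel {s \<in> ?J. (f ^^ n) s \<in> E}"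
      unfolding L[OF E] N[OF E] by (simp add: E_def Int_absorb2 Diff_subset)
    \<comment> \<open>A point that lands in \<open>E\<close> after \<open>n\<close> steps is either
      outside \<open>A\<close> or has been carried out of \<open>A\<close>.\<close>
    also have "\<dots> \<le> emeasure lborel ((?J - A) \<union> (A - P n))"
    proof (rule emeasure_mono)
      show "{s \<in> ?J. (f ^^ n) s \<in> E} \<subseteq> (?J - A) \<union> (A - P n)" by (auto simp: E_def P_def)
      have "P n \<in> sets M0" using acip_funpow(2)[OF a1, of A n] AM by (simp add: P_def)
      then have "P n \<in> sets borel" by (simp add: sets_restrict_space_iff)
      then show "(?J - A) \<union> (A - P n) \<in> sets lborel" using A by simp
    qed
    also have "\<dots> \<le> emeasure lborel (?J - A) + emeasure lborel (A - P n)"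
    proof (rule emeasure_subadditive)
      have "P n \<in> sets M0" using acip_funpow(2)[OF a1, of A n] AM by (simp add: P_def)
      then have "P n \<in> sets borel" by (simp add: sets_restrict_space_iff)
      then show "?J - A \<in> sets lborel" "A - P n \<in> sets lborel" using A by auto
    qed
    finally show ?thesis by (simp add: null c_def)
  qed
  define e where "e = measure lborel E"
  have e: "emeasure lborel E = ennreal e" using E_fin by (simp add: e_def emeasure_eq_ennreal_measure)
  have e0: "0 \<le> e" by (simp add: e_def)
  \<comment> \<open>On intervals the inequality between \<open>L\<close> and \<open>N\<close> is the
    bound \<open>J\<close>. At \<open>A\<close> itself \<open>N\<close> vanishes, so
    \<open>\<kappa> * e\<close> times the length of \<open>A\<close> must be 0.\<close>
  define L where "L = density lborel (\<lambda>x. ennreal (\<kappa> * e) * indicator {0..<1::real} x)"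
  define N where "N = density lborel (indicator ({0..<1} - A))"
  have L: "emeasure L B = ennreal (\<kappa> * e) * emeasure lborel (B \<inter> {0..<1})" if "B \<in> sets borel" for B
    unfolding L_def using that by (simp add: emeasure_density mult.assoc indicator_inter_arith[symmetric]
        nn_integral_cmult_indicator Int_commute mult.commute[of "indicator {0..<1} _"])
  have N: "emeasure N B = emeasure lborel (B \<inter> {0..<1} - A)" if "B \<in> sets borel" for B
  proof -
    have "emeasure N B = (\<integral>\<^sup>+x. indicator ({0..<1} - A) x * indicator B x \<partial>lborel)"
      unfolding N_def using that A by (subst emeasure_density) auto
    also have "\<dots> = (\<integral>\<^sup>+x. indicator (B \<inter> {0..<1} - A) x \<partial>lborel)"
      by (intro nn_integral_cong) (simp split: split_indicator)
    also have "\<dots> = emeasure lborel (B \<inter> {0..<1} - A)"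
      using that A by (intro nn_integral_indicator) auto
    finally show ?thesis .
  qed
  have "emeasure L A \<le> emeasure N A"
  proof (rule emeasure_le_of_intervals)
    show "finite_measure L"
      by (rule finite_measureI) (use L[of UNIV] in \<open>auto simp: L_def ennreal_mult_eq_top_iff\<close>)
    have "emeasure lborel ({0..<1} - A) \<le> emeasure lborel {0..<1::real}" by (rule emeasure_mono) auto
    then show "finite_measure N"
      by (intro finite_measureI) (use N[of UNIV] in \<open>auto simp: N_def top_unique\<close>)
    show "sets L = sets borel" "sets N = sets borel" by (simp_all add: L_def N_def)
    show "A \<in> sets borel" by (rule A)
    fix u v :: real assume "u < v"
    let ?u = "max u 0" and ?v = "min v 1"
    show "emeasure L {u..<v} \<le> emeasure N {u..<v}"
    proof (cases "?u < ?v")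
      case True
      have i: "{u..<v} \<inter> {0..<1} = {?u..<?v}" by auto
      have "emeasure L {u..<v} = ennreal (\<kappa> * (?v - ?u)) * emeasure lborel E"
        using True \<kappa> e0 by (simp add: L i e ennreal_mult[symmetric] mult_ac)
      also have "\<dots> \<le> emeasure lborel ({?u..<?v} - A)" using True by (intro J) auto
      finally show ?thesis by (simp add: N i)
    next
      case False
      then have e: "{u..<v} \<inter> {0..<1} = {}" by auto
        have "emeasure L {u..<v} = 0" using L[of "{u..<v}"] unfolding e by simp
        then show ?thesis by simp
    qed
  qed
  then have "ennreal (\<kappa> * e) * emeasure lborel (A \<inter> {0..<1}) = 0"
  proof -
    have *: "A \<inter> {0..<1} - A = {}" by auto
    show ?thesis using \<open>emeasure L A \<le> emeasure N A\<close> unfolding L[OF A] N[OF A] * by simp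
  qed
  moreover have "emeasure lborel (A \<inter> {0..<1}) \<noteq> 0"
  proof
    assume "emeasure lborel (A \<inter> {0..<1}) = 0"
    moreover have "emeasure lborel A \<le> emeasure lborel ((A \<inter> {0..<1}) \<union> {1})"
      using A A01 by (intro emeasure_mono) auto
    moreover have "emeasure lborel ((A \<inter> {0..<1}) \<union> {1}) \<le> emeasure lborel (A \<inter> {0..<1}) + emeasure lborel {1::real}"
      using A by (intro emeasure_subadditive) auto
    ultimately show False using pos by simp
  qed
  ultimately have "\<kappa> * e \<le> 0" by (simp add: ennreal_eq_0_iff)
  then have "e = 0" using \<kappa> e0 by (simp add: mult_le_0_iff)
  then show "emeasure lborel ({0..<\<delta>} - A) = 0" using e by (simp add: E_def)
qed

theorem acip_unique:
  assumes "is_acip f \<mu>" "is_acip f \<nu>"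
  shows "\<mu> = \<nu>"
proof -
  obtain h1 where h1: "h1 \<in> borel_measurable M0" "\<mu> = density M0 h1" using acip_density[OF assms(1)] .
  obtain h2 where h2: "h2 \<in> borel_measurable M0" "\<nu> = density M0 h2" using acip_density[OF assms(2)] .
  have sp: "space M0 = {0..1}" by (simp add: space_restrict_space)
  interpret p1: prob_space \<mu> using assms by (simp add: is_acip_def)
  interpret p2: prob_space \<nu> using assms by (simp add: is_acip_def)
  have int: "(\<integral>\<^sup>+x. h x \<partial>M0) = emeasure (density M0 h) (space (density M0 h))"
    if "h \<in> borel_measurable M0" for h
    using that sets.top[of M0] by (subst emeasure_density) (auto intro!: nn_integral_cong simp: indicator_def)
  have int1: "(\<integral>\<^sup>+x. h1 x \<partial>M0) = 1"
    using p1.emeasure_space_1 int[OF h1(1)] by (simp only: h1(2))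
  have int2: "(\<integral>\<^sup>+x. h2 x \<partial>M0) = 1"
    using p2.emeasure_space_1 int[OF h2(1)] by (simp only: h2(2))
  obtain \<delta> \<kappa> where mix: "0 < \<delta>" "0 < \<kappa>" "mixing \<delta> \<kappa>" using ex_mixing by blast
  define A1 where "A1 = {x \<in> {0..1}. h2 x < h1 x}"
  define A2 where "A2 = {x \<in> {0..1}. h1 x < h2 x}"
  note acips = assms[unfolded h1(2) h2(2)]
  note cov1 = positive_part_covers[OF acips h1(1) h2(1) A1_def _ mix]
  note cov2 = positive_part_covers[OF acips(2,1) h2(1) h1(1) A2_def _ mix]
  have AE_iff: "(AE x in M0. k1 x \<le> k2 x) \<longleftrightarrow> emeasure lborel {x \<in> {0..1}. k2 x < k1 x} = 0"
    if "k1 \<in> borel_measurable M0" "k2 \<in> borel_measurable M0" for k1 k2 :: "real \<Rightarrow> ennreal"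
  proof -
    have m: "{x \<in> space M0. \<not> k1 x \<le> k2 x} \<in> sets M0" using that by measurable
    have eq: "{x \<in> space M0. \<not> k1 x \<le> k2 x} = {x \<in> {0..1}. k2 x < k1 x}" by (auto simp: sp not_le)
    have "emeasure M0 {x \<in> {0..1}. k2 x < k1 x} = emeasure lborel {x \<in> {0..1}. k2 x < k1 x}"
      by (rule emeasure_restrict_space) auto
    then show ?thesis using AE_iff_measurable[OF m refl] unfolding eq by simp
  qed
  \<comment> \<open>Equal integrals turn domination almost everywhere into equality, so
    \<open>A1\<close> and \<open>A2\<close> can only be null together.\<close>
  have AE_swap: "AE x in M0. k2 x \<le> k1 x" if "AE x in M0. k1 x \<le> k2 x"
    "k1 \<in> borel_measurable M0" "k2 \<in> borel_measurable M0" "(\<integral>\<^sup>+x. k1 x \<partial>M0) = 1" "(\<integral>\<^sup>+x. k2 x \<partial>M0) = 1"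
    for k1 k2 :: "real \<Rightarrow> ennreal"
  proof (rule ccontr)
    assume "\<not> (AE x in M0. k2 x \<le> k1 x)"
    from nn_integral_less[OF that(2,3) _ that(1) this] that(4,5) show False by simp
  qed
  have null_iff: "emeasure lborel A1 = 0 \<longleftrightarrow> emeasure lborel A2 = 0"
    unfolding A1_def A2_def AE_iff[OF h1(1) h2(1), symmetric] AE_iff[OF h2(1) h1(1), symmetric]
    using AE_swap[OF _ h1(1) h2(1) int1 int2] AE_swap[OF _ h2(1) h1(1) int2 int1] by blast
  have "emeasure lborel A1 = 0"
  proof (rule ccontr)
    assume pos: "emeasure lborel A1 \<noteq> 0"
    note c1 = cov1[OF pos] and c2 = cov2[OF pos[unfolded null_iff]]
    \<comment> \<open>Since \<open>A1\<close> and \<open>A2\<close> are disjoint, their complements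
      cover \<open>{0..<\<delta>}\<close>.\<close>
    have "emeasure lborel {0..<\<delta>} \<le> emeasure lborel (({0..<\<delta>} - A1) \<union> ({0..<\<delta>} - A2))"
      using c1(1) c2(1) by (intro emeasure_mono) (auto simp: A1_def A2_def)
    also have "\<dots> \<le> emeasure lborel ({0..<\<delta>} - A1) + emeasure lborel ({0..<\<delta>} - A2)"
      using c1(1) c2(1) by (intro emeasure_subadditive) auto
    finally show False using c1(2) c2(2) mix(1) by simp
  qed
  then have "AE x in M0. h1 x \<le> h2 x" "AE x in M0. h2 x \<le> h1 x"
    using null_iff unfolding A1_def A2_def AE_iff[OF h1(1) h2(1)] AE_iff[OF h2(1) h1(1)] by blast+
  then have "AE x in M0. h1 x = h2 x" by eventually_elim auto
  then show ?thesis unfolding h1(2) h2(2) by (rule density_cong[OF h1(1) h2(1)])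
qed

end

section \<open>Weak limits of empirical measures\<close>

text \<open>A Lipschitz substitute for the indicator of \<open>{u..v}\<close>: it is 1 there and
  falls linearly to 0 at distance \<open>(v - u) / 2\<close>.\<close>

definition trapezoid :: "real \<Rightarrow> real \<Rightarrow> real \<Rightarrow> real" where
  "trapezoid u v x = max 0 (min 1 (2 - \<bar>2 * x - (u + v)\<bar> / (v - u)))"

lemma trapezoid_range: "0 \<le> trapezoid u v x" "trapezoid u v x \<le> 1"
  by (auto simp: trapezoid_def)

lemma trapezoid_eq_1: "u < v \<Longrightarrow> x \<in> {u..v} \<Longrightarrow> trapezoid u v x = 1"
  by (auto simp: trapezoid_def field_simps abs_if)

text \<open>The interval used here is three times as long as \<open>{u..v}\<close>; this 3 enters
  the visit constant in \<open>AE_typical_window\<close>.\<close>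

lemma trapezoid_eq_0:
  assumes "u < v" "x \<notin> {u - (v - u)..v + (v - u)}" shows "trapezoid u v x = 0"
proof -
  have "2 * (v - u) \<le> \<bar>2 * x - (u + v)\<bar>" using assms by (auto simp: abs_if)
  then have "2 \<le> \<bar>2 * x - (u + v)\<bar> / (v - u)" using assms by (simp add: le_divide_eq)
  then show ?thesis by (simp add: trapezoid_def)
qed

lemma trapezoid_lipschitz:
  assumes "u < v"
  shows "\<bar>trapezoid u v y - trapezoid u v x\<bar> \<le> 2 / (v - u) * \<bar>y - x\<bar>"
proof -
  have "\<bar>trapezoid u v y - trapezoid u v x\<bar> \<le> \<bar>\<bar>2 * y - (u + v)\<bar> / (v - u) - \<bar>2 * x - (u + v)\<bar> / (v - u)\<bar>"
    unfolding trapezoid_def by linarith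
  also have "\<dots> = \<bar>\<bar>2 * y - (u + v)\<bar> - \<bar>2 * x - (u + v)\<bar>\<bar> / (v - u)"
    using assms by (simp add: diff_divide_distrib[symmetric])
  also have "\<dots> \<le> (2 * \<bar>y - x\<bar>) / (v - u)"
  proof (rule divide_right_mono)
    show "\<bar>\<bar>2 * y - (u + v)\<bar> - \<bar>2 * x - (u + v)\<bar>\<bar> \<le> 2 * \<bar>y - x\<bar>" by (simp add: abs_if)
  qed (use assms in simp)
  finally show ?thesis by simp
qed

lemma trapezoid_continuous: "isCont (trapezoid u v) x"
  unfolding trapezoid_def[abs_def] divide_inverse by (intro continuous_intros)

lemma trapezoid_measurable [measurable]: "trapezoid u v \<in> borel_measurable borel"
  using trapezoid_continuous
  by (intro borel_measurable_continuous_onI continuous_at_imp_continuous_on) auto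

text \<open>The constant sequence \<open>M\<close> converges weakly to \<open>N\<close>, so their
  characteristic functions agree.\<close>

lemma real_distribution_eqI:
  assumes M: "real_distribution M" and N: "real_distribution N"
    and eq: "\<And>\<psi> :: real \<Rightarrow> real. (\<And>x. isCont \<psi> x) \<Longrightarrow> (\<And>x. \<bar>\<psi> x\<bar> \<le> 1) \<Longrightarrow> integral\<^sup>L M \<psi> = integral\<^sup>L N \<psi>"
  shows "M = N"
proof (rule Levy_uniqueness[OF M N], rule ext)
  fix t
  have "weak_conv_m (\<lambda>n. M) N"
    using M N eq by (intro integral_bdd_continuous_conv_imp_weak_conv) auto
  from levy_continuity1[OF M N this, of t] show "char M t = char N t"
    by (simp add: LIMSEQ_const_iff)
qed

text \<open>Rational end points suffice, so that only countably many null sets of parameters need to be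
  discarded.\<close>

locale regular_orbit = scaled_map T d b a m H for T d b a m H +
  fixes x K :: real
  assumes x_range: "x \<in> {0..1}" and K_nonneg: "0 \<le> K"
    and visits_le: "u \<in> \<rat> \<Longrightarrow> v \<in> \<rat> \<Longrightarrow> u < v \<Longrightarrow>
      eventually (\<lambda>n. (\<Sum>j<n. trapezoid u v ((f ^^ Suc j) x)) \<le> K * (v - u) * n) sequentially"
begin

abbreviation clamp :: "real \<Rightarrow> real" where "clamp z \<equiv> max 0 (min 1 z)"

text \<open>Clamping extends the map to the line, where weak convergence of real distributions
  applies; orbits only see the values on the unit interval.\<close>

definition F :: "real \<Rightarrow> real" where "F z = f (clamp z)"

lemma F_eq: "z \<in> {0..1} \<Longrightarrow> F z = f z" by (simp add: F_def)

lemma F_measurable [measurable]: "F \<in> borel_measurable borel"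
proof -
  have "F = (\<lambda>z. T (max 0 (a * clamp z)))" using a_pos by (auto simp: F_def f_def max_def)
  moreover have "(\<lambda>z. T (max 0 (a * clamp z))) \<in> borel_measurable borel"
    by (rule measurable_compose[OF _ T_borel]) measurable
  ultimately show ?thesis by simp
qed

lemma F_isCont:
  assumes "z \<notin> insert 0 (insert 1 (range (\<lambda>k. b k / a)))"
  shows "isCont F z"
proof -
  consider "z < 0" | "1 < z" | "0 < z" "z < 1" using assms by force
  then show ?thesis
  proof cases
    case 1
    have "isCont (\<lambda>_. f 0) z" by simp
    moreover have "eventually (\<lambda>z. F z = f 0) (nhds z)"
      using eventually_nhds_in_open[of "{..<0}" z] 1 by (auto elim!: eventually_mono simp: F_def)
    ultimately show ?thesis by (subst isCont_cong) auto
  next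
    case 2
    have "isCont (\<lambda>_. f 1) z" by simp
    moreover have "eventually (\<lambda>z. F z = f 1) (nhds z)"
      using eventually_nhds_in_open[of "{1<..}" z] 2 by (auto elim!: eventually_mono simp: F_def)
    ultimately show ?thesis by (subst isCont_cong) auto
  next
    case 3
    let ?k = "branch (a * z)"
    have ne: "a * z \<noteq> b ?k"
    proof
      assume "a * z = b ?k"
      then have "z = b ?k / a" using a_pos by (simp add: field_simps)
      then show False using assms by blast
    qed
    then have k: "b ?k < a * z" "a * z < b (Suc ?k)"
      using b_branch_le[of "a * z"] less_b_Suc_branch[of "a * z"] 3 a_pos by auto
    have "continuous_on {b ?k<..<b (Suc ?k)} T" by (rule continuous_on_subset[OF T_cont[of ?k]]) auto
    then have "isCont T (a * z)" using k by (auto simp: continuous_on_eq_continuous_at)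
    then have "isCont (\<lambda>z. T (a * z)) z" by (intro isCont_o2[where f = "\<lambda>z. a * z" and g = T]) auto
    moreover have "eventually (\<lambda>z. F z = T (a * z)) (nhds z)"
      using eventually_nhds_in_open[of "{0<..<1}" z] 3 by (auto elim!: eventually_mono simp: F_def f_def)
    ultimately show ?thesis by (subst isCont_cong) auto
  qed
qed

text \<open>Shifted by one index so that every \<open>emp n\<close> is a probability measure, and
  defined on the Borel sets of the line.\<close>

definition emp :: "nat \<Rightarrow> real measure" where
  "emp n = distr (uniform_count_measure {..<Suc n}) borel (\<lambda>i. (f ^^ i) x)"

lemma orbit_range: "(f ^^ i) x \<in> {0..1}" using funpow_f_range x_range by blast

lemma emp_measurable: "(\<lambda>i. (f ^^ i) x) \<in> borel_measurable (uniform_count_measure {..<Suc n})"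
  by (simp add: measurable_def space_uniform_count_measure sets_uniform_count_measure)

lemma integral_emp:
  fixes \<psi> :: "real \<Rightarrow> real"
  assumes "\<psi> \<in> borel_measurable borel"
  shows "integral\<^sup>L (emp n) \<psi> = (\<Sum>i<Suc n. \<psi> ((f ^^ i) x)) / real (Suc n)"
  unfolding emp_def by (subst integral_distr[OF emp_measurable assms]) (subst integral_uniform_count_measure, auto)

lemma emp_real_distribution: "real_distribution (emp n)"
proof -
  interpret U: prob_space "uniform_count_measure {..<Suc n}"
    by (rule prob_space_uniform_count_measure) auto
  have "prob_space (emp n)" unfolding emp_def by (rule U.prob_space_distr[OF emp_measurable])
  then show ?thesis by (auto simp: real_distribution_def real_distribution_axioms_def emp_def)
qed

lemma emp_tight: "tight emp"
  unfolding tight_def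
proof (intro conjI allI impI emp_real_distribution)
  fix \<epsilon> :: real assume "0 < \<epsilon>"
  have "measure (emp n) {-1<..1} = 1" for n
  proof -
    interpret E: real_distribution "emp n" by (rule emp_real_distribution)
    have "measure (emp n) {-1<..1} = integral\<^sup>L (emp n) (indicator {-1<..1})" by simp
    also have "\<dots> = 1"
    proof -
      have "indicator {-1<..1} ((f ^^ i) x) = (1::real)" for i
        using orbit_range[of i] by (auto simp: indicator_def)
      then show ?thesis by (subst integral_emp) auto
    qed
    finally show ?thesis .
  qed
  then show "\<exists>a b::real. a < b \<and> (\<forall>n. 1 - \<epsilon> < measure (emp n) {a<..b})"
    using \<open>0 < \<epsilon>\<close> by (intro exI[of _ "-1"] exI[of _ 1]) auto
qed

end

section \<open>Subsequential weak limits of the empirical measures\<close>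

locale empirical_limit = regular_orbit T d b a m H x K for T d b a m H x K +
  fixes s :: "nat \<Rightarrow> nat" and \<nu> :: "real measure"
  assumes s_mono: "strict_mono s" and \<nu>_rd: "real_distribution \<nu>"
    and conv: "weak_conv_m (emp \<circ> s) \<nu>"
begin

interpretation N: real_distribution \<nu> by (rule \<nu>_rd)

lemma integral_tendsto:
  fixes \<psi> :: "real \<Rightarrow> real"
  assumes "emeasure \<nu> {z. \<not> isCont \<psi> z} = 0" "\<And>z. \<bar>\<psi> z\<bar> \<le> B" "\<psi> \<in> borel_measurable borel"
  shows "(\<lambda>n. integral\<^sup>L (emp (s n)) \<psi>) \<longlonglongrightarrow> integral\<^sup>L \<nu> \<psi>"
  using weak_conv_imp_bdd_ae_continuous_conv[OF _ \<nu>_rd conv, of \<psi> B] emp_real_distribution assms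
  by (simp add: comp_def)

lemma \<nu>_support: "measure \<nu> {0..1} = 1"
proof -
  \<comment> \<open>The distance to the unit interval, capped at 1; its integral against every
    \<open>emp n\<close> is 0.\<close>
  define \<psi> :: "real \<Rightarrow> real" where "\<psi> z = min 1 (max 0 (max (- z) (z - 1)))" for z
  have cont: "isCont \<psi> z" for z unfolding \<psi>_def[abs_def] by (intro continuous_intros)
  have meas: "\<psi> \<in> borel_measurable borel" unfolding \<psi>_def[abs_def] by measurable
  have bd: "\<bar>\<psi> z\<bar> \<le> 1" for z by (auto simp: \<psi>_def)
  have "\<psi> ((f ^^ i) x) = 0" for i using orbit_range[of i] by (auto simp: \<psi>_def)
  then have "integral\<^sup>L (emp (s n)) \<psi> = 0" for n by (simp add: integral_emp[OF meas])
  then have int: "integral\<^sup>L \<nu> \<psi> = 0"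
    using integral_tendsto[of \<psi> 1] cont bd meas LIMSEQ_unique[OF _ tendsto_const] by fastforce
  have "integrable \<nu> \<psi>" using meas bd by (intro N.integrable_const_bound[where B = 1]) auto
  then have "AE z in \<nu>. \<psi> z = 0"
    using integral_nonneg_eq_0_iff_AE[of \<nu> \<psi>] int by (auto simp: \<psi>_def)
  then have "AE z in \<nu>. z \<in> {0..1}" by eventually_elim (auto simp: \<psi>_def min_def max_def split: if_splits)
  then show ?thesis by (subst N.prob_eq_1) auto
qed

lemma \<nu>_outside: "emeasure \<nu> (B - {0..1}) = 0" if "B \<in> sets borel"
proof -
  have "measure \<nu> (UNIV - {0..1}) = 0" using N.prob_compl[of "{0..1}"] \<nu>_support by simp
  then have "emeasure \<nu> (UNIV - {0..1}) = 0" by (simp add: N.emeasure_eq_measure)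
  moreover have "emeasure \<nu> (B - {0..1}) \<le> emeasure \<nu> (UNIV - {0..1})" by (rule emeasure_mono) auto
  ultimately show ?thesis by simp
qed

text \<open>The visit bound starts with the first iterate; the starting point adds at most
  \<open>1 / Suc (s n)\<close> to the average, which vanishes in the limit.\<close>

lemma \<nu>_rat_interval:
  assumes "u \<in> \<rat>" "v \<in> \<rat>" "u < v"
  shows "measure \<nu> {u..v} \<le> K * (v - u)"
proof -
  have "measure \<nu> {u..v} = integral\<^sup>L \<nu> (indicator {u..v})" by simp
  also have "\<dots> \<le> integral\<^sup>L \<nu> (trapezoid u v)"
  proof (rule integral_mono)
    show "integrable \<nu> (trapezoid u v)" using trapezoid_range
      by (intro N.integrable_const_bound[where B = 1]) auto
    show "indicator {u..v} z \<le> trapezoid u v z" for z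
      using trapezoid_eq_1[OF assms(3), of z] trapezoid_range(1)[of u v z] by (auto simp: indicator_def)
  qed (auto simp: less_top[symmetric])
  also have "\<dots> \<le> K * (v - u)"
  proof (rule LIMSEQ_le)
    show "(\<lambda>n. integral\<^sup>L (emp (s n)) (trapezoid u v)) \<longlonglongrightarrow> integral\<^sup>L \<nu> (trapezoid u v)"
      using trapezoid_continuous trapezoid_range by (intro integral_tendsto[where B = 1]) auto
    have "(\<lambda>n. 1 / real (Suc n)) \<longlonglongrightarrow> 0" by (rule LIMSEQ_Suc[OF lim_1_over_n])
    then have "((\<lambda>n. 1 / real (Suc n)) \<circ> s) \<longlonglongrightarrow> 0" using s_mono by (rule LIMSEQ_subseq_LIMSEQ)
    from tendsto_add[OF this tendsto_const[of "K * (v - u)"]]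
    show "(\<lambda>n. 1 / real (Suc (s n)) + K * (v - u)) \<longlonglongrightarrow> K * (v - u)"
      by (simp only: comp_def add_0)
    have "\<forall>\<^sub>F n in sequentially. (\<Sum>j<s n. trapezoid u v ((f ^^ Suc j) x)) \<le> K * (v - u) * real (s n)"
      using eventually_subseq[OF s_mono visits_le[OF assms]] .
    then have "\<forall>\<^sub>F n in sequentially. integral\<^sup>L (emp (s n)) (trapezoid u v) \<le> 1 / real (Suc (s n)) + K * (v - u)"
    proof (rule eventually_mono)
      fix n assume le: "(\<Sum>j<s n. trapezoid u v ((f ^^ Suc j) x)) \<le> K * (v - u) * real (s n)"
      have "(\<Sum>i<Suc (s n). trapezoid u v ((f ^^ i) x)) = trapezoid u v x + (\<Sum>j<s n. trapezoid u v ((f ^^ Suc j) x))"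
        by (subst sum.lessThan_Suc_shift) simp
      also have "\<dots> \<le> 1 + K * (v - u) * real (Suc (s n))"
        using le trapezoid_range(2)[of u v x] K_nonneg assms(3)
          mult_left_mono[of "real (s n)" "real (Suc (s n))" "K * (v - u)"] by auto
      finally have "(\<Sum>i<Suc (s n). trapezoid u v ((f ^^ i) x)) / real (Suc (s n))
          \<le> (1 + K * (v - u) * real (Suc (s n))) / real (Suc (s n))"
        by (intro divide_right_mono) auto
      then show "integral\<^sup>L (emp (s n)) (trapezoid u v) \<le> 1 / real (Suc (s n)) + K * (v - u)"
        by (simp add: integral_emp[OF trapezoid_measurable] add_divide_distrib del: of_nat_Suc)
    qed
    then show "\<exists>N. \<forall>n\<ge>N. integral\<^sup>L (emp (s n)) (trapezoid u v) \<le> 1 / real (Suc (s n)) + K * (v - u)"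
      by (simp add: eventually_sequentially)
  qed
  finally show ?thesis .
qed

lemma \<nu>_interval:
  assumes "u < v" shows "measure \<nu> {u..<v} \<le> 2 * K * (v - u)"
proof -
  let ?h = "(v - u) / 2"
  obtain u' where u': "u' \<in> \<rat>" "u - ?h < u'" "u' < u" using Rats_dense_in_real[of "u - ?h" u] assms by auto
  obtain v' where v': "v' \<in> \<rat>" "v < v'" "v' < v + ?h" using Rats_dense_in_real[of v "v + ?h"] assms by auto
  have "measure \<nu> {u..<v} \<le> measure \<nu> {u'..v'}" using u' v' by (intro N.finite_measure_mono) auto
  also have "\<dots> \<le> K * (v' - u')" using u' v' assms by (intro \<nu>_rat_interval) auto
  also have "\<dots> \<le> K * (2 * (v - u))" using u' v' K_nonneg by (intro mult_left_mono) (auto simp: field_simps)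
  finally show ?thesis by (simp add: algebra_simps)
qed

text \<open>The bound \<open>2 * K\<close> on the measure of intervals per unit length extends to
  Borel sets. The comparison measure lives on \<open>{0..<2}\<close> so that half-open intervals
  inside its support can cover the point 1.\<close>

lemma \<nu>_null:
  assumes "B \<in> sets borel" "emeasure lborel B = 0"
  shows "emeasure \<nu> B = 0"
proof -
  define L where "L = density lborel (\<lambda>z. ennreal (2 * K) * indicator {0..<2::real} z)"
  have L: "emeasure L B = ennreal (2 * K) * emeasure lborel (B \<inter> {0..<2})" if "B \<in> sets borel" for B
    unfolding L_def using that by (simp add: emeasure_density mult.assoc indicator_inter_arith[symmetric]
        nn_integral_cmult_indicator Int_commute mult.commute[of "indicator {0..<2} _"])
  have "emeasure \<nu> B \<le> emeasure L B"
  proof (rule emeasure_le_of_intervals[OF _ _ _ _ _ assms(1)])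
    show "finite_measure \<nu>" by unfold_locales
    show "finite_measure L"
      by (rule finite_measureI) (use L[of UNIV] in \<open>auto simp: L_def ennreal_mult_eq_top_iff\<close>)
    show "sets \<nu> = sets borel" "sets L = sets borel" by (simp_all add: L_def)
    fix u v :: real assume "u < v"
    let ?u = "max u 0" and ?v = "min v 2"
    have "emeasure \<nu> {u..<v} \<le> emeasure \<nu> ({?u..<?v} \<union> ({u..<v} - {0..1}))"
      by (intro emeasure_mono) auto
    also have "\<dots> \<le> emeasure \<nu> {?u..<?v} + emeasure \<nu> ({u..<v} - {0..1})"
      by (intro emeasure_subadditive) auto
    also have "\<dots> = emeasure \<nu> {?u..<?v}" by (simp add: \<nu>_outside)
    also have "\<dots> \<le> emeasure L {u..<v}"
    proof (cases "?u < ?v")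
      case True
      have i: "{u..<v} \<inter> {0..<2} = {?u..<?v}" by auto
      have "emeasure L {u..<v} = ennreal (2 * K * (?v - ?u))"
        using L[of "{u..<v}"] True K_nonneg unfolding i by (simp add: ennreal_mult)
      moreover have "emeasure \<nu> {?u..<?v} \<le> ennreal (2 * K * (?v - ?u))"
        unfolding N.emeasure_eq_measure by (intro ennreal_leI \<nu>_interval True)
      ultimately show ?thesis by simp
    next
      case False
      then have "{?u..<?v} = {}" by auto
      then show ?thesis by (simp only: emeasure_empty zero_le)
    qed
    finally show "emeasure \<nu> {u..<v} \<le> emeasure L {u..<v}" .
  qed
  also have "emeasure L B = 0"
  proof -
    have "emeasure lborel (B \<inter> {0..<2}) \<le> emeasure lborel B" using assms by (intro emeasure_mono) auto
    then show ?thesis using assms by (simp add: L)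
  qed
  finally show ?thesis by simp
qed

text \<open>Discontinuities of \<open>F\<close> lie in a countable set, null for
  \<open>\<nu>\<close> by absolute continuity; this justifies weak limits with the discontinuous
  integrand \<open>\<psi> (F z)\<close>.\<close>

lemma F_discont_null:
  assumes "\<And>z. isCont \<psi> z"
  shows "emeasure \<nu> {z. \<not> isCont (\<lambda>z. \<psi> (F z)) z} = 0"
proof -
  let ?D = "insert 0 (insert 1 (range (\<lambda>k. b k / a)))"
  have c: "countable ?D" by simp
  then have "?D \<in> sets borel" by (rule sets.countable[rotated]) auto
  moreover have "emeasure lborel ?D = 0" using c by (rule emeasure_lborel_countable)
  ultimately have D: "?D \<in> sets borel" "emeasure \<nu> ?D = 0" using \<nu>_null by auto
  have "{z. \<not> isCont (\<lambda>z. \<psi> (F z)) z} \<subseteq> ?D"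
  proof (rule subsetI, rule ccontr)
    fix z assume "z \<in> {z. \<not> isCont (\<lambda>z. \<psi> (F z)) z}" "z \<notin> ?D"
    then show False using isCont_o2[OF F_isCont[of z] assms] by auto
  qed
  then have "emeasure \<nu> {z. \<not> isCont (\<lambda>z. \<psi> (F z)) z} \<le> emeasure \<nu> ?D" using D by (intro emeasure_mono) auto
  then show ?thesis using D by simp
qed

lemma \<nu>_invariant: "distr \<nu> borel F = \<nu>"
proof (rule real_distribution_eqI)
  show "real_distribution (distr \<nu> borel F)" by (rule N.real_distribution_distr) simp
  show "real_distribution \<nu>" by (rule \<nu>_rd)
  fix \<psi> :: "real \<Rightarrow> real" assume \<psi>: "\<And>z. isCont \<psi> z" "\<And>z. \<bar>\<psi> z\<bar> \<le> 1"
  have meas [measurable]: "\<psi> \<in> borel_measurable borel"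
    using \<psi> by (intro borel_measurable_continuous_onI continuous_at_imp_continuous_on) auto
  have 1: "(\<lambda>n. integral\<^sup>L (emp (s n)) \<psi>) \<longlonglongrightarrow> integral\<^sup>L \<nu> \<psi>"
    using \<psi> by (intro integral_tendsto[where B = 1]) auto
  have 2: "(\<lambda>n. integral\<^sup>L (emp (s n)) (\<lambda>z. \<psi> (F z))) \<longlonglongrightarrow> integral\<^sup>L \<nu> (\<lambda>z. \<psi> (F z))"
    using \<psi> by (intro integral_tendsto[where B = 1] F_discont_null) auto
  \<comment> \<open>Shifting the orbit by one step changes the sum only by two boundary
    terms.\<close>
  have diff: "\<bar>integral\<^sup>L (emp N) (\<lambda>z. \<psi> (F z)) - integral\<^sup>L (emp N) \<psi>\<bar> \<le> 2 / real (Suc N)" for N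
  proof -
    have "(\<Sum>i<Suc N. \<psi> (F ((f ^^ i) x))) - (\<Sum>i<Suc N. \<psi> ((f ^^ i) x))
        = (\<Sum>i<Suc N. \<psi> ((f ^^ Suc i) x) - \<psi> ((f ^^ i) x))"
      using F_eq[OF orbit_range] by (simp add: sum_subtractf)
    also have "\<dots> = \<psi> ((f ^^ Suc N) x) - \<psi> x"
      by (subst sum_lessThan_telescope) simp
    finally have "(\<Sum>i<Suc N. \<psi> (F ((f ^^ i) x))) - (\<Sum>i<Suc N. \<psi> ((f ^^ i) x)) = \<psi> ((f ^^ Suc N) x) - \<psi> x" .
    moreover have "\<bar>\<psi> ((f ^^ Suc N) x) - \<psi> x\<bar> \<le> 2"
      using \<psi>(2)[of "(f ^^ Suc N) x"] \<psi>(2)[of x] by linarith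
    ultimately have "\<bar>(\<Sum>i<Suc N. \<psi> (F ((f ^^ i) x))) - (\<Sum>i<Suc N. \<psi> ((f ^^ i) x))\<bar> / real (Suc N) \<le> 2 / real (Suc N)"
      by (intro divide_right_mono) auto
    then show ?thesis
      by (simp add: integral_emp abs_divide diff_divide_distrib[symmetric] del: of_nat_Suc sum.lessThan_Suc)
  qed
  have "(\<lambda>n. 1 / real (Suc n)) \<longlonglongrightarrow> 0" by (rule LIMSEQ_Suc[OF lim_1_over_n])
  then have "((\<lambda>n. 1 / real (Suc n)) \<circ> s) \<longlonglongrightarrow> 0" using s_mono by (rule LIMSEQ_subseq_LIMSEQ)
  then have "(\<lambda>n. 2 * (1 / real (Suc (s n)))) \<longlonglongrightarrow> 2 * 0" by (intro tendsto_mult tendsto_const) (simp add: comp_def)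
  then have lim: "(\<lambda>n. 2 / real (Suc (s n))) \<longlonglongrightarrow> 0" by (simp only: times_divide_eq_right mult_1_right mult_zero_right)
  have "(\<lambda>n. integral\<^sup>L (emp (s n)) (\<lambda>z. \<psi> (F z)) - integral\<^sup>L (emp (s n)) \<psi>) \<longlonglongrightarrow> 0"
    by (rule Lim_null_comparison[OF always_eventually lim]) (simp only: real_norm_def diff simp_thms)
  moreover have "(\<lambda>n. integral\<^sup>L (emp (s n)) (\<lambda>z. \<psi> (F z)) - integral\<^sup>L (emp (s n)) \<psi>)
      \<longlonglongrightarrow> integral\<^sup>L \<nu> (\<lambda>z. \<psi> (F z)) - integral\<^sup>L \<nu> \<psi>"
    by (intro tendsto_diff 1 2)
  ultimately have "integral\<^sup>L \<nu> (\<lambda>z. \<psi> (F z)) - integral\<^sup>L \<nu> \<psi> = 0" by (rule LIMSEQ_unique[rotated])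
  then show "integral\<^sup>L (distr \<nu> borel F) \<psi> = integral\<^sup>L \<nu> \<psi>"
    by (subst integral_distr) auto
qed

lemma emeasure_restrict: "emeasure \<nu> (B \<inter> {0..1}) = emeasure \<nu> B" if "B \<in> sets borel"
proof -
  have "emeasure \<nu> B = emeasure \<nu> (B \<inter> {0..1}) + emeasure \<nu> (B - {0..1})"
    using that by (subst plus_emeasure) (auto simp: Int_Diff_Un)
  then show ?thesis using \<nu>_outside[OF that] by simp
qed

lemma is_acip_restrict: "is_acip f (restrict_space \<nu> {0..1})"
proof -
  let ?\<mu> = "restrict_space \<nu> {0..1}"
  have sets: "sets ?\<mu> = sets (restrict_space borel {0..1})" by (rule sets_restrict_space_cong) simp
  have em: "emeasure ?\<mu> B = emeasure \<nu> B" if "B \<subseteq> {0..1}" for B using that by (intro emeasure_restrict_space) auto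
  have sp: "space ?\<mu> = {0..1}" by (simp add: space_restrict_space)
  have prob: "prob_space ?\<mu>"
    by (rule prob_spaceI) (simp add: sp em N.emeasure_eq_measure \<nu>_support)
  have fm: "f \<in> measurable ?\<mu> ?\<mu>" using f_measurable measurable_cong_sets[OF sets sets] by simp
  have ac: "absolutely_continuous (restrict_space lborel {0..1}) ?\<mu>"
    unfolding absolutely_continuous_def
  proof
    fix B :: "real set" assume "B \<in> null_sets (restrict_space lborel {0..1})"
    then have B: "B \<in> sets (restrict_space lborel {0..1})" "emeasure (restrict_space lborel {0..1}) B = 0" by auto
    have B': "B \<in> sets borel" "B \<subseteq> {0..1}" using B(1) by (simp_all add: sets_restrict_space_iff)
    have "emeasure lborel B = 0" using B(2) B' by (simp add: emeasure_restrict_space)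
    then show "B \<in> null_sets ?\<mu>" using \<nu>_null[OF B'(1)] em[OF B'(2)] B' by (simp add: null_sets_def sets_restrict_space_iff)
  qed
  have "distr ?\<mu> ?\<mu> f = ?\<mu>"
  proof (rule measure_eqI)
    fix B assume "B \<in> sets (distr ?\<mu> ?\<mu> f)"
    then have B: "B \<in> sets ?\<mu>" by simp
    then have B': "B \<in> sets borel" "B \<subseteq> {0..1}" by (simp_all add: sets_restrict_space_iff)
    have "emeasure (distr ?\<mu> ?\<mu> f) B = emeasure ?\<mu> (f -` B \<inter> {0..1})" using fm B by (simp add: emeasure_distr sp)
    also have "\<dots> = emeasure \<nu> (f -` B \<inter> {0..1})" by (rule em) auto
    also have "f -` B \<inter> {0..1} = (F -` B) \<inter> {0..1}" using F_eq by auto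
    also have "emeasure \<nu> ((F -` B) \<inter> {0..1}) = emeasure \<nu> (F -` B)"
      using measurable_sets[OF F_measurable B'(1)] by (intro emeasure_restrict) simp
    also have "\<dots> = emeasure (distr \<nu> borel F) B" using B' by (simp add: emeasure_distr)
    also have "\<dots> = emeasure ?\<mu> B" using em[OF B'(2)] by (simp add: \<nu>_invariant)
    finally show "emeasure (distr ?\<mu> ?\<mu> f) B = emeasure ?\<mu> B" .
  qed simp
  then show ?thesis using prob sets ac fm by (simp add: is_acip_def)
qed

end

section \<open>Uniqueness of limits and convergence of the whole sequence\<close>

context regular_orbit
begin

theorem typical: "typical f (acip f) x"
proof -
  obtain r \<nu> where r: "strict_mono r" "real_distribution \<nu>" "weak_conv_m (emp \<circ> id \<circ> r) \<nu>"
    using tight_imp_convergent_subsubsequence[OF emp_tight strict_mono_id] by blast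
  have r3: "weak_conv_m (emp \<circ> r) \<nu>" using r(3) by (simp only: comp_id)
  interpret E: empirical_limit T d b a m H x K r \<nu>
    by (rule empirical_limit.intro[OF regular_orbit_axioms empirical_limit_axioms.intro[OF r(1,2) r3]])
  interpret N: real_distribution \<nu> by (rule r)
  \<comment> \<open>A subsequential limit supplies existence and \<open>acip_unique\<close> supplies
    uniqueness, so the definite description is determined.\<close>
  have acip: "acip f = restrict_space \<nu> {0..1}"
    unfolding acip_def
    by (rule the_equality, rule E.is_acip_restrict, erule acip_unique[OF _ E.is_acip_restrict])
  \<comment> \<open>By tightness it suffices that all subsequential limits agree; each restricts to
    an absolutely continuous invariant measure, and there is only one.\<close>
  have "weak_conv_m emp \<nu>"
  proof (rule tight_subseq_weak_converge[OF emp_real_distribution r(2) emp_tight])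
    fix s \<nu>' assume s: "strict_mono s" "real_distribution \<nu>'" "weak_conv_m (emp \<circ> s) \<nu>'"
    interpret E': empirical_limit T d b a m H x K s \<nu>'
      by (rule empirical_limit.intro[OF regular_orbit_axioms empirical_limit_axioms.intro[OF s]])
    interpret N': real_distribution \<nu>' by (rule s)
    have eq: "restrict_space \<nu>' {0..1} = restrict_space \<nu> {0..1}"
      using acip_unique[OF E'.is_acip_restrict E.is_acip_restrict] .
    have "\<nu>' = \<nu>"
    proof (rule measure_eqI)
      fix B assume "B \<in> sets \<nu>'"
      then have B: "B \<in> sets borel" by simp
      have "emeasure \<nu>' (B \<inter> {0..1}) = emeasure (restrict_space \<nu>' {0..1}) (B \<inter> {0..1})"
        by (rule emeasure_restrict_space[symmetric]) auto
      also have "\<dots> = emeasure \<nu> (B \<inter> {0..1})" unfolding eq by (rule emeasure_restrict_space) auto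
      finally show "emeasure \<nu>' B = emeasure \<nu> B" using E.emeasure_restrict[OF B] E'.emeasure_restrict[OF B] by simp
    qed simp
    then show "weak_conv_m (emp \<circ> s) \<nu>" using s by simp
  qed
  note conv = this
  show ?thesis unfolding typical_def weak_star_conv_def
  proof (intro allI impI)
    fix \<phi> :: "real \<Rightarrow> real" assume \<phi>: "continuous_on {0..1} \<phi>"
    define \<psi> where "\<psi> z = \<phi> (clamp z)" for z
    have cont: "isCont \<psi> z" for z
    proof -
      have "continuous_on UNIV \<psi>" unfolding \<psi>_def
        by (rule continuous_on_compose2[OF \<phi>]) (auto intro!: continuous_intros)
      then show ?thesis by (simp add: continuous_on_eq_continuous_at)
    qed
    obtain B where "\<forall>z\<in>\<phi> ` {0..1}. \<bar>z\<bar> \<le> B"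
      using compact_imp_bounded[OF compact_continuous_image[OF \<phi> compact_Icc]] unfolding bounded_real by blast
    then have B: "\<bar>\<phi> z\<bar> \<le> B" if "z \<in> {0..1}" for z using that by blast
    have bd: "\<bar>\<psi> z\<bar> \<le> B" for z unfolding \<psi>_def by (rule B) auto
    have meas: "\<psi> \<in> borel_measurable borel"
      using cont by (intro borel_measurable_continuous_onI continuous_at_imp_continuous_on) auto
    have "(\<lambda>n. integral\<^sup>L (emp n) \<psi>) \<longlonglongrightarrow> integral\<^sup>L \<nu> \<psi>"
      using weak_conv_imp_integral_bdd_continuous_conv[OF emp_real_distribution r(2) conv, of \<psi> B] cont bd by auto
    also have "integral\<^sup>L \<nu> \<psi> = integral\<^sup>L (restrict_space \<nu> {0..1}) \<phi>"
    proof -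
      have "integral\<^sup>L (restrict_space \<nu> {0..1}) \<phi> = integral\<^sup>L (restrict_space \<nu> {0..1}) \<psi>"
        by (intro Bochner_Integration.integral_cong) (auto simp: \<psi>_def space_restrict_space)
      also have "\<dots> = (LINT z|\<nu>. indicator {0..1} z *\<^sub>R \<psi> z)"
        by (rule integral_restrict_space) auto
      also have "\<dots> = integral\<^sup>L \<nu> \<psi>"
      proof (rule integral_cong_AE)
        have "AE z in \<nu>. z \<in> {0..1}" using E.\<nu>_support by (subst (asm) N.prob_eq_1) auto
        then show "AE z in \<nu>. indicator {0..1} z *\<^sub>R \<psi> z = \<psi> z" by eventually_elim auto
      qed (use meas in auto)
      finally show ?thesis by simp
    qed
    finally have lim: "(\<lambda>n. integral\<^sup>L (emp n) \<psi>) \<longlonglongrightarrow> integral\<^sup>L (acip f) \<phi>" by (simp add: acip)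
    have eq: "integral\<^sup>L (emp n) \<psi> = integral\<^sup>L (empirical_measure f x (Suc n)) \<phi>" for n
    proof -
      have \<phi>m: "\<phi> \<in> borel_measurable (restrict_space borel {0..1})"
        by (rule borel_measurable_continuous_on_restrict[OF \<phi>])
      have "\<psi> ((f ^^ i) x) = \<phi> ((f ^^ i) x)" for i using orbit_range[of i] by (simp add: \<psi>_def)
      then show ?thesis
        unfolding integral_emp[OF meas]
        using integral_empirical_measure[OF _ x_range \<phi>m, of f "Suc n"] f_range by (auto simp: image_subset_iff)
    qed
    show "(\<lambda>n. integral\<^sup>L (empirical_measure f x n) \<phi>) \<longlonglongrightarrow> integral\<^sup>L (acip f) \<phi>"
      using lim unfolding eq by (rule LIMSEQ_imp_Suc)
  qed
qed

end

section \<open>Typicality along the parameter curve\<close>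

lemma right_deriv_eqI:
  assumes "(f has_real_derivative D) (at_right x)"
  shows "right_deriv f x = D"
  unfolding right_deriv_def
proof (rule the_equality, rule assms)
  fix D' assume "(f has_real_derivative D') (at_right x)"
  then show "D' = D" using assms
    unfolding has_field_derivative_iff by (rule tendsto_unique[OF trivial_limit_at_right_real])
qed

lemma right_deriv_scale:
  fixes f :: "real \<Rightarrow> real"
  assumes "0 < a" "(f has_real_derivative D) (at_right (a * x))"
  shows "right_deriv (\<lambda>x. f (a * x)) x = a * D"
proof (rule right_deriv_eqI)
  have "(*) a ` {x<..} \<subseteq> {a * x<..}" using assms by auto
  then have "(f has_real_derivative D) (at (a * x) within (*) a ` {x<..})"
    by (rule has_field_derivative_subset[OF assms(2)])
  moreover have "((*) a has_real_derivative a) (at x within {x<..})"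
    by (auto intro!: derivative_eq_intros)
  ultimately have "(f \<circ> (*) a has_real_derivative D * a) (at x within {x<..})"
    by (rule DERIV_image_chain)
  then show "((\<lambda>x. f (a * x)) has_real_derivative a * D) (at_right x)"
    by (simp add: comp_def mult.commute)
qed

section \<open>Distortion of piecewise C^{1,1} maps\<close>

locale piecewise_C11 = branch_points b for b :: "nat \<Rightarrow> real" +
  fixes T :: "real \<Rightarrow> real" and L :: real
  assumes L_pos: "0 < L"
    and range: "\<And>y. 0 \<le> y \<Longrightarrow> T y \<in> {0..1}"
    and C11: "\<And>k. C11_on L T {b k..<b (Suc k)}"
    and zero: "\<And>k. T (b k) = 0"
begin

abbreviation "d \<equiv> right_deriv T"

text \<open>On a half-open branch the derivative within the branch is also the right derivative at
  each point, which identifies the function supplied by \<open>C11_on\<close> with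
  \<open>right_deriv\<close>.\<close>

lemma
  assumes "x \<in> {b k..<b (Suc k)}"
  shows deriv_within: "(T has_real_derivative d x) (at x within {b k..<b (Suc k)})"
    and deriv_right: "(T has_real_derivative d x) (at_right x)"
    and d_lipschitz: "z \<in> {b k..<b (Suc k)} \<Longrightarrow> \<bar>d x - d z\<bar> \<le> L * \<bar>x - z\<bar>"
proof -
  obtain f' where f': "\<And>x. x \<in> {b k..<b (Suc k)} \<Longrightarrow> (T has_real_derivative f' x) (at x within {b k..<b (Suc k)})"
    "L-lipschitz_on {b k..<b (Suc k)} f'"
    using C11[of k] unfolding C11_on_def by blast
  have right: "(T has_real_derivative f' x) (at_right x)" if x: "x \<in> {b k..<b (Suc k)}" for x
  proof -
    obtain c where c: "x < c" "c < b (Suc k)" using dense[of x "b (Suc k)"] x by auto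
    have "(T has_real_derivative f' x) (at x within {x..c})"
      by (rule has_field_derivative_subset[OF f'(1)[OF x]]) (use c x in auto)
    then show ?thesis using at_within_Icc_at_right[OF c(1)] by simp
  qed
  then have eq: "d x = f' x" if "x \<in> {b k..<b (Suc k)}" for x using that by (intro right_deriv_eqI)
  show "(T has_real_derivative d x) (at x within {b k..<b (Suc k)})" "(T has_real_derivative d x) (at_right x)"
    using f'(1)[OF assms] right[OF assms] eq[OF assms] by simp_all
  show "\<bar>d x - d z\<bar> \<le> L * \<bar>x - z\<bar>" if z: "z \<in> {b k..<b (Suc k)}"
    using lipschitz_onD[OF f'(2) assms z] eq[OF assms] eq[OF z] by (simp add: dist_real_def)
qed

lemma in_branch: "0 \<le> y \<Longrightarrow> y \<in> {b (branch y)..<b (Suc (branch y))}"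
  using b_branch_le less_b_Suc_branch by auto

lemma right_deriv_scaled: "0 < a \<Longrightarrow> 0 \<le> x \<Longrightarrow> right_deriv (\<lambda>x. T (a * x)) x = a * d (a * x)"
  by (rule right_deriv_scale[OF _ deriv_right[OF in_branch]]) auto

lemma mean_value:
  assumes "b k \<le> x" "x < y" "y < b (Suc k)"
  obtains \<xi> where "x < \<xi>" "\<xi> < y" "T y - T x = d \<xi> * (y - x)"
proof -
  have "\<exists>\<xi>\<in>{x<..<y}. T y - T x = d \<xi> * (y - x)"
  proof (rule mvt_simple[OF assms(2)])
    fix z assume "x \<le> z" "z \<le> y"
    then have z: "z \<in> {b k..<b (Suc k)}" using assms by auto
    have "(T has_real_derivative d z) (at z within {x..y})"
      by (rule has_field_derivative_subset[OF deriv_within[OF z]]) (use assms in auto)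
    then show "(T has_derivative (*) (d z)) (at z within {x..y})" by (simp add: has_field_derivative_def)
  qed
  then show ?thesis using that by auto
qed

text \<open>A derivative that is \<open>L\<close>-Lipschitz and at least \<open>m\<close> has
  relative variation at most \<open>L / m\<close> per unit length, which
  \<open>1 + z \<le> exp z\<close> puts into exponential form. The estimates for \<open>T\<close>
  follow by the mean value theorem.\<close>

lemma expanding_branchesI:
  assumes m: "0 < m" and ge: "\<And>y. 0 \<le> y \<Longrightarrow> y \<le> R \<Longrightarrow> m \<le> d y"
  shows "expanding_branches T d b R m (L / m)"
proof -
  let ?H = "L / m"
  have H: "0 \<le> ?H" using L_pos m by simp
  have ratio: "d x \<le> d y * exp (?H * \<bar>x - y\<bar>)"
    if "x \<in> {b k..<b (Suc k)}" "y \<in> {b k..<b (Suc k)}" "y \<le> R" for x y k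
  proof -
    have y: "m \<le> d y" using ge[of y] that b_nonneg[of k] by auto
    have "d x \<le> d y + L * \<bar>x - y\<bar>" using d_lipschitz[OF that(1,2)] by linarith
    also have "\<dots> \<le> d y * (1 + ?H * \<bar>x - y\<bar>)"
    proof -
      have "L * \<bar>x - y\<bar> = m * (?H * \<bar>x - y\<bar>)" using m by simp
      also have "\<dots> \<le> d y * (?H * \<bar>x - y\<bar>)" using y H by (intro mult_right_mono mult_nonneg_nonneg) auto
      finally show ?thesis by (simp add: distrib_left)
    qed
    also have "\<dots> \<le> d y * exp (?H * \<bar>x - y\<bar>)" using y m exp_ge_add_one_self by (intro mult_left_mono) auto
    finally show ?thesis by simp
  qed
  have mv: "\<exists>\<xi>. x \<le> \<xi> \<and> \<xi> \<le> y \<and> T y - T x = d \<xi> * (y - x)"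
    if "b k \<le> x" "x \<le> y" "y < b (Suc k)" for k x y
  proof (cases "x = y")
    case False
    then show ?thesis using mean_value[of k x y] that by (metis less_eq_real_def)
  qed auto
  have lower: "d x * exp (- ?H * (y - x)) \<le> d \<xi>" and upper: "d \<xi> \<le> d x * exp (?H * (y - x))" and ge_m: "m \<le> d \<xi>"
    if "b k \<le> x" "x \<le> \<xi>" "\<xi> \<le> y" "y < b (Suc k)" "y \<le> R" for x \<xi> y k
  proof -
    have dx: "0 < d x" "0 < d \<xi>" using ge[of x] ge[of \<xi>] m that b_nonneg[of k] by auto
    show "m \<le> d \<xi>" using ge[of \<xi>] that b_nonneg[of k] by auto
    have "?H * \<bar>x - \<xi>\<bar> \<le> ?H * (y - x)" using that H by (intro mult_left_mono) auto
    then have e: "exp (?H * \<bar>x - \<xi>\<bar>) \<le> exp (?H * (y - x))" by simp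
    have "d x \<le> d \<xi> * exp (?H * \<bar>x - \<xi>\<bar>)" using that by (intro ratio[of _ k]) auto
    also have "\<dots> \<le> d \<xi> * exp (?H * (y - x))" using e dx by (intro mult_left_mono) auto
    finally show "d x * exp (- ?H * (y - x)) \<le> d \<xi>" by (simp add: exp_minus field_simps)
    have "d \<xi> \<le> d x * exp (?H * \<bar>\<xi> - x\<bar>)" using that by (intro ratio[of _ k]) auto
    also have "\<dots> \<le> d x * exp (?H * (y - x))" using e dx by (intro mult_left_mono) (auto simp: abs_minus_commute)
    finally show "d \<xi> \<le> d x * exp (?H * (y - x))" .
  qed
  show ?thesis
  proof unfold_locales
    show "T (b k) = 0" for k by (rule zero)
    show "0 \<le> T y \<and> T y \<le> 1" if "0 \<le> y" for y using range[OF that] by simp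
    show "continuous_on {b k..<b (Suc k)} T" for k
      using deriv_within[of _ k] by (intro DERIV_continuous_on)
    show "0 < m" by (rule m)
    show "0 \<le> L / m" by (rule H)
    show "m \<le> d x" if "0 \<le> x" "x \<le> R" for x using ge that .
    fix k x y assume xy: "b k \<le> x" "x \<le> y" "y < b (Suc k)" "y \<le> R"
    obtain \<xi> where \<xi>: "x \<le> \<xi>" "\<xi> \<le> y" "T y - T x = d \<xi> * (y - x)" using mv[OF xy(1-3)] by blast
    show "m * (y - x) \<le> T y - T x" unfolding \<xi>(3)
      using ge_m[OF xy(1) \<xi>(1,2) xy(3,4)] xy by (intro mult_right_mono) auto
    show "d x * exp (- ?H * (y - x)) * (y - x) \<le> T y - T x" unfolding \<xi>(3)
      using lower[OF xy(1) \<xi>(1,2) xy(3,4)] xy by (intro mult_right_mono) auto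
    show "T y - T x \<le> d x * exp (?H * (y - x)) * (y - x)" unfolding \<xi>(3)
      using upper[OF xy(1) \<xi>(1,2) xy(3,4)] xy by (intro mult_right_mono) auto
    show "d x * exp (- ?H * (y - x)) \<le> d y" using lower[OF xy(1,2) order_refl xy(3,4)] .
    show "d y \<le> d x * exp (?H * (y - x))" using upper[OF xy(1,2) order_refl xy(3,4)] .
  qed
qed

text \<open>Expansion is uniform only locally in the parameter; the rational windows form a countable cover.\<close>

lemma ex_rational_window:
  assumes a: "1 < a" and inf: "1 < (INF x\<in>{0..1}. ereal (right_deriv (\<lambda>x. T (a * x)) x))"
  shows "\<exists>p\<in>\<rat>. \<exists>q\<in>\<rat>. 1 < p \<and> p < a \<and> a < q \<and> (\<exists>m. 1 < p * m \<and> (\<forall>y. 0 \<le> y \<longrightarrow> y \<le> q \<longrightarrow> m \<le> d y))"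
proof -
  obtain r where r: "1 < ereal r" "ereal r < (INF x\<in>{0..1}. ereal (right_deriv (\<lambda>x. T (a * x)) x))"
    using ereal_dense2[OF inf] by blast
  have ge: "r / a < d y" if "0 \<le> y" "y \<le> a" for y
  proof -
    have "y / a \<in> {0..1}" using that a by auto
    from less_INF_D[OF r(2) this] have "r < right_deriv (\<lambda>x. T (a * x)) (y / a)" by simp
    also have "\<dots> = a * d (a * (y / a))" using that a by (intro right_deriv_scaled) auto
    finally have "r < a * d y" using a by simp
    then show ?thesis using a by (simp add: field_simps)
  qed
  have r1: "1 < r" using r(1) by (simp add: one_ereal_def)
  \<comment> \<open>The midpoint of \<open>1 / a\<close> and \<open>r / a\<close>: still expanding
    at \<open>a\<close>, yet strictly below the derivative bound, which leaves room for larger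
    parameters.\<close>
  define m where "m = (1 + r) / (2 * a)"
  have m: "1 < a * m" "m < r / a" "0 < m" using r1 a by (auto simp: m_def field_simps)
  \<comment> \<open>Below \<open>q0\<close> the argument stays in the branch of \<open>a\<close>,
    and the Lipschitz bound lowers the derivative by at most \<open>r / a - m\<close>.\<close>
  define q0 where "q0 = min (b (Suc (branch a))) (a + (r / a - m) / L)"
  have "a < q0" using less_b_Suc_branch[of a] m L_pos by (simp add: q0_def)
  then obtain q where q: "q \<in> \<rat>" "a < q" "q < q0" using Rats_dense_in_real by blast
  have "max 1 (1 / m) < a" using a m by (simp add: field_simps)
  then obtain p where p: "p \<in> \<rat>" "max 1 (1 / m) < p" "p < a" using Rats_dense_in_real by blast
  have "m \<le> d y" if y: "0 \<le> y" "y \<le> q" for y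
  proof (cases "y \<le> a")
    case True
    then show ?thesis using ge[OF y(1)] m by simp
  next
    case False
    have in_a: "a \<in> {b (branch a)..<b (Suc (branch a))}" using in_branch a by simp
    have in_y: "y \<in> {b (branch a)..<b (Suc (branch a))}" using in_a False y q by (auto simp: q0_def)
    have "\<bar>d a - d y\<bar> \<le> L * \<bar>a - y\<bar>" by (rule d_lipschitz[OF in_a in_y])
    moreover have "L * \<bar>a - y\<bar> \<le> L * ((r / a - m) / L)"
      using False y q L_pos by (intro mult_left_mono) (auto simp: q0_def)
    moreover have "L * ((r / a - m) / L) = r / a - m" using L_pos by simp
    moreover have "r / a < d a" using ge[of a] a by simp
    ultimately show ?thesis by linarith
  qed
  moreover have "1 < p * m" using p m by (simp add: field_simps)
  ultimately show ?thesis using p q by (intro bexI[of _ p] bexI[of _ q] conjI exI[of _ m]) auto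
qed

end

locale parameter_curve = piecewise_C11 b T L for b T L +
  fixes X :: "real \<Rightarrow> real"
  assumes X_range: "1 < a \<Longrightarrow> 0 < X a \<and> X a \<le> 1"
    and X_C1: "X C1_differentiable_on {1<..}"
    and X_deriv_nonneg: "1 < a \<Longrightarrow> 0 \<le> deriv X a"
begin

section \<open>The curve \<open>X\<close> on a compact parameter window\<close>

lemma X_increment:
  assumes "1 < p"
  obtains B where "0 \<le> B" "\<And>s t. p \<le> s \<Longrightarrow> s \<le> t \<Longrightarrow> t \<le> q \<Longrightarrow> 0 \<le> X t - X s \<and> X t - X s \<le> B * (t - s)"
proof -
  obtain X' where X': "\<And>a. 1 < a \<Longrightarrow> (X has_real_derivative X' a) (at a)" "continuous_on {1<..} X'"
    using X_C1 by (auto simp: C1_differentiable_on_def has_real_derivative_iff_has_vector_derivative)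
  have nonneg: "0 \<le> X' a" if "1 < a" for a using X_deriv_nonneg[OF that] DERIV_imp_deriv[OF X'(1)[OF that]] by simp
  have "continuous_on {p..q} X'" by (rule continuous_on_subset[OF X'(2)]) (use assms in auto)
  then have "bounded (X' ` {p..q})" by (intro compact_imp_bounded compact_continuous_image) auto
  then obtain B where B: "\<forall>z\<in>X' ` {p..q}. \<bar>z\<bar> \<le> B" unfolding bounded_real by blast
  have "0 \<le> X t - X s \<and> X t - X s \<le> max 0 B * (t - s)" if st: "p \<le> s" "s \<le> t" "t \<le> q" for s t
  proof (cases "s = t")
    case False
    then have "s < t" using st by simp
    then obtain z where z: "s < z" "z < t" "X t - X s = (t - s) * X' z"
      using MVT2[of s t X X'] X'(1) st assms by (metis less_le_trans)
    have "0 \<le> X' z" "X' z \<le> max 0 B" using nonneg[of z] B z st assms by (auto simp: abs_le_iff image_iff le_max_iff_disj)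
    then show ?thesis using z st by (auto simp: mult.commute intro!: mult_left_mono)
  qed simp
  then show ?thesis using that[of "max 0 B"] by auto
qed

lemma AE_typical_window:
  assumes p: "1 < p" "p < q" and m: "1 < p * m" and ge: "\<forall>y. 0 \<le> y \<longrightarrow> y \<le> q \<longrightarrow> m \<le> d y"
  shows "AE a in lborel. p < a \<and> a < q \<longrightarrow> typical (\<lambda>x. T (a * x)) (acip (\<lambda>x. T (a * x))) (X a)"
proof -
  have m_pos: "0 < m" using m p by (meson less_trans zero_less_mult_pos zero_less_one)
  obtain B where B: "0 \<le> B" "\<And>s t. p \<le> s \<Longrightarrow> s \<le> t \<Longrightarrow> t \<le> q \<Longrightarrow> 0 \<le> X t - X s \<and> X t - X s \<le> B * (t - s)"
    using X_increment[OF p(1)] by blast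
  have "expanding_branches T d b q m (L / m)" using m_pos ge by (intro expanding_branchesI) auto
  then interpret expanding_branches T d b q m "L / m" .
  \<comment> \<open>Here \<open>A = p\<close> and \<open>R = q\<close>. As \<open>X\<close> is
    nondecreasing, \<open>s * X s\<close> grows at least at the rate \<open>X p > 0\<close>, and at
    most at the rate \<open>1 + q * B\<close>.\<close>
  interpret F: expanding_family T d b q m "L / m" "\<lambda>s. s" "\<lambda>s. s * X s" p q p "X p" "1 + q * B"
  proof unfold_locales
    show "0 < X p" using X_range p by simp
    fix s t assume st: "p \<le> s" "s \<le> t" "t < q"
    have eq: "t * X t - s * X s = (t - s) * X t + s * (X t - X s)" by (simp add: algebra_simps)
    note inc = B(2)[OF st(1,2) less_imp_le[OF st(3)]]
    have "(t - s) * X p \<le> (t - s) * X t" using B(2)[of p t] st by (intro mult_left_mono) auto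
    moreover have "0 \<le> s * (X t - X s)" using inc st p by (intro mult_nonneg_nonneg) auto
    ultimately show "X p * (t - s) \<le> t * X t - s * X s" unfolding eq by (simp add: mult.commute)
    have "(t - s) * X t \<le> (t - s) * 1" using X_range[of t] st p by (intro mult_left_mono) auto
    moreover have "s * (X t - X s) \<le> q * (B * (t - s))" using inc st p by (intro mult_mono) auto
    ultimately show "t * X t - s * X s \<le> (1 + q * B) * (t - s)" unfolding eq by (simp add: algebra_simps)
  next
    fix s assume s: "p \<le> s" "s < q"
    then have "0 < X s" "X s \<le> 1" using X_range[of s] p by auto
    then have "s * X s \<le> s * 1" "0 \<le> s * X s" using s p by (auto intro!: mult_left_mono)
    then show "0 \<le> s * X s \<and> s * X s \<le> q" using s by auto
  qed (use p m in auto)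
  \<comment> \<open>The visit constant \<open>2 * F.C3 * F.C4\<close> times the 3 from
    \<open>trapezoid_eq_0\<close>.\<close>
  define K where "K = 6 * F.C3 * F.C4"
  have K: "0 \<le> K" using F.C3_pos F.C4_pos by (simp add: K_def)
  have y: "F.y n s = s * ((\<lambda>x. T (s * x)) ^^ n) (X s)" for n s by (induction n) auto
  have visits: "AE s in lborel. p \<le> s \<and> s < q \<longrightarrow>
      (\<forall>\<^sub>F n in sequentially. (\<Sum>j<n. trapezoid u v (T (F.y j s))) \<le> K * (v - u) * n)" if uv: "u < v" for u v
  proof -
    have "AE s in lborel. p \<le> s \<and> s < q \<longrightarrow> (\<forall>\<^sub>F n in sequentially. (\<Sum>j<n. trapezoid u v (T (F.y j s)))
        \<le> 2 * F.C3 * F.C4 * ((v + (v - u)) - (u - (v - u))) * n)"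
    proof (rule F.AE_eventually_visits_le)
      show "\<bar>trapezoid u v z - trapezoid u v x\<bar> \<le> 2 / (v - u) * (z - x)" if "x \<le> z" for x z
        using trapezoid_lipschitz[OF uv, of z x] that by simp
      show "trapezoid u v x = 0" if "x \<notin> {u - (v - u)..v + (v - u)}" for x
        using trapezoid_eq_0[OF uv that] .
    qed (use uv trapezoid_range trapezoid_measurable in auto)
    also have "2 * F.C3 * F.C4 * ((v + (v - u)) - (u - (v - u))) = K * (v - u)"
      by (simp add: K_def algebra_simps)
    finally show ?thesis .
  qed
  have "AE s in lborel. \<forall>u\<in>\<rat>. \<forall>v\<in>\<rat>. u < v \<longrightarrow> (p \<le> s \<and> s < q \<longrightarrow>
      (\<forall>\<^sub>F n in sequentially. (\<Sum>j<n. trapezoid u v (T (F.y j s))) \<le> K * (v - u) * n))"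
    using visits by (intro AE_ball_countable' countable_rat) (auto intro: AE_I2)
  then show ?thesis
  proof (rule AE_mp, intro AE_I2 impI)
    fix s assume vis: "\<forall>u\<in>\<rat>. \<forall>v\<in>\<rat>. u < v \<longrightarrow> (p \<le> s \<and> s < q \<longrightarrow>
      (\<forall>\<^sub>F n in sequentially. (\<Sum>j<n. trapezoid u v (T (F.y j s))) \<le> K * (v - u) * n))" and s: "p < s \<and> s < q"
    \<comment> \<open>The branch estimates again, with the cut-off lowered from \<open>q\<close> to
      the parameter \<open>s\<close>.\<close>
    have "expanding_branches T d b s m (L / m)" using m_pos ge s by (intro expanding_branchesI) auto
    moreover have "1 < s * m"
      using less_trans[OF m mult_strict_right_mono[OF conjunct1[OF s] m_pos]] .
    ultimately interpret S: scaled_map T d b s m "L / m"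
      using s p by (intro scaled_map.intro scaled_map_axioms.intro) auto
    have f: "S.f = (\<lambda>x. T (s * x))" by (simp add: fun_eq_iff S.f_def)
    interpret R: regular_orbit T d b s m "L / m" "X s" K
    proof (intro regular_orbit.intro S.scaled_map_axioms regular_orbit_axioms.intro)
      show "X s \<in> {0..1}" using X_range[of s] s p by auto
      show "0 \<le> K" by (rule K)
      fix u v :: real assume "u \<in> \<rat>" "v \<in> \<rat>" "u < v"
      then show "\<forall>\<^sub>F n in sequentially. (\<Sum>j<n. trapezoid u v ((S.f ^^ Suc j) (X s))) \<le> K * (v - u) * n"
        using vis s by (simp add: y f)
    qed
    show "typical (\<lambda>x. T (s * x)) (acip (\<lambda>x. T (s * x))) (X s)" using R.typical by (simp add: f)
  qed
qed

theorem AE_typical: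
  assumes inf: "\<And>a. 1 < a \<Longrightarrow> 1 < (INF x\<in>{0..1}. ereal (right_deriv (\<lambda>x. T (a * x)) x))"
  shows "AE a in lborel. 1 < a \<longrightarrow> typical (\<lambda>x. T (a * x)) (acip (\<lambda>x. T (a * x))) (X a)"
proof -
  let ?W = "\<lambda>p q. 1 < p \<and> p < q \<and> (\<exists>m. 1 < p * m \<and> (\<forall>y. 0 \<le> y \<longrightarrow> y \<le> q \<longrightarrow> m \<le> d y))"
  have "AE a in lborel. \<forall>p\<in>\<rat>. \<forall>q\<in>\<rat>. ?W p q \<longrightarrow>
      (p < a \<and> a < q \<longrightarrow> typical (\<lambda>x. T (a * x)) (acip (\<lambda>x. T (a * x))) (X a))"
  proof (intro AE_ball_countable' countable_rat)
    fix p q :: real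
    show "AE a in lborel. ?W p q \<longrightarrow>
      (p < a \<and> a < q \<longrightarrow> typical (\<lambda>x. T (a * x)) (acip (\<lambda>x. T (a * x))) (X a))"
    proof (cases "?W p q")
      case True
      then show ?thesis using AE_typical_window[of p q] by auto
    next
      case False
      show ?thesis by (rule AE_I2) (use False in blast)
    qed
  qed
  then show ?thesis
  proof (rule AE_mp, intro AE_I2 impI)
    fix a :: real assume W: "\<forall>p\<in>\<rat>. \<forall>q\<in>\<rat>. ?W p q \<longrightarrow>
      (p < a \<and> a < q \<longrightarrow> typical (\<lambda>x. T (a * x)) (acip (\<lambda>x. T (a * x))) (X a))" and a: "1 < a"
    obtain p q where "p \<in> \<rat>" "q \<in> \<rat>" "?W p q" "p < a" "a < q"
      using ex_rational_window[OF a inf[OF a]] by (metis less_trans)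
    then show "typical (\<lambda>x. T (a * x)) (acip (\<lambda>x. T (a * x))) (X a)" using W by blast
  qed
qed

end

theorem theorem1p1:
  fixes b :: "nat \<Rightarrow> real" and L :: real and T X :: "real \<Rightarrow> real"
  assumes "b 0 = 0" and "strict_mono b" and "filterlim b at_top sequentially"
    and "L > 0"
    and "\<forall>x\<ge>0. T x \<in> {0..1}"
    and "\<forall>x\<ge>0. continuous (at_right x) T"
    and "\<forall>k. C11_on L T {b k..<b (Suc k)}"
    and "\<forall>k. T (b k) = 0"
    and "\<forall>a>1. 1 < (INF x\<in>{0..1}. ereal (right_deriv (\<lambda>x. T (a * x)) x))"
    and "\<forall>a>1. (SUP x\<in>{0..1}. ereal (right_deriv (\<lambda>x. T (a * x)) x)) < \<infinity>"
    and "\<forall>a>1. 0 < X a \<and> X a \<le> 1"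
    and "X C1_differentiable_on {1<..}"
    and "\<forall>a>1. deriv X a \<ge> 0"
  shows "AE a in lebesgue. a > 1 \<longrightarrow> typical (\<lambda>x. T (a * x)) (acip (\<lambda>x. T (a * x))) (X a)"
proof -
  interpret parameter_curve b T L X
    using assms by unfold_locales auto
  show ?thesis using AE_typical assms(9) by (intro AE_completion) auto
qed

end
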